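(* Let $(T,\Sigma,\mu)$ be a complete, $\sigma$-finite, nonatomic measure space, let $Z$ be a separable reflexive Banach space, let $1\le p<\infty$, and let $q$ be the conjugate exponent of $p$. Let $S:T\rightrightarrows Z$ be a measurable multifunction with nonempty closed values, and let $\varphi:T\times Z\to\mathbb R\cup\{+\infty\}$ be a normal integrand, that is, $\varphi$ is measurable in $t\in T$ and proper lower semicontinuous in $u\in Z$. Assume that (i) $x_0$ is a local solution of the problem: minimize $I_\varphi[x]$ subject to $x\in\mathsf{Sel}_p(S)$, and $I_\varphi[x_0]\in\mathbb R$; (ii) for a.e. $t\in T$, the epigraph $\operatorname{epi}\varphi(t,\cdot)$ is compactly epi-Lipschitz at $(x_0(t),\varphi(t,x_0(t)))$; (iii) an arbitrary weight $\theta\in L^q(T)\cap L^\infty(T)$ with $\theta(t)>0$ a.e. is chosen. Then there exist $\xi\in L^q(T,Z^* )$ and $\eta\in L^\infty(T)$ such that (a) $0\le\eta(t)\le\theta(t)$ and $\|\xi(t)\|+\eta(t)=\theta(t)$ for a.e. $t\in T$; (b) $\int_T\langle\xi(t),v(t)\rangle\,d\mu(t)\le0$ for every $v\in\widehat{\mathbf T}_{\mathsf{Sel}_p(S)}(x_0)$; (c) $\int_T\langle\xi(t),w(t)\rangle\,d\mu(t)+\int_T\eta(t)\sigma(t)\,d\mu(t)\ge0$ for every $(w,\sigma)\in\widehat{\mathbf T}_{\mathsf{Sel}_{p,1}(t\mapsto\operatorname{epi}\varphi(t,\cdot))}\big(x_0(\cdot),\varphi(\cdot,x_0(\cdot))\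big)$.
   Context: $L^p(T,Z)$ is the Lebesgue--Bochner space; products carry the sum norm. A multifunction $S:T\rightrightarrows Z$ with nonempty closed values is measurable if $\{t:S(t)\cap U\neq\emptyset\}\in\Sigma$ for every open $U\subset Z$. The conjugate exponent is $q=\infty$ if $p=1$ and $1/p+1/q=1$ otherwise. $\mathsf{Sel}_p(S):=\{z\in L^p(T,Z):z(t)\in S(t)\text{ a.e.}\}$, and $$\mathsf{Sel}_{p,1}(t\mapsto\operatorname{epi}\varphi(t,\cdot)):=\{(w,a)\in L^p(T,Z)\times L^1(T): (w(t),a(t))\in\operatorname{epi}\varphi(t,\cdot)\text{ a.e.}\},$$ with $\operatorname{epi}\varphi(t,\cdot)=\{(u,\alpha)\in Z\times\mathbb R:\varphi(t,u)\le\alpha\}$. Upper integral functional: $I_\varphi[x]:=\inf\{\int_T\sigma\,d\mu:\sigma\in L^1(T),\ \sigma(t)\ge\varphi(t,x(t))\text{ a.e.}\}$ (with $\inf\emptyset=+\infty$). A local solution is a point $x_0\in\mathsf{Sel}_p(S)$ such that $I_\varphi[x_0]\le I_\varphi[x]$ for all $x\in\mathsf{Sel}_p(S)$ in some $L^p$-neighbourhood of $x_0$. Below $X$ is a Banach space with closed unit ball $\overline{\mathbf B}_X$. Compactly epi-Lipschitz: a closed set $A\subset X$ is compactly epi-Lipschitz at $a_0\in A$ if there exist $\varepsilon,\delta,\lambda>0$ and a compact set $K\subset X$ such that $\big(A\cap(a_0+\delta\overline{\mathbf B}_X)\big)+\eta\varepsilon\overline{\mathbf B}_X\subset A-\eta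 K$ for all $\eta\in[0,\lambda]$. Clarke tangent cone: for $C\subset X$ closed and $x\in C$, $\widehat{\mathbf T}_C(x)$ is the set of all $v\in X$ such that for every $\varepsilon>0$ there exist $\delta>0$, $\lambda>0$ such that $C\cap[y+\eta(v+\varepsilon\overline{\mathbf B}_X)]\ne\emptyset$ for every $y\in C\cap(x+\delta\overline{\mathbf B}_X)$ and every $\eta\in[0,\lambda]$. The cones in (b) and (c) are taken in $L^p(T,Z)$ and $L^p(T,Z)\times L^1(T)$ respectively.
   Formalization: "Measurable in t" is taken as joint measurability of φ in (t,u), the standard meaning of normal integrand; with measurability in t only for each fixed u, φ(·,x_0(·)) may be nonmeasurable and the cone in (c) undefined. *)

theory Defs
  imports "HOL-Analysis.Analysis" "HOL-Library.Function_Algebras"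
begin

instantiation "fun" :: (type, real_vector) real_vector
begin

definition "r *\<^sub>R f = (\<lambda>x. r *\<^sub>R f x)"

instance
  by standard (simp_all add: scaleR_fun_def fun_eq_iff scaleR_add_right scaleR_add_left)

end

definition reflexive_space :: "'z::real_normed_vector itself \<Rightarrow> bool" where
  "reflexive_space _ \<longleftrightarrow>
     (\<forall>F :: ('z \<Rightarrow>\<^sub>L real) \<Rightarrow>\<^sub>L real. \<exists>u::'z. \<forall>f. blinfun_apply F f = blinfun_apply f u)"

definition nonatomic :: "'a measure \<Rightarrow> bool" where
  "nonatomic M \<longleftrightarrow>
     (\<forall>A\<in>sets M. 0 < emeasure M A \<longrightarrow>
        (\<exists>B\<in>sets M. B \<subseteq> A \<and> 0 < emeasure M B \<and> emeasure M B < emeasure M A))"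

text \<open>
  Elements of the Lebesgue--Bochner spaces are represented by functions on the underlying type,
  not by classes modulo almost everywhere equality, so \<open>Lp_norm\<close> is only a seminorm.
  The dual \<open>'z \<Rightarrow>\<^sub>L real\<close> is not known to be second countable as a type, so strong (Bochner)
  measurability is spelled out instead of using \<^const>\<open>borel_measurable\<close>.
\<close>

definition strongly_measurable :: "'a measure \<Rightarrow> ('a \<Rightarrow> 'b::real_normed_vector) \<Rightarrow> bool" where
  "strongly_measurable M f \<longleftrightarrow>
     (\<exists>s. (\<forall>i. simple_function M (s i)) \<and> (AE t in M. (\<lambda>i. s i t) \<longlonglongrightarrow> f t))"

definition Lp_space :: "ereal \<Rightarrow> 'a measure \<Rightarrow> ('a \<Rightarrow> 'b::real_normed_vector) set" where
  "Lp_space p M = {f. strongly_measurable M f \<and>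
     (if p = \<infinity> then \<exists>C. AE t in M. norm (f t) \<le> C
      else integrable M (\<lambda>t. norm (f t) powr real_of_ereal p))}"

definition Lp_norm :: "real \<Rightarrow> 'a measure \<Rightarrow> ('a \<Rightarrow> 'b::real_normed_vector) \<Rightarrow> real" where
  "Lp_norm p M f = (\<integral>t. norm (f t) powr p \<partial>M) powr (1 / p)"

definition conjugate_exponent :: "real \<Rightarrow> ereal \<Rightarrow> bool" where
  "conjugate_exponent p q \<longleftrightarrow> (if p = 1 then q = \<infinity> else ereal (1 / p) + 1 / q = 1)"

definition measurable_multifunction ::
    "'a measure \<Rightarrow> ('a \<Rightarrow> 'z::topological_space set) \<Rightarrow> bool" where
  "measurable_multifunction M S \<longleftrightarrow>
     (\<forall>U. open U \<longrightarrow> {t \<in> space M. S t \<inter> U \<noteq> {}} \<in> sets M)"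

text \<open>
  Measurability of a normal integrand is joint measurability in \<open>(t, u)\<close>; measurability of each
  \<open>\<lambda>t. \<phi> t u\<close> alone would not make \<open>\<lambda>t. \<phi> t (x t)\<close> measurable for measurable \<open>x\<close>.
\<close>

definition normal_integrand ::
    "'a measure \<Rightarrow> ('a \<Rightarrow> 'z::topological_space \<Rightarrow> ereal) \<Rightarrow> bool" where
  "normal_integrand M \<phi> \<longleftrightarrow>
     (\<lambda>(t, u). \<phi> t u) \<in> borel_measurable (M \<Otimes>\<^sub>M borel) \<and>
     (\<forall>t\<in>space M.
        (\<forall>u. \<phi> t u \<noteq> -\<infinity>) \<and> (\<exists>u. \<phi> t u \<noteq> \<infinity>) \<and> (\<forall>u. \<phi> t u \<le> Liminf (at u) (\<phi> t)))"

definition epi :: "('z \<Rightarrow> ereal) \<Rightarrow> ('z \<times> real) set" where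
  "epi f = {(u, \<alpha>). f u \<le> ereal \<alpha>}"

definition Sel :: "real \<Rightarrow> 'a measure \<Rightarrow> ('a \<Rightarrow> 'z::real_normed_vector set) \<Rightarrow> ('a \<Rightarrow> 'z) set" where
  "Sel p M S = {z \<in> Lp_space (ereal p) M. AE t in M. z t \<in> S t}"

definition Sel1 ::
    "real \<Rightarrow> 'a measure \<Rightarrow> ('a \<Rightarrow> ('z::real_normed_vector \<times> real) set) \<Rightarrow>
     (('a \<Rightarrow> 'z) \<times> ('a \<Rightarrow> real)) set" where
  "Sel1 p M E = {(w, a). w \<in> Lp_space (ereal p) M \<and> a \<in> Lp_space 1 M \<and> (AE t in M. (w t, a t) \<in> E t)}"

definition upper_integral_functional ::
    "'a measure \<Rightarrow> ('a \<Rightarrow> 'z \<Rightarrow> ereal) \<Rightarrow> ('a \<Rightarrow> 'z) \<Rightarrow> ereal" where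
  "upper_integral_functional M \<phi> x =
     Inf {ereal (\<integral>t. \<sigma> t \<partial>M) |\<sigma>. \<sigma> \<in> Lp_space 1 M \<and> (AE t in M. \<phi> t (x t) \<le> ereal (\<sigma> t))}"

definition local_solution ::
    "real \<Rightarrow> 'a measure \<Rightarrow> ('a \<Rightarrow> 'z \<Rightarrow> ereal) \<Rightarrow> ('a \<Rightarrow> 'z::real_normed_vector set) \<Rightarrow>
     ('a \<Rightarrow> 'z) \<Rightarrow> bool" where
  "local_solution p M \<phi> S x0 \<longleftrightarrow> x0 \<in> Sel p M S \<and>
     (\<exists>r>0. \<forall>x\<in>Sel p M S. Lp_norm p M (x - x0) < r \<longrightarrow>
        upper_integral_functional M \<phi> x0 \<le> upper_integral_functional M \<phi> x)"

definition sum_norm :: "('v \<Rightarrow> real) \<Rightarrow> ('w \<Rightarrow> real) \<Rightarrow> 'v \<times> 'w \<Rightarrow> real" where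
  "sum_norm N N' = (\<lambda>(v, w). N v + N' w)"

text \<open>
  The norm \<open>N\<close> is an explicit argument because the norm of the product type is the Euclidean
  one. It is meant to be equivalent to the norm of the type, which provides the topology for
  \<^const>\<open>closed\<close> and \<^const>\<open>compact\<close>.
\<close>

definition compactly_epi_Lipschitz_at ::
    "('v::real_normed_vector \<Rightarrow> real) \<Rightarrow> 'v set \<Rightarrow> 'v \<Rightarrow> bool" where
  "compactly_epi_Lipschitz_at N A a0 \<longleftrightarrow> closed A \<and> a0 \<in> A \<and>
     (\<exists>\<epsilon>>0. \<exists>\<delta>>0. \<exists>l>0. \<exists>K. compact K \<and>
        (\<forall>\<eta>\<in>{0..l}.
           {a + (\<eta> * \<epsilon>) *\<^sub>R b |a b. a \<in> A \<and> N (a - a0) \<le> \<delta> \<and> N b \<le> 1}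
             \<subseteq> {a - \<eta> *\<^sub>R k |a k. a \<in> A \<and> k \<in> K}))"

text \<open>
  The ambient space is the subspace \<open>X\<close> of the type, with (semi)norm \<open>N\<close>.
\<close>

definition Clarke_tangent_cone ::
    "'v::real_vector set \<Rightarrow> ('v \<Rightarrow> real) \<Rightarrow> 'v set \<Rightarrow> 'v \<Rightarrow> 'v set" where
  "Clarke_tangent_cone X N C x =
     {v \<in> X. \<forall>\<epsilon>>0. \<exists>\<delta>>0. \<exists>l>0. \<forall>y\<in>C. N (y - x) \<le> \<delta> \<longrightarrow>
        (\<forall>\<eta>\<in>{0..l}. \<exists>b\<in>X. N b \<le> 1 \<and> y + \<eta> *\<^sub>R (v + \<epsilon> *\<^sub>R b) \<in> C)}"

end

theory Submission
  imports Defs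
begin

text \<open>
  On a nonatomic space a local solution is optimal pointwise: for almost every \<open>t\<close>, \<open>x0 t\<close>
  minimizes \<open>\<phi> t\<close> over \<open>S t\<close>, since values of \<open>x0\<close> may be changed arbitrarily on small sets of
  positive measure. Thus the epigraph of \<open>\<phi> t\<close> and the product of \<open>S t\<close> with a half-line are extremal
  at \<open>(x0 t, \<phi> t (x0 t))\<close>, and because the epigraph is compactly epi-Lipschitz an Ekeland argument
  shows that the difference of their Clarke tangent cones is not dense; any nonzero functional in
  its polar is a multiplier at \<open>t\<close>, and it can be scaled to norm \<open>\<theta> t\<close>.

  The Clarke tangent cones in \<open>L\<^sup>p\<close> only control tangency in measure, with the same step for all
  \<open>t\<close>. Still, a Clarke tangent vector \<open>v\<close> of the set of selections satisfies \<open>v t\<close> in the Clarke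
  tangent cone of \<open>S t\<close> almost everywhere, by a drop argument: failure of tangency at one scale
  yields a nearby point at which it fails at all smaller scales. So it remains to choose the
  multiplier measurably. A Hiai--Umegaki sequence of selections of the pointwise cones reduces the
  polar to countably many conditions, and a Hahn--Banach extension along a dense sequence is
  measurable in \<open>t\<close> by construction.
\<close>

section \<open>Sublinear functionals and separable duals\<close>

text \<open>Measurability is the obstacle behind most of the length. The dependence of the Clarke
  cones on \<open>t\<close> is never shown to be measurable; only countable data built from their
  measurable selections are used. The sets of \<open>t\<close> at which \<open>S t\<close> offers a
  better value than \<open>x0 t\<close>, or at which tangency fails near \<open>x0 t\<close>, are
  projections of product-measurable sets. Hence the measurable projection and selection theorem is
  proved on the way, and completeness of the measure absorbs the null sets that it leaves. The
  extremal principle excludes density of the difference of the cones, which is more than a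
  difference unequal to the whole space: only a point at positive distance from a convex cone yields
  a bounded functional that is nonzero and nonpositive on the cone. Reflexivity serves to make the
  dual separable, so that functionals that depend measurably on \<open>t\<close> at each fixed
  vector form a strongly measurable map.\<close>

lemma dense_sequence:
  obtains d :: "nat \<Rightarrow> 'a::{metric_space, second_countable_topology}"
  where "\<And>w r. 0 < r \<Longrightarrow> \<exists>i. dist w (d i) < r"
proof -
  obtain D :: "'a set" where D: "countable D" "\<And>U. open U \<Longrightarrow> U \<noteq> {} \<Longrightarrow> \<exists>d\<in>D. d \<in> U"
    by (erule countable_dense_setE)
  have "D \<noteq> {}" using D(2)[of UNIV] by auto
  show ?thesis
  proof (rule that)
    show "\<exists>i. dist w (from_nat_into D i) < r" if "0 < r" for w r
      using D(2)[of "ball w r"] that \<open>D \<noteq> {}\<close> from_nat_into_surj[OF D(1)]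
      by (metis ball_eq_empty mem_ball not_less open_ball)
  qed
qed

lemma closure_range_dense:
  assumes "\<And>w r. 0 < r \<Longrightarrow> \<exists>i. dist w (d i) < r"
  shows "closure (range d) = UNIV"
  using assms by (auto simp: closure_approachable dist_commute)

text \<open>Homogeneity is asked only for natural multiples, which is what countable infima such as
  \<open>linearize\<close> preserve directly; real homogeneity returns in
  \<open>sublin_imp_bounded_linear\<close>. The norm bound also bounds \<open>p\<close> from below,
  so all infima are finite, and it makes \<open>p\<close> 1-Lipschitz, so that information on a
  dense set is enough.\<close>

definition sublin :: "('v::real_normed_vector \<Rightarrow> real) \<Rightarrow> bool" where
  "sublin p \<longleftrightarrow> (\<forall>x y. p (x + y) \<le> p x + p y) \<and> (\<forall>n::nat. \<forall>x. p (real n *\<^sub>R x) = real n * p x) \<and>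
     (\<forall>x. p x \<le> norm x)"

lemma sublinD:
  assumes "sublin p"
  shows "p (x + y) \<le> p x + p y" "p (real n *\<^sub>R x) = real n * p x" "p x \<le> norm x"
  using assms unfolding sublin_def by blast+

lemma sublin_0: "sublin p \<Longrightarrow> p 0 = 0"
  using sublinD(2)[of p 0 0] by simp

lemma sublin_uminus_le: "sublin p \<Longrightarrow> - p (- x) \<le> p x"
  using sublinD(1)[of p x "- x"] sublin_0[of p] by simp

lemma sublin_ge: "sublin p \<Longrightarrow> - norm x \<le> p x"
  using sublin_uminus_le[of p x] sublinD(3)[of p "- x"] by simp

lemma sublin_Lipschitz: "sublin p \<Longrightarrow> \<bar>p x - p y\<bar> \<le> norm (x - y)"
  using sublinD(1)[of p "x - y" y] sublinD(1)[of p "y - x" x]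
    sublinD(3)[of p "x - y"] sublinD(3)[of p "y - x"]
  by (simp add: norm_minus_commute abs_le_iff)

text \<open>Subadditivity of an infimum needs one member below any two that are used at
  \<open>x\<close> and at \<open>y\<close>; this is the directedness. It covers both the chains of
  Zorn's lemma and the decreasing sequences of the measurable construction.\<close>

lemma sublin_INF:
  fixes p :: "'i \<Rightarrow> 'v::real_normed_vector \<Rightarrow> real"
  assumes "I \<noteq> {}" and p: "\<And>i. i \<in> I \<Longrightarrow> sublin (p i)"
    and directed: "\<And>i j. i \<in> I \<Longrightarrow> j \<in> I \<Longrightarrow> \<exists>k\<in>I. \<forall>x. p k x \<le> p i x \<and> p k x \<le> p j x"
  shows "sublin (\<lambda>x. INF i\<in>I. p i x)"
proof -
  have bdd: "bdd_below ((\<lambda>i. p i x) ` I)" for x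
    using p sublin_ge by (intro bdd_belowI2[of _ "- norm x"]) blast
  have lower: "(INF i\<in>I. p i x) \<le> p i x" if "i \<in> I" for i x
    using bdd that by (rule cINF_lower)
  have greatest: "c \<le> (INF i\<in>I. p i x)" if "\<And>i. i \<in> I \<Longrightarrow> c \<le> p i x" for c x
    using \<open>I \<noteq> {}\<close> that by (rule cINF_greatest)
  show ?thesis unfolding sublin_def
  proof (intro conjI allI)
    fix x y
    have "(INF i\<in>I. p i (x + y)) \<le> p i x + p j y" if i: "i \<in> I" and j: "j \<in> I" for i j
    proof -
      obtain k where k: "k \<in> I" "\<And>x. p k x \<le> p i x \<and> p k x \<le> p j x" using directed[OF i j] by blast
      have "(INF i\<in>I. p i (x + y)) \<le> p k (x + y)" by (rule lower[OF k(1)])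
      also have "\<dots> \<le> p k x + p k y" by (rule sublinD[OF p[OF k(1)]])
      also have "\<dots> \<le> p i x + p j y" using k(2) by (simp add: add_mono)
      finally show ?thesis .
    qed
    then have "(INF i\<in>I. p i (x + y)) - p j y \<le> (INF i\<in>I. p i x)" if "j \<in> I" for j
      using that by (intro greatest) (simp add: algebra_simps)
    then have "(INF i\<in>I. p i (x + y)) - (INF i\<in>I. p i x) \<le> (INF i\<in>I. p i y)"
      by (intro greatest) (simp add: algebra_simps)
    then show "(INF i\<in>I. p i (x + y)) \<le> (INF i\<in>I. p i x) + (INF i\<in>I. p i y)" by simp
  next
    fix n :: nat and x
    have eq: "p i (real n *\<^sub>R x) = real n * p i x" if "i \<in> I" for i
      by (rule sublinD[OF p[OF that]])
    show "(INF i\<in>I. p i (real n *\<^sub>R x)) = real n * (INF i\<in>I. p i x)"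
    proof (rule antisym)
      show "real n * (INF i\<in>I. p i x) \<le> (INF i\<in>I. p i (real n *\<^sub>R x))"
        using lower eq by (intro greatest) (simp add: mult_left_mono)
      show "(INF i\<in>I. p i (real n *\<^sub>R x)) \<le> real n * (INF i\<in>I. p i x)"
      proof (cases "n = 0")
        case True
        obtain i where "i \<in> I" using \<open>I \<noteq> {}\<close> by blast
        with lower[of i "0"] eq[of i] True show ?thesis by simp
      next
        case False
        have "(INF i\<in>I. p i (real n *\<^sub>R x)) / real n \<le> (INF i\<in>I. p i x)"
          using False lower[of _ "real n *\<^sub>R x"] eq by (intro greatest) (simp add: field_simps)
        then show ?thesis using False by (simp add: field_simps)
      qed
    qed
  next
    fix x
    obtain i where "i \<in> I" using \<open>I \<noteq> {}\<close> by blast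
    then show "(INF i\<in>I. p i x) \<le> norm x" using lower[of i x] sublinD(3)[OF p, of i x] by simp
  qed
qed

text \<open>The greatest functional below \<open>p\<close> that is additive along the ray of \<open>y\<close>. Natural multiples
  suffice because the expression decreases in \<open>n\<close>; this keeps the infimum countable.\<close>

definition linearize :: "('v::real_normed_vector \<Rightarrow> real) \<Rightarrow> 'v \<Rightarrow> 'v \<Rightarrow> real" where
  "linearize p y x = (INF n::nat. p (x + real n *\<^sub>R y) - real n * p y)"

context
  fixes p :: "'v::real_normed_vector \<Rightarrow> real" and y :: 'v
  assumes p: "sublin p"
begin

lemma linearize_bdd: "bdd_below (range (\<lambda>n. p (x + real n *\<^sub>R y) - real n * p y))"
proof (rule bdd_belowI2)
  fix n
  have "real n * p y \<le> p (x + real n *\<^sub>R y) + p (- x)"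
    using sublinD(1)[OF p, of "x + real n *\<^sub>R y" "- x"] sublinD(2)[OF p, of n y] by simp
  then show "- p (- x) \<le> p (x + real n *\<^sub>R y) - real n * p y" by simp
qed

lemma linearize_lower: "linearize p y x \<le> p (x + real n *\<^sub>R y) - real n * p y"
  unfolding linearize_def by (intro cINF_lower linearize_bdd) simp

lemma linearize_greatest:
  "(\<And>n. c \<le> p (x + real n *\<^sub>R y) - real n * p y) \<Longrightarrow> c \<le> linearize p y x"
  unfolding linearize_def by (rule cINF_greatest) auto

lemma linearize_le: "linearize p y x \<le> p x"
  using linearize_lower[of x 0] by simp

lemma linearize_uminus: "linearize p y (- y) \<le> - p y"
  using linearize_lower[of "- y" 1] sublin_0[OF p] by simp

lemma linearize_add: "linearize p y (x + z) \<le> linearize p y x + linearize p y z"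
proof -
  have "linearize p y (x + z) \<le> (p (x + real n *\<^sub>R y) - real n * p y) + (p (z + real m *\<^sub>R y) - real m * p y)"
    for n m
  proof -
    have "linearize p y (x + z) \<le> p ((x + z) + real (n + m) *\<^sub>R y) - real (n + m) * p y"
      by (rule linearize_lower)
    also have "(x + z) + real (n + m) *\<^sub>R y = (x + real n *\<^sub>R y) + (z + real m *\<^sub>R y)"
      by (simp add: algebra_simps)
    also have "p \<dots> \<le> p (x + real n *\<^sub>R y) + p (z + real m *\<^sub>R y)" by (rule sublinD[OF p])
    finally show ?thesis by (simp add: algebra_simps)
  qed
  then have "linearize p y (x + z) - (p (z + real m *\<^sub>R y) - real m * p y) \<le> linearize p y x" for m
    by (intro linearize_greatest) (simp add: algebra_simps)
  then have "linearize p y (x + z) - linearize p y x \<le> linearize p y z"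
    by (intro linearize_greatest) (simp add: algebra_simps)
  then show ?thesis by simp
qed

lemma sublin_linearize: "sublin (linearize p y)"
  unfolding sublin_def
proof (intro conjI allI)
  show "linearize p y (x + z) \<le> linearize p y x + linearize p y z" for x z
    by (rule linearize_add)
  have 0: "linearize p y 0 = 0"
  proof (rule antisym)
    show "linearize p y 0 \<le> 0" using linearize_le[of 0] sublin_0[OF p] by simp
    show "0 \<le> linearize p y 0" using sublinD(2)[OF p, of _ y] by (intro linearize_greatest) simp
  qed
  show "linearize p y (real n *\<^sub>R x) = real n * linearize p y x" for n x
  proof (rule antisym)
    show "linearize p y (real n *\<^sub>R x) \<le> real n * linearize p y x"
    proof (induct n)
      case (Suc n)
      then show ?case using linearize_add[of "real n *\<^sub>R x" x] by (simp add: algebra_simps)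
    qed (simp add: 0)
    \<comment> \<open>Scaling the \<open>m\<close>-th term by \<open>n\<close> produces
      \<open>n * m\<close> copies of \<open>y\<close>, while the \<open>m\<close>-th term at the
      scaled point has only \<open>m\<close>. The surplus of \<open>(n - 1) * m\<close> copies is
      split off by subadditivity and costs exactly its share of \<open>p y\<close>.\<close>
    show "real n * linearize p y x \<le> linearize p y (real n *\<^sub>R x)"
    proof (cases "n = 0")
      case False
      show ?thesis
      proof (rule linearize_greatest)
        fix m
        have "real n * linearize p y x \<le> real n * (p (x + real m *\<^sub>R y) - real m * p y)"
          by (intro mult_left_mono linearize_lower) simp
        also have "\<dots> = p (real n *\<^sub>R (x + real m *\<^sub>R y)) - real n * real m * p y"
          using sublinD(2)[OF p, of n "x + real m *\<^sub>R y"] by (simp add: algebra_simps)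
        also have "real n *\<^sub>R (x + real m *\<^sub>R y)
            = (real n *\<^sub>R x + real m *\<^sub>R y) + real ((n - 1) * m) *\<^sub>R y"
          using False by (simp add: algebra_simps of_nat_diff flip: scaleR_add_left)
        also have "p \<dots> \<le> p (real n *\<^sub>R x + real m *\<^sub>R y) + real ((n - 1) * m) * p y"
          using sublinD(1)[OF p] sublinD(2)[OF p, of "(n - 1) * m" y] by metis
        also have "p (real n *\<^sub>R x + real m *\<^sub>R y) + real ((n - 1) * m) * p y - real n * real m * p y
            = p (real n *\<^sub>R x + real m *\<^sub>R y) - real m * p y"
          using False by (simp add: algebra_simps of_nat_diff)
        finally show "real n * linearize p y x \<le> p (real n *\<^sub>R x + real m *\<^sub>R y) - real m * p y"
          by simp
      qed
    qed (simp add: 0)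
  qed
  show "linearize p y x \<le> norm x" for x
    using linearize_le sublinD(3)[OF p] by (rule order_trans)
qed

end

text \<open>Oddness passes from \<open>D\<close> to all vectors by continuity, and an odd
  subadditive function is additive.\<close>

lemma sublin_imp_bounded_linear:
  assumes p: "sublin p" and D: "closure D = UNIV" "\<And>x. x \<in> D \<Longrightarrow> p (- x) \<le> - p x"
  shows "bounded_linear p"
proof -
  have cont: "continuous_on UNIV p"
  proof (rule continuous_onI)
    fix x and e :: real assume "0 < e"
    then show "\<exists>d>0. \<forall>x'\<in>UNIV. dist x' x < d \<longrightarrow> dist (p x') (p x) \<le> e"
      using order_trans[OF sublin_Lipschitz[OF p] less_imp_le] by (intro exI[of _ e]) (auto simp: dist_norm)
  qed
  have "closed {x. p (- x) \<le> - p x}"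
    by (intro closed_Collect_le continuous_intros continuous_on_compose2[OF cont]) auto
  with D have "{x. p (- x) \<le> - p x} = UNIV"
    using closure_minimal[of D "{x. p (- x) \<le> - p x}"] by auto
  then have le: "p (- x) \<le> - p x" for x by blast
  then have minus: "p (- x) = - p x" for x
    using sublin_uminus_le[OF p, of x] by (metis minus_le_iff order_antisym)
  have add: "p (x + y) = p x + p y" for x y
    using sublinD(1)[OF p, of x y] sublinD(1)[OF p, of "- x" "- y"] minus[of "x + y"] minus[of x] minus[of y]
    by simp
  have scale: "p (r *\<^sub>R x) = r * p x" for r x
  proof -
    \<comment> \<open>Replacing \<open>real n * r\<close> by its floor \<open>k\<close> costs at
      most \<open>norm x\<close> in each of the two terms, uniformly in \<open>n\<close>, whereas a
      defect in real homogeneity would be multiplied by \<open>n\<close>.\<close>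
    have bound: "real n * \<bar>p (r *\<^sub>R x) - r * p x\<bar> \<le> 2 * norm x" for n
    proof -
      define k where "k = \<lfloor>real n * r\<rfloor>"
      have k: "\<bar>real n * r - of_int k\<bar> \<le> 1" unfolding k_def by linarith
      have int: "p (of_int k *\<^sub>R x) = of_int k * p x"
      proof (cases k)
        case (nonneg m)
        then show ?thesis using sublinD(2)[OF p, of m x] by simp
      next
        case (neg m)
        then have k: "real_of_int k = - real (Suc m)" by simp
        show ?thesis using sublinD(2)[OF p, of "Suc m" x] minus[of "real (Suc m) *\<^sub>R x"]
          unfolding k by (simp only: scaleR_minus_left mult_minus_left)
      qed
      have "real n * p (r *\<^sub>R x) - of_int k * p x = p ((real n * r) *\<^sub>R x) - p (of_int k *\<^sub>R x)"
        using sublinD(2)[OF p, of n "r *\<^sub>R x"] int by simp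
      then have "\<bar>real n * p (r *\<^sub>R x) - of_int k * p x\<bar> \<le> norm ((real n * r) *\<^sub>R x - of_int k *\<^sub>R x)"
        using sublin_Lipschitz[OF p, of "(real n * r) *\<^sub>R x" "of_int k *\<^sub>R x"] by simp
      also have "\<dots> = \<bar>real n * r - of_int k\<bar> * norm x"
        by (simp flip: scaleR_diff_left)
      also have "\<dots> \<le> norm x" using mult_right_mono[OF k norm_ge_zero[of x]] by simp
      finally have 1: "\<bar>real n * p (r *\<^sub>R x) - of_int k * p x\<bar> \<le> norm x" .
      have "\<bar>p x\<bar> \<le> norm x" using sublin_ge[OF p, of x] sublinD(3)[OF p, of x] by linarith
      then have "\<bar>(real n * r - of_int k) * p x\<bar> \<le> 1 * norm x"
        unfolding abs_mult using k by (intro mult_mono) auto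
      with 1 have "\<bar>(real n * p (r *\<^sub>R x) - of_int k * p x) - (real n * r - of_int k) * p x\<bar> \<le> 2 * norm x"
        by linarith
      moreover have "(real n * p (r *\<^sub>R x) - of_int k * p x) - (real n * r - of_int k) * p x
          = real n * (p (r *\<^sub>R x) - r * p x)" by (simp add: algebra_simps)
      ultimately show ?thesis by (simp add: abs_mult)
    qed
    have "\<bar>p (r *\<^sub>R x) - r * p x\<bar> = 0"
    proof (rule ccontr)
      assume "\<not> ?thesis"
      then obtain n where "2 * norm x < real n * \<bar>p (r *\<^sub>R x) - r * p x\<bar>"
        using reals_Archimedean3[of "\<bar>p (r *\<^sub>R x) - r * p x\<bar>"] by auto
      with bound[of n] show False by simp
    qed
    then show ?thesis by simp
  qed
  show ?thesis
  proof (rule bounded_linear_intro[of _ 1])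
    show "norm (p x) \<le> norm x * 1" for x
      using sublin_ge[OF p, of x] sublinD(3)[OF p, of x] by (simp add: abs_le_iff)
  qed (auto simp: add scale)
qed

text \<open>A minimal sublinear functional is unchanged by every \<open>linearize\<close>, hence
  odd, hence linear. Starting Zorn's lemma below \<open>linearize p y\<close> instead of
  \<open>p\<close> forces equality at \<open>y\<close>.\<close>

theorem Hahn_Banach_sublin:
  fixes p :: "'v::real_normed_vector \<Rightarrow> real"
  assumes p: "sublin p"
  shows "\<exists>f. bounded_linear f \<and> (\<forall>x. f x \<le> p x) \<and> f y = p y"
proof -
  define A where "A = {q. sublin q \<and> (\<forall>x. q x \<le> linearize p y x)}"
  have "\<exists>m\<in>A. \<forall>a\<in>A. a \<le> m \<longrightarrow> a = m"
  proof (rule predicate_Zorn)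
    show "partial_order_on A (relation_of (\<lambda>a b. b \<le> a) A)"
      by (rule partial_order_on_relation_ofI) auto
  next
    fix C assume C: "C \<in> Chains (relation_of (\<lambda>a b. b \<le> a) A)"
    then have CA: "C \<subseteq> A" and chain: "\<And>a b. a \<in> C \<Longrightarrow> b \<in> C \<Longrightarrow> a \<le> b \<or> b \<le> a"
      unfolding Chains_def relation_of_def by auto
    show "\<exists>u\<in>A. \<forall>a\<in>C. u \<le> a"
    proof (cases "C = {}")
      case True
      then show ?thesis using sublin_linearize[OF p, of y] by (auto simp: A_def)
    next
      case False
      have "sublin (\<lambda>x. INF q\<in>C. q x)"
      proof (rule sublin_INF[OF False])
        show "\<exists>k\<in>C. \<forall>x. k x \<le> i x \<and> k x \<le> j x" if "i \<in> C" "j \<in> C" for i j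
          using chain[OF that] that by (auto simp: le_fun_def)
      qed (use CA in \<open>auto simp: A_def\<close>)
      moreover have lower: "(INF q\<in>C. q x) \<le> q x" if "q \<in> C" for q x
      proof (rule cINF_lower[OF _ that])
        show "bdd_below ((\<lambda>q. q x) ` C)"
          using CA sublin_ge by (intro bdd_belowI2[of _ "- norm x"]) (auto simp: A_def)
      qed
      moreover obtain q where "q \<in> C" using False by blast
      ultimately have "(\<lambda>x. INF q\<in>C. q x) \<in> A"
        using CA order_trans[OF lower[OF \<open>q \<in> C\<close>]] by (auto simp: A_def)
      then show ?thesis using lower by (intro bexI[of _ "\<lambda>x. INF q\<in>C. q x"]) (auto simp: le_fun_def)
    qed
  qed
  then obtain f where f: "sublin f" "\<And>x. f x \<le> linearize p y x"
    and min: "\<And>q. q \<in> A \<Longrightarrow> q \<le> f \<Longrightarrow> q = f"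
    unfolding A_def by auto
  have "f (- x) \<le> - f x" for x
  proof -
    have "linearize f x \<in> A"
      using sublin_linearize[OF f(1), of x] order_trans[OF linearize_le[OF f(1)] f(2)] by (auto simp: A_def)
    then have "linearize f x = f" by (rule min) (simp add: le_fun_def linearize_le[OF f(1)])
    then show ?thesis using linearize_uminus[OF f(1), of x] by simp
  qed
  then have "bounded_linear f" by (intro sublin_imp_bounded_linear[OF f(1), of UNIV]) auto
  moreover have le: "f x \<le> p x" for x
    using f(2) linearize_le[OF p] by (rule order_trans)
  moreover have "p y \<le> f y"
    using f(2)[of "- y"] linearize_uminus[OF p, of y] linear_neg[OF bounded_linear.linear[OF \<open>bounded_linear f\<close>], of y]
    by simp
  ultimately show ?thesis by (metis order_antisym)
qed

text \<open>This turns separation into Hahn--Banach: a linear functional below the distance to a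
  cone is nonpositive on the cone and can be made equal to the distance at a chosen point.\<close>

lemma sublin_infdist:
  assumes "convex_cone C"
  shows "sublin (\<lambda>x. infdist x C)"
  unfolding sublin_def
proof (intro conjI allI)
  have ne: "C \<noteq> {}" by (rule convex_cone_nonempty[OF assms])
  show "infdist (x + y) C \<le> infdist x C + infdist y C" for x y
  proof -
    have "infdist (x + y) C \<le> dist x a + dist y b" if "a \<in> C" "b \<in> C" for a b
      using infdist_le[OF convex_cone_add[OF assms that], of "x + y"] dist_triangle_add[of x y a b] by simp
    then have "infdist (x + y) C - dist y b \<le> infdist x C" if "b \<in> C" for b
      using that unfolding infdist_notempty[OF ne, of x]
      by (intro cINF_greatest[OF ne]) (simp add: algebra_simps)
    then have "infdist (x + y) C - infdist x C \<le> infdist y C"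
      unfolding infdist_notempty[OF ne, of y] by (intro cINF_greatest[OF ne]) (simp add: algebra_simps)
    then show ?thesis by simp
  qed
  show "infdist x C \<le> norm x" for x
    using infdist_le[OF convex_cone_contains_0[OF assms], of x] by simp
  have *: "infdist (r *\<^sub>R x) C \<le> r * infdist x C" if "0 < r" for r x
  proof -
    have "infdist (r *\<^sub>R x) C / r \<le> infdist x C"
      unfolding infdist_notempty[OF ne, of x]
    proof (rule cINF_greatest[OF ne])
      fix a assume "a \<in> C"
      then have "infdist (r *\<^sub>R x) C \<le> dist (r *\<^sub>R x) (r *\<^sub>R a)"
        using that by (intro infdist_le convex_cone_scaleR[OF assms]) auto
      also have "\<dots> = r * dist x a"
        using that by (simp add: dist_norm flip: scaleR_diff_right)
      finally show "infdist (r *\<^sub>R x) C / r \<le> dist x a"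
        using that by (simp add: pos_divide_le_eq mult.commute)
    qed
    then show ?thesis using that by (simp add: field_simps)
  qed
  show "infdist (real n *\<^sub>R x) C = real n * infdist x C" for n x
  proof (cases "n = 0")
    case False
    then have "infdist (real n *\<^sub>R x) C \<le> real n * infdist x C" by (intro *) simp
    moreover have "infdist ((1 / real n) *\<^sub>R (real n *\<^sub>R x)) C \<le> 1 / real n * infdist (real n *\<^sub>R x) C"
      using False by (intro *) simp
    ultimately show ?thesis using False by (simp add: field_simps)
  qed (simp add: convex_cone_contains_0[OF assms])
qed

section \<open>Separability of the dual and strong measurability of functionals\<close>

lemma separable_span:
  fixes B :: "'v::real_normed_vector set"
  assumes "countable B"
  shows "\<exists>D. countable D \<and> closure D = closure (span B)"
proof -
  \<comment> \<open>Rational combinations of \<open>B\<close>, coded by finite lists so that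
    countability is immediate and sums are concatenations.\<close>
  define D where "D = (\<lambda>l. \<Sum>(q, b)\<leftarrow>l. real_of_rat q *\<^sub>R b) ` lists (UNIV \<times> B)"
  have "countable D" unfolding D_def using assms by auto
  have add: "x + y \<in> D" if xy: "x \<in> D" "y \<in> D" for x y
  proof -
    obtain l m where "l \<in> lists (UNIV \<times> B)" "m \<in> lists (UNIV \<times> B)"
      "x = (\<Sum>(q, b)\<leftarrow>l. real_of_rat q *\<^sub>R b)" "y = (\<Sum>(q, b)\<leftarrow>m. real_of_rat q *\<^sub>R b)"
      using xy unfolding D_def by blast
    then show ?thesis unfolding D_def by (intro image_eqI[of _ _ "l @ m"]) auto
  qed
  have scale: "real_of_rat r *\<^sub>R x \<in> D" if x: "x \<in> D" for x r
  proof -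
    obtain l where l: "l \<in> lists (UNIV \<times> B)" "x = (\<Sum>(q, b)\<leftarrow>l. real_of_rat q *\<^sub>R b)"
      using x unfolding D_def by blast
    have "real_of_rat r *\<^sub>R (\<Sum>(q, b)\<leftarrow>l. real_of_rat q *\<^sub>R b)
        = (\<Sum>(q, b)\<leftarrow>map (\<lambda>(q, b). (r * q, b)) l. real_of_rat q *\<^sub>R b)" for l :: "(rat \<times> 'v) list"
      by (induct l) (auto simp: scaleR_add_right of_rat_mult)
    with l show ?thesis unfolding D_def by (intro image_eqI[of _ _ "map (\<lambda>(q, b). (r * q, b)) l"]) auto
  qed
  have "subspace (closure D)"
  proof (rule subspaceI)
    have "0 \<in> D" unfolding D_def by (intro image_eqI[of _ _ "[]"]) auto
    then show "0 \<in> closure D" using closure_subset by blast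
  next
    fix x y assume "x \<in> closure D" "y \<in> closure D"
    moreover have "(\<lambda>z. fst z + snd z) ` closure (D \<times> D) \<subseteq> closure D"
      using add closure_subset by (intro image_closure_subset continuous_intros) fastforce+
    ultimately show "x + y \<in> closure D" by (force simp: closure_Times)
  next
    fix c :: real and x assume "x \<in> closure D"
    moreover have "(\<lambda>z. fst z *\<^sub>R snd z) ` closure (\<rat> \<times> D) \<subseteq> closure D"
    proof (intro image_closure_subset continuous_intros)
      show "(\<lambda>z. fst z *\<^sub>R snd z) ` (\<rat> \<times> D) \<subseteq> closure D"
        using scale closure_subset[of D] by (auto elim!: Rats_cases)
    qed simp
    moreover have "c \<in> closure \<rat>" using Rats_closure_real by auto
    ultimately show "c *\<^sub>R x \<in> closure D" by (force simp: closure_Times)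
  qed
  moreover have "B \<subseteq> D"
  proof
    fix b assume "b \<in> B"
    then show "b \<in> D" unfolding D_def by (intro image_eqI[of _ _ "[(1, b)]"]) auto
  qed
  ultimately have "span B \<subseteq> closure D"
    using closure_subset by (intro span_minimal) auto
  moreover have "D \<subseteq> span B"
  proof
    fix x assume "x \<in> D"
    then obtain l where l: "l \<in> lists (UNIV \<times> B)" "x = (\<Sum>(q, b)\<leftarrow>l. real_of_rat q *\<^sub>R b)"
      unfolding D_def by blast
    from l(1) have "(\<Sum>(q, b)\<leftarrow>l. real_of_rat q *\<^sub>R b) \<in> span B"
      by induct (auto intro: span_add span_scale span_base simp: span_zero)
    with l show "x \<in> span B" by simp
  qed
  ultimately have "closure D = closure (span B)"
    by (meson closure_minimal closure_mono closed_closure order_antisym)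
  with \<open>countable D\<close> show ?thesis by blast
qed

text \<open>The values on a dense sequence map the unit ball of the dual into a second countable
  space, so countably many members of the ball approximate all others pointwise. By reflexivity a
  bounded functional on the dual is evaluation at a vector, so one that vanishes on these members
  vanishes; Hahn--Banach then makes their span norm dense.\<close>

theorem separable_dual:
  assumes refl: "reflexive_space TYPE('z::{real_normed_vector, second_countable_topology})"
  shows "\<exists>D :: ('z \<Rightarrow>\<^sub>L real) set. countable D \<and> closure D = UNIV"
proof -
  obtain d :: "nat \<Rightarrow> 'z" where d: "\<And>w r. 0 < r \<Longrightarrow> \<exists>i. dist w (d i) < r"
    by (rule dense_sequence) (rule that)
  obtain \<B> :: "(nat \<Rightarrow> real) set set" where \<B>: "countable \<B>" "topological_basis \<B>"
    using ex_countable_basis by blast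
  define \<Phi> where "\<Phi> g = (\<lambda>n. blinfun_apply g (d n))" for g :: "'z \<Rightarrow>\<^sub>L real"
  define pick where "pick U = (SOME g. norm g \<le> 1 \<and> \<Phi> g \<in> U)" for U
  define B where "B = {pick U |U. U \<in> \<B> \<and> (\<exists>g. norm g \<le> 1 \<and> \<Phi> g \<in> U)}"
  have pick: "norm (pick U) \<le> 1 \<and> \<Phi> (pick U) \<in> U" if "\<exists>g. norm g \<le> 1 \<and> \<Phi> g \<in> U" for U
    unfolding pick_def using that by (rule someI_ex)
  have "countable B"
    unfolding B_def using \<B>(1) by (rule countable_subset[OF _ countable_image[of _ pick], rotated]) auto
  have vanish: "blinfun_apply g u = 0"
    if u: "\<And>b. b \<in> B \<Longrightarrow> blinfun_apply b u = 0" and g: "norm g \<le> 1" for g :: "'z \<Rightarrow>\<^sub>L real" and u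
  proof -
    have "\<bar>blinfun_apply g u\<bar> \<le> 0 + e" if "0 < e" for e
    proof -
      have *: "\<bar>blinfun_apply b u - blinfun_apply b (d n)\<bar> \<le> dist u (d n)" if "norm b \<le> 1"
        for b :: "'z \<Rightarrow>\<^sub>L real" and n
      proof -
        have "norm (blinfun_apply b (u - d n)) \<le> norm b * norm (u - d n)" by (rule norm_blinfun)
        also have "\<dots> \<le> 1 * norm (u - d n)" using that by (intro mult_right_mono) auto
        finally show ?thesis by (simp add: blinfun.diff_right dist_norm)
      qed
      obtain n where n: "dist u (d n) < e / 3" using d[of "e/3" u] \<open>0 < e\<close> by auto
      define W where "W = {x::nat \<Rightarrow> real. dist (x n) (\<Phi> g n) < e / 3}"
      have "open W" unfolding W_def
        by (intro open_Collect_less continuous_on_dist continuous_on_const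
            continuous_on_product_coordinates)
      moreover have "\<Phi> g \<in> W" using \<open>0 < e\<close> by (simp add: W_def)
      ultimately obtain U where U: "U \<in> \<B>" "\<Phi> g \<in> U" "U \<subseteq> W"
        using \<B>(2) by (meson topological_basisE)
      define b where "b = pick U"
      have b: "norm b \<le> 1" "\<Phi> b \<in> U" using pick[of U] g U unfolding b_def by auto
      have "b \<in> B" using U g unfolding B_def b_def by blast
      then have "blinfun_apply b u = 0" by (rule u)
      moreover have "\<bar>blinfun_apply b (d n) - blinfun_apply g (d n)\<bar> < e / 3"
        using b(2) U(3) by (auto simp: W_def \<Phi>_def dist_real_def)
      ultimately show ?thesis
        using *[OF b(1), of n] *[OF g, of n] n by linarith
    qed
    then have "\<bar>blinfun_apply g u\<bar> \<le> 0" by (rule field_le_epsilon)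
    then show ?thesis by simp
  qed
  have "closure (span B) = UNIV"
  proof (rule ccontr)
    assume "closure (span B) \<noteq> UNIV"
    then obtain f where "f \<notin> closure (span B)" by blast
    then have pos: "0 < infdist f (span B)"
      using in_closure_iff_infdist_zero[of "span B" f] infdist_nonneg[of f "span B"]
      by (metis empty_iff less_le span_zero)
    have "convex_cone (span B)"
      by (auto simp: convex_cone_iff span_zero span_add span_scale)
    from Hahn_Banach_sublin[OF sublin_infdist[OF this], of f] obtain F
      where F: "bounded_linear F" "\<And>x. F x \<le> infdist x (span B)" "F f = infdist f (span B)" by blast
    have ge: "F b \<le> 0" if "b \<in> span B" for b using F(2)[of b] that by simp
    obtain u where u: "\<And>g. F g = blinfun_apply g u"
      using refl F(1) unfolding reflexive_space_def by (metis bounded_linear_Blinfun_apply)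
    have "blinfun_apply b u = 0" if "b \<in> B" for b
      using ge[of b] ge[of "- b"] that by (simp add: u span_base span_neg blinfun.minus_left)
    then have "blinfun_apply ((1 / norm f) *\<^sub>R f) u = 0"
      by (rule vanish) auto
    moreover have "f \<noteq> 0" using \<open>f \<notin> closure (span B)\<close> span_zero closure_subset by blast
    ultimately have "F f = 0" by (simp add: u blinfun.scaleR_left)
    with pos F(3) show False by simp
  qed
  then show ?thesis using separable_span[OF \<open>countable B\<close>] by metis
qed

lemma norm_blinfun_le_iff_dense:
  assumes D: "closure D = UNIV" and "0 \<le> r"
  shows "norm f \<le> r \<longleftrightarrow> (\<forall>z\<in>D. norm (blinfun_apply f z) \<le> r * norm z)"
proof
  assume "norm f \<le> r"
  then show "\<forall>z\<in>D. norm (blinfun_apply f z) \<le> r * norm z"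
    by (meson mult_right_mono norm_blinfun norm_ge_zero order_trans)
next
  assume *: "\<forall>z\<in>D. norm (blinfun_apply f z) \<le> r * norm z"
  have "closed {z. norm (blinfun_apply f z) \<le> r * norm z}"
    by (intro closed_Collect_le continuous_intros)
  with * D have "{z. norm (blinfun_apply f z) \<le> r * norm z} = UNIV"
    using closure_minimal[of D "{z. norm (blinfun_apply f z) \<le> r * norm z}"] by auto
  then show "norm f \<le> r" using \<open>0 \<le> r\<close> by (intro norm_blinfun_bound) auto
qed

lemma norm_blinfun_measurable:
  fixes \<xi> :: "'a \<Rightarrow> 'z::{real_normed_vector, second_countable_topology} \<Rightarrow>\<^sub>L real"
  assumes "\<And>z. (\<lambda>t. blinfun_apply (\<xi> t) z) \<in> borel_measurable M"
  shows "(\<lambda>t. norm (\<xi> t)) \<in> borel_measurable M"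
proof -
  obtain d :: "nat \<Rightarrow> 'z" where "\<And>w r. 0 < r \<Longrightarrow> \<exists>i. dist w (d i) < r"
    by (rule dense_sequence) (rule that)
  then have "closure (range d) = UNIV" by (rule closure_range_dense)
  note iff = norm_blinfun_le_iff_dense[OF this]
  note [measurable] = assms
  show ?thesis unfolding borel_measurable_iff_le
  proof
    fix r
    show "{t \<in> space M. norm (\<xi> t) \<le> r} \<in> sets M"
    proof (cases "0 \<le> r")
      case True
      have "{t \<in> space M. \<forall>i. norm (blinfun_apply (\<xi> t) (d i)) \<le> r * norm (d i)} \<in> sets M"
        by measurable
      then show ?thesis by (simp add: iff[OF True])
    next
      case False
      then have "\<not> norm (\<xi> t) \<le> r" for t using norm_ge_zero[of "\<xi> t"] by linarith
      then show ?thesis by simp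
    qed
  qed
qed

text \<open>The best approximation of \<open>\<xi> t\<close> among the first \<open>i + 1\<close>
  points of a dense sequence of the dual takes finitely many values, and choosing the least index
  among ties keeps it measurable.\<close>

lemma strongly_measurable_blinfun:
  fixes \<xi> :: "'a \<Rightarrow> 'z::{real_normed_vector, second_countable_topology} \<Rightarrow>\<^sub>L real"
  assumes "reflexive_space TYPE('z)"
    and \<xi>: "\<And>z. (\<lambda>t. blinfun_apply (\<xi> t) z) \<in> borel_measurable M"
  shows "strongly_measurable M \<xi>"
proof -
  obtain D :: "('z \<Rightarrow>\<^sub>L real) set" where D: "countable D" "closure D = UNIV"
    using separable_dual[OF assms(1)] by blast
  define d where "d = from_nat_into D"
  have "D \<noteq> {}" using D(2) by auto
  have d: "\<exists>k. norm (f - d k) < e" if e: "0 < e" for f e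
  proof -
    have "f \<in> closure D" using D(2) by simp
    then obtain y where "y \<in> D" "dist y f < e" using e unfolding closure_approachable by blast
    then show ?thesis
      using from_nat_into_surj[OF D(1)] unfolding d_def by (metis dist_commute dist_norm)
  qed
  define best where "best i t k \<longleftrightarrow> k \<le> i \<and> (\<forall>j\<le>i. norm (\<xi> t - d k) \<le> norm (\<xi> t - d j))" for i t and k :: nat
  define \<kappa> where "\<kappa> i t = (LEAST k. best i t k)" for i t
  have best: "best i t (\<kappa> i t)" for i t
  proof -
    obtain k where "k \<in> {..i}" "\<forall>j\<in>{..i}. norm (\<xi> t - d k) \<le> norm (\<xi> t - d j)"
      using finite_imp_Sup_less[of "{..i}"] ex_is_arg_min_if_finite[of "{..i}" "\<lambda>j. norm (\<xi> t - d j)"]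
      unfolding is_arg_min_linorder by auto
    then have "\<exists>k. best i t k" unfolding best_def by auto
    then show ?thesis unfolding \<kappa>_def by (rule LeastI_ex)
  qed
  have [measurable]: "(\<lambda>t. norm (\<xi> t - d k)) \<in> borel_measurable M" for k
    by (intro norm_blinfun_measurable)
      (simp add: blinfun.diff_left borel_measurable_diff[OF \<xi> borel_measurable_const])
  have \<kappa>[measurable]: "\<kappa> i \<in> measurable M (count_space UNIV)" for i
    unfolding \<kappa>_def best_def by measurable
  have simple: "simple_function M (\<lambda>t. d (\<kappa> i t))" for i
  proof -
    have "finite (\<kappa> i ` space M)"
      by (rule finite_subset[of _ "{..i}"]) (use best in \<open>auto simp: best_def\<close>)
    then have "simple_function M (\<kappa> i)"
      unfolding simple_function_def using measurable_sets[OF \<kappa>] by auto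
    then show ?thesis by (rule simple_function_compose1)
  qed
  moreover have "(\<lambda>i. d (\<kappa> i t)) \<longlonglongrightarrow> \<xi> t" for t
  proof (rule LIMSEQ_I)
    fix e :: real assume "0 < e"
    then obtain k where k: "norm (\<xi> t - d k) < e" using d by blast
    have "norm (d (\<kappa> i t) - \<xi> t) < e" if "k \<le> i" for i
      using best[of i t] k that unfolding best_def by (metis le_less_trans norm_minus_commute)
    then show "\<exists>no. \<forall>i\<ge>no. norm (d (\<kappa> i t) - \<xi> t) < e" by blast
  qed
  ultimately show ?thesis
    unfolding strongly_measurable_def by (intro exI[of _ "\<lambda>i t. d (\<kappa> i t)"]) simp
qed

text \<open>Each step linearizes along one more vector of a dense sequence, so the limit is odd on a
  dense set. Every step is a countable infimum, which Zorn's lemma would not be, and so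
  measurability in \<open>t\<close> survives.\<close>

theorem measurable_Hahn_Banach:
  fixes p :: "'a \<Rightarrow> 'y::{real_normed_vector, second_countable_topology} \<Rightarrow> real"
  assumes p: "\<And>t. t \<in> space M \<Longrightarrow> sublin (p t)"
    and m: "\<And>x. (\<lambda>t. p t x) \<in> borel_measurable M"
  shows "\<exists>f. (\<forall>x. (\<lambda>t. f t x) \<in> borel_measurable M) \<and>
    (\<forall>t\<in>space M. bounded_linear (f t) \<and> (\<forall>x. f t x \<le> p t x) \<and> ((\<exists>x. 0 < p t x) \<longrightarrow> (\<exists>x. 0 < f t x)))"
proof -
  obtain d :: "nat \<Rightarrow> 'y" where "\<And>w r. 0 < r \<Longrightarrow> \<exists>i. dist w (d i) < r"
    by (rule dense_sequence) (rule that)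
  then have d: "closure (range d) = UNIV" by (rule closure_range_dense)
  \<comment> \<open>The first step freezes the value at \<open>y\<close>: it pushes the value at
    \<open>- y\<close> down to \<open>- p t y\<close> or below, later steps only decrease it
    further, and linearity of the limit turns this into a lower bound at \<open>y\<close>.\<close>
  define P where "P y t = rec_nat (linearize (p t) y) (\<lambda>i q. linearize q (d i))" for y t
  have P0: "P y t 0 = linearize (p t) y" and PS: "P y t (Suc i) = linearize (P y t i) (d i)" for y t i
    by (auto simp: P_def)
  define f where "f y t x = (INF i. P y t i x)" for y t x
  have P: "sublin (P y t i)" if "t \<in> space M" for y t i
    by (induct i) (auto simp: P0 PS intro!: sublin_linearize p that)
  have anti: "P y t j x \<le> P y t i x" if "t \<in> space M" "i \<le> j" for y t i j x
    using that(2) by (induct rule: dec_induct)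
      (auto simp: PS intro: order_trans[OF linearize_le[OF P[OF that(1)]]])
  have sub: "sublin (f y t)" if t: "t \<in> space M" for y t
    unfolding f_def
  proof (rule sublin_INF)
    show "\<exists>k\<in>UNIV. \<forall>x. P y t k x \<le> P y t i x \<and> P y t k x \<le> P y t j x" for i j
      using anti[OF t] by (intro bexI[of _ "max i j"]) auto
  qed (auto simp: P t)
  have f_le: "f y t x \<le> P y t i x" if "t \<in> space M" for y t i x
    unfolding f_def by (intro cINF_lower bdd_belowI2[of _ "- norm x"] sublin_ge P that) auto
  have lin: "bounded_linear (f y t)" if t: "t \<in> space M" for y t
  proof (rule sublin_imp_bounded_linear[OF sub[OF t] d])
    fix x assume "x \<in> range d"
    then obtain i where i: "x = d i" by blast
    have "f y t (- x) \<le> P y t (Suc i) (- x)" by (rule f_le[OF t])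
    also have "\<dots> \<le> - P y t i x" unfolding PS i by (rule linearize_uminus[OF P[OF t]])
    also have "\<dots> \<le> - f y t x" using f_le[OF t] by simp
    finally show "f y t (- x) \<le> - f y t x" .
  qed
  have f_p: "f y t x \<le> p t x" if t: "t \<in> space M" for y t x
    using f_le[OF t, of y x 0] linearize_le[OF p[OF t], of y x] by (simp add: P0)
  have f_y: "p t y \<le> f y t y" if t: "t \<in> space M" for y t
    using f_le[OF t, of y "- y" 0] linearize_uminus[OF p[OF t], of y]
      linear_neg[OF bounded_linear.linear[OF lin[OF t]], of y y] by (simp add: P0)
  have "(\<lambda>t. P y t i x) \<in> borel_measurable M" for y i x
  proof (induct i arbitrary: x)
    case 0
    then show ?case unfolding P0 linearize_def
      by (intro borel_measurable_cINF_real borel_measurable_diff borel_measurable_times m) auto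
  next
    case (Suc i)
    then show ?case unfolding PS linearize_def
      by (intro borel_measurable_cINF_real borel_measurable_diff borel_measurable_times) auto
  qed
  then have f_m: "(\<lambda>t. f y t x) \<in> borel_measurable M" for y x
    unfolding f_def by (intro borel_measurable_cINF_real) auto
  \<comment> \<open>The vector to be frozen has to depend on \<open>t\<close>. Where no index
    qualifies, \<open>J t\<close> is some unspecified number; this is harmless, since the limit is
    linear and below \<open>p t\<close> for every choice of \<open>y\<close>.\<close>
  define J where "J t = (LEAST j. 0 < p t (d j))" for t
  have J: "J \<in> measurable M (count_space UNIV)"
    using m unfolding J_def by measurable
  show ?thesis
  proof (intro exI[of _ "\<lambda>t. f (d (J t)) t"] conjI allI ballI impI)
    show "(\<lambda>t. f (d (J t)) t x) \<in> borel_measurable M" for x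
      using J by (rule measurable_compose_countable[OF f_m])
  next
    fix t assume t: "t \<in> space M" and "\<exists>x. 0 < p t x"
    then obtain x where x: "0 < p t x" by blast
    have "x \<in> closure (range d)" using d by simp
    then obtain j where "dist (d j) x < p t x" using x unfolding closure_approachable by blast
    then have "0 < p t (d j)"
      using sublin_Lipschitz[OF p[OF t], of "d j" x] by (simp add: dist_norm)
    then have "0 < p t (d (J t))" unfolding J_def by (rule LeastI)
    with f_y[OF t] show "\<exists>x. 0 < f (d (J t)) t x" by (meson less_le_trans)
  qed (auto simp: lin f_p)
qed

section \<open>Clarke tangent cones and an extremal principle\<close>

lemma Clarke_tangent_coneD:
  assumes "v \<in> Clarke_tangent_cone X N C x" "0 < e"
  obtains r where "0 < r"
    "\<And>y s. y \<in> C \<Longrightarrow> N (y - x) \<le> r \<Longrightarrow> 0 \<le> s \<Longrightarrow> s \<le> r \<Longrightarrow>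
       \<exists>b\<in>X. N b \<le> 1 \<and> y + s *\<^sub>R (v + e *\<^sub>R b) \<in> C"
proof -
  obtain d l where "0 < d" "0 < l" and
    *: "\<forall>y\<in>C. N (y - x) \<le> d \<longrightarrow> (\<forall>s\<in>{0..l}. \<exists>b\<in>X. N b \<le> 1 \<and> y + s *\<^sub>R (v + e *\<^sub>R b) \<in> C)"
    using assms unfolding Clarke_tangent_cone_def by blast
  show ?thesis
    using \<open>0 < d\<close> \<open>0 < l\<close> * by (intro that[of "min d l"]) auto
qed

lemma Clarke_tangent_coneI:
  assumes "v \<in> X"
    and "\<And>e. 0 < e \<Longrightarrow> \<exists>r>0. \<forall>y\<in>C. N (y - x) \<le> r \<longrightarrow>
       (\<forall>s. 0 \<le> s \<longrightarrow> s \<le> r \<longrightarrow> (\<exists>b\<in>X. N b \<le> 1 \<and> y + s *\<^sub>R (v + e *\<^sub>R b) \<in> C))"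
  shows "v \<in> Clarke_tangent_cone X N C x"
  unfolding Clarke_tangent_cone_def mem_Collect_eq
proof (intro conjI allI impI assms(1))
  fix e :: real assume "0 < e"
  then obtain r where r: "0 < r" "\<forall>y\<in>C. N (y - x) \<le> r \<longrightarrow>
       (\<forall>s. 0 \<le> s \<longrightarrow> s \<le> r \<longrightarrow> (\<exists>b\<in>X. N b \<le> 1 \<and> y + s *\<^sub>R (v + e *\<^sub>R b) \<in> C))"
    using assms(2) by blast
  then show "\<exists>\<delta>>0. \<exists>l>0. \<forall>y\<in>C. N (y - x) \<le> \<delta> \<longrightarrow> (\<forall>\<eta>\<in>{0..l}. \<exists>b\<in>X. N b \<le> 1 \<and> y + \<eta> *\<^sub>R (v + e *\<^sub>R b) \<in> C)"
    by (intro exI[of _ r] conjI) auto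
qed

lemma convex_cone_Clarke_tangent_cone:
  fixes C :: "'v::real_normed_vector set"
  shows "convex_cone (Clarke_tangent_cone UNIV norm C x)" (is "convex_cone ?T")
  unfolding convex_cone_iff
proof (intro conjI ballI allI impI)
  show T0: "0 \<in> ?T"
    by (intro Clarke_tangent_coneI exI[of _ 1] conjI ballI impI allI bexI[of _ 0]) auto
  fix v assume v: "v \<in> ?T"
  {
    fix w assume w: "w \<in> ?T"
    show "v + w \<in> ?T"
    proof (rule Clarke_tangent_coneI)
      fix e :: real assume e: "0 < e"
      obtain r1 where r1: "0 < r1"
        "\<And>y s. y \<in> C \<Longrightarrow> norm (y - x) \<le> r1 \<Longrightarrow> 0 \<le> s \<Longrightarrow> s \<le> r1 \<Longrightarrow>
          \<exists>b\<in>UNIV. norm b \<le> 1 \<and> y + s *\<^sub>R (v + (e/2) *\<^sub>R b) \<in> C"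
        using Clarke_tangent_coneD[OF v, of "e/2"] e by (metis half_gt_zero)
      obtain r2 where r2: "0 < r2"
        "\<And>y s. y \<in> C \<Longrightarrow> norm (y - x) \<le> r2 \<Longrightarrow> 0 \<le> s \<Longrightarrow> s \<le> r2 \<Longrightarrow>
          \<exists>b\<in>UNIV. norm b \<le> 1 \<and> y + s *\<^sub>R (w + (e/2) *\<^sub>R b) \<in> C"
        using Clarke_tangent_coneD[OF w, of "e/2"] e by (metis half_gt_zero)
      \<comment> \<open>\<open>B\<close> bounds the speed of the first move, along \<open>v\<close>;
        \<open>r * B \<le> r2 / 2\<close> keeps the moved point in the ball in which
        \<open>w\<close> may be used for the second move.\<close>
      define B where "B = norm v + e + 1"
      have B: "0 < B" using e by (simp add: B_def add_nonneg_pos)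
      define r where "r = min (min r1 (r2 / 2)) (r2 / 2 / B)"
      have "r \<le> r2 / 2 / B" unfolding r_def by (rule min.cobounded2)
      then have "r * B \<le> r2 / 2" by (simp only: pos_le_divide_eq[OF B])
      then have r: "0 < r" "r \<le> r1" "r \<le> r2 / 2" "r * B \<le> r2 / 2"
        using r1(1) r2(1) B by (auto simp: r_def)
      have "\<exists>b. norm b \<le> 1 \<and> y + s *\<^sub>R ((v + w) + e *\<^sub>R b) \<in> C"
        if y: "y \<in> C" "norm (y - x) \<le> r" and s: "0 \<le> s" "s \<le> r" for y s
      proof -
        obtain b where b: "norm b \<le> 1" "y + s *\<^sub>R (v + (e/2) *\<^sub>R b) \<in> C"
          using r1(2)[of y s] y s r by auto
        have "norm (s *\<^sub>R (v + (e/2) *\<^sub>R b)) \<le> r * B"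
        proof -
          have "norm (v + (e/2) *\<^sub>R b) \<le> norm v + (e/2) * norm b"
            using norm_triangle_ineq[of v "(e/2) *\<^sub>R b"] e by simp
          also have "\<dots> \<le> B"
          proof -
            have "(e/2) * norm b \<le> (e/2) * 1" using e b(1) by (intro mult_left_mono) auto
            then show ?thesis using e unfolding B_def by linarith
          qed
          finally show ?thesis using s B by (simp add: mult_mono)
        qed
        then have "norm (y + s *\<^sub>R (v + (e/2) *\<^sub>R b) - x) \<le> r2"
          using y(2) r norm_triangle_ineq[of "y - x" "s *\<^sub>R (v + (e/2) *\<^sub>R b)"] by (simp add: algebra_simps)
        then obtain b' where b': "norm b' \<le> 1" "y + s *\<^sub>R (v + (e/2) *\<^sub>R b) + s *\<^sub>R (w + (e/2) *\<^sub>R b') \<in> C"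
          using r2(2)[OF b(2), of s] s r r2(1) by auto
        have "y + s *\<^sub>R (v + (e/2) *\<^sub>R b) + s *\<^sub>R (w + (e/2) *\<^sub>R b')
            = y + s *\<^sub>R ((v + w) + e *\<^sub>R ((1/2) *\<^sub>R b + (1/2) *\<^sub>R b'))"
          by (simp add: algebra_simps)
        moreover have "norm ((1/2) *\<^sub>R b + (1/2) *\<^sub>R b') \<le> 1"
          using norm_triangle_ineq[of "(1/2) *\<^sub>R b" "(1/2) *\<^sub>R b'"] b(1) b'(1) by simp
        ultimately show ?thesis using b'(2) by metis
      qed
      with r(1) show "\<exists>r>0. \<forall>y\<in>C. norm (y - x) \<le> r \<longrightarrow> (\<forall>s. 0 \<le> s \<longrightarrow> s \<le> r \<longrightarrow>
          (\<exists>b\<in>UNIV. norm b \<le> 1 \<and> y + s *\<^sub>R ((v + w) + e *\<^sub>R b) \<in> C))" by auto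
    qed simp
  }
  fix c :: real assume "0 \<le> c"
  show "c *\<^sub>R v \<in> ?T"
  proof (cases "c = 0")
    case False
    with \<open>0 \<le> c\<close> have c: "0 < c" by simp
    show ?thesis
    proof (rule Clarke_tangent_coneI)
      fix e :: real assume e: "0 < e"
      obtain r1 where r1: "0 < r1"
        "\<And>y s. y \<in> C \<Longrightarrow> norm (y - x) \<le> r1 \<Longrightarrow> 0 \<le> s \<Longrightarrow> s \<le> r1 \<Longrightarrow>
          \<exists>b\<in>UNIV. norm b \<le> 1 \<and> y + s *\<^sub>R (v + (e/c) *\<^sub>R b) \<in> C"
        using Clarke_tangent_coneD[OF v, of "e/c"] e c by (metis divide_pos_pos)
      have "\<exists>b. norm b \<le> 1 \<and> y + s *\<^sub>R (c *\<^sub>R v + e *\<^sub>R b) \<in> C"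
        if y: "y \<in> C" "norm (y - x) \<le> min r1 (r1 / c)" and s: "0 \<le> s" "s \<le> min r1 (r1 / c)" for y s
      proof -
        have "c * s \<le> r1" using s(2) c by (simp add: field_simps)
        then obtain b where "norm b \<le> 1" "y + (c * s) *\<^sub>R (v + (e/c) *\<^sub>R b) \<in> C"
          using r1(2)[of y "c * s"] y s c by auto
        moreover have "y + (c * s) *\<^sub>R (v + (e/c) *\<^sub>R b) = y + s *\<^sub>R (c *\<^sub>R v + e *\<^sub>R b)"
          using c by (simp add: algebra_simps)
        ultimately show ?thesis by metis
      qed
      then show "\<exists>r>0. \<forall>y\<in>C. norm (y - x) \<le> r \<longrightarrow> (\<forall>s. 0 \<le> s \<longrightarrow> s \<le> r \<longrightarrow>
          (\<exists>b\<in>UNIV. norm b \<le> 1 \<and> y + s *\<^sub>R (c *\<^sub>R v + e *\<^sub>R b) \<in> C))"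
        using r1(1) c by (intro exI[of _ "min r1 (r1 / c)"]) auto
    qed simp
  qed (simp add: T0)
qed

text \<open>Common core of Ekeland's principle and of the drop argument, with closed upper sections
  in the role of semicontinuity of \<open>f\<close>. Successors that nearly minimize
  \<open>f\<close> over the current section make the sections shrink to one point, which is then
  maximal.\<close>

lemma closed_order_maximal:
  fixes f :: "'x::complete_space \<Rightarrow> real"
  assumes refl: "\<And>x. x \<in> A \<Longrightarrow> R x x"
    and trans: "\<And>x y z. R x y \<Longrightarrow> R y z \<Longrightarrow> R x z"
    and dist: "\<And>x y. R x y \<Longrightarrow> dist x y \<le> f x - f y"
    and closed: "\<And>x. closed {y \<in> A. R x y}"
    and bound: "\<And>x. x \<in> A \<Longrightarrow> m \<le> f x"
    and "x0 \<in> A"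
  obtains x where "x \<in> A" "R x0 x" "\<And>y. y \<in> A \<Longrightarrow> R x y \<Longrightarrow> y = x"
proof -
  define S where "S x = {y \<in> A. R x y}" for x
  have bdd: "bdd_below (f ` S x)" for x
    using bound by (intro bdd_belowI2[of _ m]) (auto simp: S_def)
  define good where "good n x y \<longleftrightarrow> y \<in> S x \<and> f y \<le> (INF z\<in>S x. f z) + 1/2^n" for n :: nat and x y
  have "\<exists>y. good n x y" if "x \<in> A" for n x
  proof -
    have "S x \<noteq> {}" using refl[OF that] that by (auto simp: S_def)
    moreover have "(INF z\<in>S x. f z) < (INF z\<in>S x. f z) + 1/2^n" by simp
    ultimately obtain y where "y \<in> S x" "f y < (INF z\<in>S x. f z) + 1/2^n"
      using cINF_less_iff[OF _ bdd] by blast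
    then show ?thesis unfolding good_def by (meson less_imp_le)
  qed
  then have "\<exists>\<xi>. \<xi> 0 = x0 \<and> (\<forall>n. \<xi> n \<in> A \<and> good n (\<xi> n) (\<xi> (Suc n)))"
    using \<open>x0 \<in> A\<close> dependent_nat_choice[of "\<lambda>n x. x \<in> A \<and> (n = 0 \<longrightarrow> x = x0)" good]
    by (metis (no_types, lifting) S_def good_def mem_Collect_eq nat.distinct(1))
  then obtain \<xi> where \<xi>: "\<xi> 0 = x0" "\<And>n. \<xi> n \<in> A" "\<And>n. good n (\<xi> n) (\<xi> (Suc n))" by blast
  have S_Suc: "S (\<xi> (Suc n)) \<subseteq> S (\<xi> n)" for n
    using \<xi>(3)[of n] trans by (auto simp: S_def good_def)
  have small: "dist (\<xi> (Suc n)) y \<le> 1/2^n" if "y \<in> S (\<xi> (Suc n))" for n y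
  proof -
    have "(INF z\<in>S (\<xi> n). f z) \<le> f y" using that S_Suc by (intro cINF_lower bdd) auto
    moreover have "dist (\<xi> (Suc n)) y \<le> f (\<xi> (Suc n)) - f y" using that dist by (simp add: S_def)
    ultimately show ?thesis using \<xi>(3)[of n] by (simp add: good_def)
  qed
  have half: "\<exists>n. 1/2^n < e" if "0 < e" for e :: real
    using real_arch_pow_inv[OF that, of "1/2"] by (auto simp: power_one_over)
  have "\<exists>x. \<forall>n. x \<in> S (\<xi> n)"
  proof (rule decreasing_closed_nest[rule_format])
    show "closed (S (\<xi> n))" for n using closed by (simp add: S_def)
    show "S (\<xi> n) \<noteq> {}" for n using refl \<xi>(2) by (auto simp: S_def)
    show "S (\<xi> n) \<subseteq> S (\<xi> m)" if "m \<le> n" for m n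
      using that S_Suc by (induct rule: dec_induct) auto
    fix e :: real assume "0 < e"
    then obtain n where n: "1/2^n < e/2" using half[of "e/2"] by auto
    have "dist y z < e" if "y \<in> S (\<xi> (Suc n))" "z \<in> S (\<xi> (Suc n))" for y z
      using small[OF that(1)] small[OF that(2)] n dist_triangle3[of y z "\<xi> (Suc n)"] by linarith
    then show "\<exists>n. \<forall>y\<in>S (\<xi> n). \<forall>z\<in>S (\<xi> n). dist y z < e" by blast
  qed blast
  then obtain x where x: "\<And>n. x \<in> S (\<xi> n)" by blast
  show ?thesis
  proof (rule that)
    show "x \<in> A" "R x0 x" using x[of 0] \<xi>(1) by (auto simp: S_def)
    fix y assume y: "y \<in> A" "R x y"
    then have "y \<in> S (\<xi> n)" for n using x[of n] trans by (auto simp: S_def)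
    then have *: "dist y x \<le> 2 * (1/2^n)" for n
      using small[OF x[of "Suc n"]] small[of y n] dist_triangle3[of y x "\<xi> (Suc n)"] by fastforce
    show "y = x"
    proof (rule ccontr)
      assume "y \<noteq> x"
      then obtain n where "1/2^n < dist y x / 2" using half[of "dist y x / 2"] by auto
      with *[of n] show False by simp
    qed
  qed
qed

text \<open>Failure of tangency at one scale propagates, at a nearby point, to all smaller scales: take a
  point of \<open>E\<close> that is maximal in the drop issued from \<open>y\<close>.\<close>

lemma drop_maximal:
  fixes E :: "'y::banach set"
  assumes "closed E" "y \<in> E" "0 < s0" "0 < e"
    and miss: "\<And>u. u \<in> E \<Longrightarrow> e * s0 < norm (u - (y + s0 *\<^sub>R v))"
  obtains y' l where "y' \<in> E" "norm (y' - y) \<le> s0 * (norm v + e)" "0 < l"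
    "\<And>s u. 0 < s \<Longrightarrow> s \<le> l \<Longrightarrow> u \<in> E \<Longrightarrow> e * s < norm (u - (y' + s *\<^sub>R v))"
proof -
  \<comment> \<open>Each point of \<open>E\<close> carries the time at which it is reached.
    \<open>R\<close> allows motion with velocity \<open>v\<close> and an error of at most
    \<open>e\<close> per unit of time, so the pairs above \<open>(y, 0)\<close> form the
    drop.\<close>
  define R where "R x z \<longleftrightarrow> snd x \<le> snd z \<and> norm (fst z - fst x - (snd z - snd x) *\<^sub>R v) \<le> e * (snd z - snd x)"
    for x z :: "'y \<times> real"
  have R_norm: "norm (fst z - fst x) \<le> (norm v + e) * (snd z - snd x)" if "R x z" for x z
  proof -
    have "norm (fst z - fst x) \<le> norm (fst z - fst x - (snd z - snd x) *\<^sub>R v) + norm ((snd z - snd x) *\<^sub>R v)"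
      using norm_triangle_ineq[of "fst z - fst x - (snd z - snd x) *\<^sub>R v" "(snd z - snd x) *\<^sub>R v"] by simp
    also have "norm ((snd z - snd x) *\<^sub>R v) = (snd z - snd x) * norm v" using that by (simp add: R_def)
    also have "norm (fst z - fst x - (snd z - snd x) *\<^sub>R v) \<le> e * (snd z - snd x)" using that by (simp add: R_def)
    finally show ?thesis by (simp add: algebra_simps)
  qed
  obtain x where x: "x \<in> E \<times> {0..s0}" "R (y, 0) x" "\<And>z. z \<in> E \<times> {0..s0} \<Longrightarrow> R x z \<Longrightarrow> z = x"
  \<comment> \<open>Along \<open>R\<close> the spatial displacement is at most
    \<open>norm v + e\<close> per unit of time; the additional \<open>1\<close> pays for the time
    coordinate in the product distance.\<close>
  proof (rule closed_order_maximal[of "E \<times> {0..s0}" R "\<lambda>x. - (norm v + e + 1) * snd x" "- (norm v + e + 1) * s0" "(y, 0)"])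
    show "R x x" for x by (simp add: R_def)
    show "R x w" if "R x z" "R z w" for x z w
    proof -
      have "fst w - fst x - (snd w - snd x) *\<^sub>R v
          = (fst z - fst x - (snd z - snd x) *\<^sub>R v) + (fst w - fst z - (snd w - snd z) *\<^sub>R v)"
        by (simp add: algebra_simps)
      also have "norm \<dots> \<le> e * (snd z - snd x) + e * (snd w - snd z)"
        using that by (intro order_trans[OF norm_triangle_ineq] add_mono) (auto simp: R_def)
      finally show ?thesis using that by (auto simp: R_def algebra_simps)
    qed
    show "dist x z \<le> - (norm v + e + 1) * snd x - - (norm v + e + 1) * snd z" if "R x z" for x z
    proof -
      have "dist x z \<le> dist (fst x) (fst z) + dist (snd x) (snd z)"
        using sqrt_sum_squares_le_sum[of "dist (fst x) (fst z)" "dist (snd x) (snd z)"]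
        by (simp add: dist_prod_def)
      also have "\<dots> \<le> (norm v + e) * (snd z - snd x) + (snd z - snd x)"
        using R_norm[OF that] that by (intro add_mono) (auto simp: R_def dist_norm norm_minus_commute)
      finally show ?thesis by (simp add: algebra_simps)
    qed
    show "closed {z \<in> E \<times> {0..s0}. R x z}" for x
    proof -
      have "{z \<in> E \<times> {0..s0}. R x z} = E \<times> {0..s0} \<inter> ({z. snd x \<le> snd z} \<inter>
        {z. norm (fst z - fst x - (snd z - snd x) *\<^sub>R v) \<le> e * (snd z - snd x)})"
        by (auto simp: R_def)
      also have "closed \<dots>"
        using \<open>closed E\<close> by (intro closed_Int closed_Times closed_Collect_le continuous_intros) auto
      finally show ?thesis .
    qed
    show "- (norm v + e + 1) * s0 \<le> - (norm v + e + 1) * snd x" if "x \<in> E \<times> {0..s0}" for x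
    proof (rule mult_left_mono_neg)
      show "snd x \<le> s0" using that by auto
      show "- (norm v + e + 1) \<le> 0" using \<open>0 < e\<close> norm_ge_zero[of v] by linarith
    qed
    show "(y, 0) \<in> E \<times> {0..s0}" using assms by simp
  qed blast
  \<comment> \<open>A maximal point at time \<open>s0\<close> would contradict \<open>miss\<close>.
    The time that remains until \<open>s0\<close> is the scale \<open>l\<close>: a step of that
    length or less with small error would be a larger element.\<close>
  have "snd x \<noteq> s0" using x(1,2) miss[of "fst x"] by (auto simp: R_def algebra_simps)
  then have s: "0 \<le> snd x" "snd x < s0" using x(1) by auto
  show ?thesis
  proof (rule that)
    show "fst x \<in> E" using x(1) by auto
    have "norm (fst x - y) \<le> (norm v + e) * snd x" using R_norm[OF x(2)] by simp
    also have "\<dots> \<le> (norm v + e) * s0" using s \<open>0 < e\<close> by (intro mult_left_mono) auto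
    finally show "norm (fst x - y) \<le> s0 * (norm v + e)" by (simp add: mult.commute)
    show "0 < s0 - snd x" using s by simp
    fix r u assume r: "0 < r" "r \<le> s0 - snd x" and u: "u \<in> E"
    show "e * r < norm (u - (fst x + r *\<^sub>R v))"
    proof (rule ccontr)
      assume "\<not> ?thesis"
      then have "R x (u, snd x + r)" using r by (simp add: R_def algebra_simps)
      then have "(u, snd x + r) = x" using u r s by (intro x(3)) auto
      then show False using r by (metis add_cancel_right_right less_irrefl snd_conv)
    qed
  qed
qed

text \<open>An exact extremal principle: if the tangent cones were jointly dense, then at an Ekeland
  point of the distance between \<open>A\<close> and the shifted \<open>B\<close> one could decrease that distance, by moving
  along the compactly epi-Lipschitz direction and cancelling the compact error \<open>k \<in> K\<close> with one of
  finitely many pairs of tangent vectors.\<close>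

theorem extremal_tangent_cones_not_dense:
  fixes A B :: "'x::banach set"
  assumes cel: "compactly_epi_Lipschitz_at N A a0" and N: "\<And>x. N x \<le> 2 * norm x"
    and "closed B" "a0 \<in> B"
    and extremal: "\<And>a b c. a \<in> A \<Longrightarrow> b \<in> B \<Longrightarrow> 0 < c \<Longrightarrow> a - b + c *\<^sub>R z0 \<noteq> 0"
  shows "\<exists>x. \<exists>e>0. \<forall>v\<in>Clarke_tangent_cone UNIV norm A a0. \<forall>w\<in>Clarke_tangent_cone UNIV norm B a0.
    e \<le> norm (x - (v - w))"
proof (rule ccontr)
  assume "\<not> ?thesis"
  then have dense: "\<exists>v w. v \<in> Clarke_tangent_cone UNIV norm A a0 \<and> w \<in> Clarke_tangent_cone UNIV norm B a0 \<and>
      norm (x - (v - w)) < e" if "0 < e" for x e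
    using that by (meson not_le)
  obtain \<epsilon> \<delta> l K where "closed A" "a0 \<in> A" and pos: "0 < \<epsilon>" "0 < \<delta>" "0 < l" and "compact K"
    and cel: "\<forall>\<eta>\<in>{0..l}. {a + (\<eta> * \<epsilon>) *\<^sub>R b |a b. a \<in> A \<and> N (a - a0) \<le> \<delta> \<and> N b \<le> 1}
             \<subseteq> {a - \<eta> *\<^sub>R k |a k. a \<in> A \<and> k \<in> K}"
    using cel unfolding compactly_epi_Lipschitz_at_def by (elim conjE exE) (rule that; assumption)
  \<comment> \<open>Per unit step the compact error costs \<open>2 * e\<close> and the two tangent
    corrections another \<open>2 * e\<close>: together \<open>\<epsilon> / 4\<close>, which is half
    of the gain \<open>\<epsilon> / 2\<close> obtained below.\<close>
  define e where "e = \<epsilon> / 16"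
  have e: "0 < e" using pos by (simp add: e_def)
  obtain D where D: "finite D" "K \<subseteq> (\<Union>d\<in>D. ball d e)"
    using \<open>compact K\<close> e unfolding compact_eq_totally_bounded by blast
  obtain R where R: "0 < R" "\<And>k. k \<in> K \<Longrightarrow> norm k \<le> R"
    using compact_imp_bounded[OF \<open>compact K\<close>] unfolding bounded_pos by blast
  have "\<forall>d. \<exists>vw. fst vw \<in> Clarke_tangent_cone UNIV norm A a0 \<and> snd vw \<in> Clarke_tangent_cone UNIV norm B a0 \<and>
      norm (- d - (fst vw - snd vw)) < e"
    using dense[OF e] by fastforce
  then obtain vw where vw: "\<And>d. fst (vw d) \<in> Clarke_tangent_cone UNIV norm A a0"
    "\<And>d. snd (vw d) \<in> Clarke_tangent_cone UNIV norm B a0" "\<And>d. norm (- d - (fst (vw d) - snd (vw d))) < e"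
    by metis
  define v where "v d = fst (vw d)" for d
  define w where "w d = snd (vw d)" for d
  note v = vw(1)[folded v_def] and w = vw(2)[folded w_def] and near = vw(3)[folded v_def w_def]
  define V where "V = (\<Sum>d\<in>D. norm (v d) + norm (w d))"
  have V: "norm (v d) \<le> V" "norm (w d) \<le> V" if "d \<in> D" for d
    using member_le_sum[OF that _ D(1), of "\<lambda>d. norm (v d) + norm (w d)"] unfolding V_def
    by (auto intro: order_trans[rotated])
  have "0 \<le> V" unfolding V_def by (intro sum_nonneg) auto
  define P where "P d r \<longleftrightarrow> 0 < r \<and>
    (\<forall>y s. y \<in> A \<longrightarrow> norm (y - a0) \<le> r \<longrightarrow> 0 \<le> s \<longrightarrow> s \<le> r \<longrightarrow> (\<exists>b. norm b \<le> 1 \<and> y + s *\<^sub>R (v d + e *\<^sub>R b) \<in> A)) \<and>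
    (\<forall>y s. y \<in> B \<longrightarrow> norm (y - a0) \<le> r \<longrightarrow> 0 \<le> s \<longrightarrow> s \<le> r \<longrightarrow> (\<exists>b. norm b \<le> 1 \<and> y + s *\<^sub>R (w d + e *\<^sub>R b) \<in> B))"
    for d r
  have "\<exists>r. P d r" for d
  proof -
    obtain r1 where r1: "0 < r1" "\<And>y s. y \<in> A \<Longrightarrow> norm (y - a0) \<le> r1 \<Longrightarrow> 0 \<le> s \<Longrightarrow> s \<le> r1 \<Longrightarrow>
        \<exists>b\<in>UNIV. norm b \<le> 1 \<and> y + s *\<^sub>R (v d + e *\<^sub>R b) \<in> A"
      using Clarke_tangent_coneD[OF v e] by metis
    obtain r2 where r2: "0 < r2" "\<And>y s. y \<in> B \<Longrightarrow> norm (y - a0) \<le> r2 \<Longrightarrow> 0 \<le> s \<Longrightarrow> s \<le> r2 \<Longrightarrow>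
        \<exists>b\<in>UNIV. norm b \<le> 1 \<and> y + s *\<^sub>R (w d + e *\<^sub>R b) \<in> B"
      using Clarke_tangent_coneD[OF w e] by metis
    have "P d (min r1 r2)" unfolding P_def using r1 r2 by auto
    then show ?thesis by blast
  qed
  then obtain r' where r': "\<And>d. P d (r' d)" by metis
  \<comment> \<open>Compactness pays off here: the net \<open>D\<close> is finite, so one radius
    serves all its pairs of tangent vectors. The \<open>1\<close> covers an empty net.\<close>
  define r where "r = Min (insert 1 (r' ` D))"
  have r: "0 < r" "\<And>d. d \<in> D \<Longrightarrow> r \<le> r' d"
    using r' D(1) unfolding r_def P_def by auto
  define C where "C = \<epsilon> + R + 2 * V + 2 * e"
  have C: "0 < C" using pos R \<open>0 \<le> V\<close> e by (simp add: C_def)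
  \<comment> \<open>\<open>C\<close> bounds the displacement per unit step. With this slope the
    Ekeland penalty of the step \<open>\<eta>\<close> is at most
    \<open>\<eta> * \<epsilon> / 8\<close>, below the net decrease
    \<open>\<eta> * \<epsilon> / 4\<close>.\<close>
  define \<kappa> where "\<kappa> = \<epsilon> / (8 * C)"
  have \<kappa>: "0 < \<kappa>" using C pos by (simp add: \<kappa>_def)
  define \<rho> where "\<rho> = min (\<delta> / 2) (r / 2)"
  have \<rho>: "0 < \<rho>" "2 * \<rho> \<le> \<delta>" "2 * \<rho> \<le> r" using pos r(1) by (auto simp: \<rho>_def)
  \<comment> \<open>The value of \<open>F\<close> at \<open>(a0, a0)\<close> becomes at most
    \<open>\<kappa> * \<rho>\<close>, which confines the Ekeland point to distance
    \<open>\<rho>\<close>, where the epi-Lipschitz inclusion and the tangent vectors are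
    available.\<close>
  define c where "c = \<kappa> * \<rho> / (norm z0 + 1)"
  have c: "0 < c" unfolding c_def by (intro divide_pos_pos mult_pos_pos \<kappa> \<rho>) (simp add: add_nonneg_pos)
  have cz: "c * norm z0 \<le> \<kappa> * \<rho>"
  proof -
    have "c * norm z0 \<le> c * (norm z0 + 1)" using c by (intro mult_left_mono) auto
    also have "\<dots> = \<kappa> * \<rho>" unfolding c_def by (simp add: add_nonneg_pos less_imp_neq[symmetric] add_pos_nonneg)
    finally show ?thesis .
  qed
  define F where "F x = norm (fst x - snd x + c *\<^sub>R z0)" for x
  obtain x where x: "x \<in> A \<times> B" "\<kappa> * dist (a0, a0) x \<le> F (a0, a0) - F x"
    and max: "\<And>y. y \<in> A \<times> B \<Longrightarrow> \<kappa> * dist x y \<le> F x - F y \<Longrightarrow> y = x"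
  proof (rule closed_order_maximal[of "A \<times> B" "\<lambda>x y. \<kappa> * dist x y \<le> F x - F y" "\<lambda>x. F x / \<kappa>" 0 "(a0, a0)"])
    show "\<kappa> * dist x z \<le> F x - F z" if "\<kappa> * dist x y \<le> F x - F y" "\<kappa> * dist y z \<le> F y - F z" for x y z
      using mult_left_mono[OF dist_triangle[of x z y], of \<kappa>] that \<kappa> by (simp add: algebra_simps)
    show "dist x y \<le> F x / \<kappa> - F y / \<kappa>" if "\<kappa> * dist x y \<le> F x - F y" for x y
      using that \<kappa> by (simp add: field_simps)
    show "closed {y \<in> A \<times> B. \<kappa> * dist x y \<le> F x - F y}" for x
    proof -
      have "{y \<in> A \<times> B. \<kappa> * dist x y \<le> F x - F y} = A \<times> B \<inter> {y. \<kappa> * dist x y \<le> F x - F y}" by auto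
      also have "closed \<dots>" unfolding F_def
        using \<open>closed A\<close> \<open>closed B\<close> by (intro closed_Int closed_Times closed_Collect_le continuous_intros) auto
      finally show ?thesis .
    qed
  qed (use \<kappa> \<open>a0 \<in> A\<close> \<open>a0 \<in> B\<close> in \<open>auto simp: F_def\<close>)
  obtain a b where ab: "x = (a, b)" "a \<in> A" "b \<in> B" using x(1) by auto
  have "\<kappa> * dist (a0, a0) (a, b) \<le> \<kappa> * \<rho>"
  proof -
    have "F (a0, a0) = c * norm z0" using c by (simp add: F_def)
    moreover have "0 \<le> F x" by (simp add: F_def)
    ultimately show ?thesis using x(2) cz unfolding ab(1)[symmetric] by linarith
  qed
  then have dist_ab: "dist (a0, a0) (a, b) \<le> \<rho>" using \<kappa> by simp
  have a: "norm (a - a0) \<le> \<rho>" and b: "norm (b - a0) \<le> \<rho>"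
    using order_trans[OF dist_fst_le[of "(a0, a0)" "(a, b)"] dist_ab]
      order_trans[OF dist_snd_le[of "(a0, a0)" "(a, b)"] dist_ab]
    by (auto simp: dist_norm norm_minus_commute)
  define z where "z = a - b + c *\<^sub>R z0"
  have "z \<noteq> 0" unfolding z_def by (rule extremal[OF ab(2,3) c])
  then have z: "0 < norm z" by simp
  define \<eta> where "\<eta> = Min {l, r, r / 2 / (\<epsilon> + R), 2 * norm z / \<epsilon>}"
  have \<eta>: "0 < \<eta>" "\<eta> \<le> l" "\<eta> \<le> r" "\<eta> \<le> r / 2 / (\<epsilon> + R)" "\<eta> \<le> 2 * norm z / \<epsilon>"
    using pos r R z unfolding \<eta>_def by auto
  have \<eta>1: "\<eta> * (\<epsilon> + R) \<le> r / 2" using \<eta>(4) pos R by (simp add: field_simps)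
  have \<eta>2: "\<eta> * \<epsilon> \<le> 2 * norm z" using \<eta>(5) pos by (simp add: field_simps)
  \<comment> \<open>\<open>u\<close> points from \<open>z\<close> towards the origin. Its length is
    1/2 because \<open>N\<close> may be twice the norm, so the gain is half of
    \<open>\<eta> * \<epsilon>\<close>; the bound
    \<open>\<eta> * \<epsilon> \<le> 2 * norm z\<close> prevents overshooting.\<close>
  define u where "u = - (1 / (2 * norm z)) *\<^sub>R z"
  have u: "norm u = 1/2" using z by (simp add: u_def)
  have "a + (\<eta> * \<epsilon>) *\<^sub>R u \<in> {a - \<eta> *\<^sub>R k |a k. a \<in> A \<and> k \<in> K}"
  proof (rule subsetD[OF bspec[OF cel]])
    show "\<eta> \<in> {0..l}" using \<eta> by simp
    show "a + (\<eta> * \<epsilon>) *\<^sub>R u \<in> {a + (\<eta> * \<epsilon>) *\<^sub>R b |a b. a \<in> A \<and> N (a - a0) \<le> \<delta> \<and> N b \<le> 1}"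
      using ab(2) N[of u] N[of "a - a0"] a \<rho>(2) u by (intro CollectI exI[of _ a] exI[of _ u]) auto
  qed
  then obtain a1 k where a1: "a1 \<in> A" and k: "k \<in> K" and a1_eq: "a + (\<eta> * \<epsilon>) *\<^sub>R u = a1 - \<eta> *\<^sub>R k"
    by blast
  have a1_eq: "a1 = a + \<eta> *\<^sub>R (\<epsilon> *\<^sub>R u + k)" using a1_eq by (simp add: algebra_simps)
  have move1: "norm (\<eta> *\<^sub>R (\<epsilon> *\<^sub>R u + k)) \<le> \<eta> * (\<epsilon> + R)"
  proof -
    have "norm (\<epsilon> *\<^sub>R u + k) \<le> \<epsilon> * norm u + norm k"
      using norm_triangle_ineq[of "\<epsilon> *\<^sub>R u" k] pos by simp
    also have "\<epsilon> * norm u \<le> \<epsilon>" using pos u by simp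
    also have "norm k \<le> R" by (rule R(2)[OF k])
    finally have "norm (\<epsilon> *\<^sub>R u + k) \<le> \<epsilon> + R" by simp
    then show ?thesis using \<eta>(1) by simp
  qed
  have "norm (a1 - a0) \<le> norm (a - a0) + norm (\<eta> *\<^sub>R (\<epsilon> *\<^sub>R u + k))"
    using norm_triangle_ineq[of "a - a0" "\<eta> *\<^sub>R (\<epsilon> *\<^sub>R u + k)"] by (simp add: a1_eq algebra_simps)
  also have "\<dots> \<le> r" using a move1 \<eta>1 \<rho> by simp
  finally have a1_near: "norm (a1 - a0) \<le> r" .
  obtain d where d: "d \<in> D" "dist d k < e" using D(2) k by auto
  have "r \<le> r' d" by (rule r(2)[OF d(1)])
  then obtain b1 where b1: "norm b1 \<le> 1" "a1 + \<eta> *\<^sub>R (v d + e *\<^sub>R b1) \<in> A"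
    using r'[of d] a1 a1_near \<eta> unfolding P_def by (metis less_imp_le order_trans)
  obtain b2 where b2: "norm b2 \<le> 1" "b + \<eta> *\<^sub>R (w d + e *\<^sub>R b2) \<in> B"
  proof -
    have "norm (b - a0) \<le> r' d" "0 \<le> \<eta>" "\<eta> \<le> r' d"
      using b \<rho> \<eta> \<open>r \<le> r' d\<close> by linarith+
    then show ?thesis using r'[of d] ab(3) that unfolding P_def by blast
  qed
  define y where "y = (a1 + \<eta> *\<^sub>R (v d + e *\<^sub>R b1), b + \<eta> *\<^sub>R (w d + e *\<^sub>R b2))"
  have eb: "norm (e *\<^sub>R b1) \<le> e" "norm (e *\<^sub>R b2) \<le> e"
    using mult_left_mono[OF b1(1), of e] mult_left_mono[OF b2(1), of e] e by auto
  have tangent: "norm (k + v d - w d) \<le> 2 * e"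
  proof -
    have "k + v d - w d = (k - d) - (- d - (v d - w d))" by simp
    also have "norm \<dots> \<le> norm (k - d) + norm (- d - (v d - w d))" by (rule norm_triangle_ineq4)
    also have "\<dots> \<le> 2 * e" using near[of d] d(2) by (simp add: dist_norm norm_minus_commute)
    finally show ?thesis .
  qed
  have "F y = norm ((z + (\<eta> * \<epsilon>) *\<^sub>R u) + \<eta> *\<^sub>R ((k + v d - w d) + (e *\<^sub>R b1 - e *\<^sub>R b2)))"
    unfolding F_def y_def z_def a1_eq by (simp add: algebra_simps)
  also have "\<dots> \<le> norm (z + (\<eta> * \<epsilon>) *\<^sub>R u) + norm (\<eta> *\<^sub>R ((k + v d - w d) + (e *\<^sub>R b1 - e *\<^sub>R b2)))"
    by (rule norm_triangle_ineq)
  also have "norm (\<eta> *\<^sub>R ((k + v d - w d) + (e *\<^sub>R b1 - e *\<^sub>R b2))) \<le> \<eta> * (4 * e)"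
    using norm_triangle_ineq[of "k + v d - w d" "e *\<^sub>R b1 - e *\<^sub>R b2"] norm_triangle_ineq4[of "e *\<^sub>R b1" "e *\<^sub>R b2"]
      tangent eb \<eta>(1) by simp
  also have "norm (z + (\<eta> * \<epsilon>) *\<^sub>R u) = norm z - \<eta> * \<epsilon> / 2"
  proof -
    have "z + (\<eta> * \<epsilon>) *\<^sub>R u = (1 - \<eta> * \<epsilon> / (2 * norm z)) *\<^sub>R z"
      by (simp add: u_def algebra_simps)
    also have "norm \<dots> = (1 - \<eta> * \<epsilon> / (2 * norm z)) * norm z"
      using \<eta>2 z by (simp add: field_simps)
    finally show ?thesis using z by (simp add: field_simps)
  qed
  finally have decrease: "F y \<le> F x - \<eta> * \<epsilon> / 4"
    by (simp add: F_def ab z_def e_def mult.commute)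
  have "dist x y \<le> dist (fst x) (fst y) + dist (snd x) (snd y)"
    using sqrt_sum_squares_le_sum[of "dist (fst x) (fst y)" "dist (snd x) (snd y)"]
    by (simp add: dist_prod_def)
  also have "dist (fst x) (fst y) \<le> \<eta> * (\<epsilon> + R) + \<eta> * (V + e)"
  proof -
    have "fst y - fst x = \<eta> *\<^sub>R (\<epsilon> *\<^sub>R u + k) + \<eta> *\<^sub>R (v d + e *\<^sub>R b1)" by (simp add: y_def ab a1_eq)
    also have "norm \<dots> \<le> norm (\<eta> *\<^sub>R (\<epsilon> *\<^sub>R u + k)) + norm (\<eta> *\<^sub>R (v d + e *\<^sub>R b1))"
      by (rule norm_triangle_ineq)
    also have "norm (\<eta> *\<^sub>R (v d + e *\<^sub>R b1)) \<le> \<eta> * (V + e)"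
      using norm_triangle_ineq[of "v d" "e *\<^sub>R b1"] V(1)[OF d(1)] eb \<eta>(1) by simp
    finally show ?thesis using move1 by (simp add: dist_norm norm_minus_commute)
  qed
  also have "dist (snd x) (snd y) \<le> \<eta> * (V + e)"
    using norm_triangle_ineq[of "w d" "e *\<^sub>R b2"] V(2)[OF d(1)] eb \<eta>(1)
    by (simp add: dist_norm y_def ab)
  finally have "dist x y \<le> \<eta> * C" by (simp add: C_def algebra_simps)
  then have "\<kappa> * dist x y \<le> \<kappa> * (\<eta> * C)" using \<kappa> by simp
  also have "\<dots> = \<eta> * \<epsilon> / 8" using C by (simp add: \<kappa>_def)
  also have "\<dots> \<le> F x - F y" using decrease mult_pos_pos[OF \<eta>(1) pos(1)] by linarith
  finally have "y = x" using b1 b2 by (intro max) (auto simp: y_def)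
  then show False using decrease mult_pos_pos[OF \<eta>(1) pos(1)] by simp
qed

section \<open>Measurable projection and selection\<close>

text \<open>All dependence on the abstract space passes through the code \<open>\<psi> t\<close>, so
  a projection problem over \<open>M\<close> becomes one for a closed set over real sequences. The
  variable \<open>w\<close> is the auxiliary coordinate of an analytic set.\<close>

definition souslin :: "'a measure \<Rightarrow> ('a \<times> 'y::metric_space) set \<Rightarrow> bool" where
  "souslin M G \<longleftrightarrow> (\<exists>\<psi>\<in>borel_measurable M. \<exists>F :: ((nat \<Rightarrow> real) \<times> 'y \<times> (nat \<Rightarrow> real)) set.
     closed F \<and> (\<forall>t\<in>space M. \<forall>y. (t, y) \<in> G \<longleftrightarrow> (\<exists>w. (\<psi> t, y, w) \<in> F)))"

lemma souslin_Times_closed: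
  assumes "A \<in> sets M" "closed C"
  shows "souslin M (A \<times> C)"
  unfolding souslin_def
proof (intro bexI exI conjI ballI allI)
  show "closed {(x::nat \<Rightarrow> real, y, w::nat \<Rightarrow> real). x 0 = 1 \<and> y \<in> C}"
  proof -
    have "{(x::nat \<Rightarrow> real, y, w::nat \<Rightarrow> real). x 0 = 1 \<and> y \<in> C}
        = {z. fst z 0 = 1} \<inter> (fst \<circ> snd) -` C"
      by auto
    moreover have "closed {z::(nat \<Rightarrow> real) \<times> 'b \<times> (nat \<Rightarrow> real). fst z 0 = 1}"
      by (rule closed_Collect_eq[OF continuous_on_product_then_coordinatewise continuous_on_const])
        (intro continuous_on_fst continuous_on_id)
    moreover have "closed ((fst \<circ> snd) -` C :: ((nat \<Rightarrow> real) \<times> 'b \<times> (nat \<Rightarrow> real)) set)"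
      by (intro closed_vimage assms continuous_intros)
    ultimately show ?thesis by (metis closed_Int)
  qed
  show "(\<lambda>t. \<lambda>k::nat. indicator A t :: real) \<in> borel_measurable M"
    using assms(1) by (intro measurable_coordinatewise_then_product) auto
  show "((t, y) \<in> A \<times> C) = (\<exists>w. ((\<lambda>k. indicator A t), y, w) \<in>
     {(x::nat \<Rightarrow> real, y, w::nat \<Rightarrow> real). x 0 = 1 \<and> y \<in> C})" for t y
    by (auto simp: indicator_def)
qed

text \<open>Together with \<open>merge_seq\<close> this packs countably many real sequences into
  one, so that countably many codes or witnesses fit into a single coordinate of
  \<open>souslin\<close>.\<close>

definition section_seq :: "nat \<Rightarrow> (nat \<Rightarrow> real) \<Rightarrow> nat \<Rightarrow> real" where
  "section_seq n x = (\<lambda>k. x (prod_encode (n, k)))"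

definition merge_seq :: "(nat \<Rightarrow> nat \<Rightarrow> real) \<Rightarrow> nat \<Rightarrow> real" where
  "merge_seq X = (\<lambda>m. X (fst (prod_decode m)) (snd (prod_decode m)))"

lemma section_merge [simp]: "section_seq n (merge_seq X) = X n"
  by (simp add: section_seq_def merge_seq_def)

lemma continuous_on_section_seq:
  "continuous_on S f \<Longrightarrow> continuous_on S (\<lambda>z. section_seq n (f z))"
  unfolding section_seq_def
  by (rule continuous_on_coordinatewise_then_product) (rule continuous_on_product_then_coordinatewise)

lemma measurable_merge_seq:
  assumes "\<And>n. \<psi> n \<in> borel_measurable M"
  shows "(\<lambda>t. merge_seq (\<lambda>n. \<psi> n t)) \<in> borel_measurable M"
  unfolding merge_seq_def
  by (rule measurable_coordinatewise_then_product) (rule measurable_product_then_coordinatewise[OF assms])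

lemma souslin_sequenceE:
  fixes G :: "nat \<Rightarrow> ('a \<times> 'y::metric_space) set"
  assumes "\<And>n. souslin M (G n)"
  obtains \<psi> and F :: "nat \<Rightarrow> ((nat \<Rightarrow> real) \<times> 'y \<times> (nat \<Rightarrow> real)) set"
  where "\<And>n. \<psi> n \<in> borel_measurable M" "\<And>n. closed (F n)"
    "\<And>n t y. t \<in> space M \<Longrightarrow> (t, y) \<in> G n \<longleftrightarrow> (\<exists>w. (\<psi> n t, y, w) \<in> F n)"
proof -
  define Q where "Q n z \<longleftrightarrow> fst z \<in> borel_measurable M \<and> closed (snd z) \<and>
      (\<forall>t\<in>space M. \<forall>y. (t, y) \<in> G n \<longleftrightarrow> (\<exists>w. (fst z t, y, w) \<in> snd z))"
    for n and z :: "('a \<Rightarrow> nat \<Rightarrow> real) \<times> ((nat \<Rightarrow> real) \<times> 'y \<times> (nat \<Rightarrow> real)) set"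
  have "\<exists>z. Q n z" for n
    using assms[of n] unfolding souslin_def Q_def by fastforce
  then obtain z where "\<And>n. Q n (z n)" by metis
  then show ?thesis using that[of "\<lambda>n. fst (z n)" "\<lambda>n. snd (z n)"] unfolding Q_def by blast
qed

lemma souslin_Union:
  fixes G :: "nat \<Rightarrow> ('a \<times> 'y::metric_space) set"
  assumes "\<And>n. souslin M (G n)"
  shows "souslin M (\<Union>n. G n)"
proof -
  obtain \<psi> and F :: "nat \<Rightarrow> ((nat \<Rightarrow> real) \<times> 'y \<times> (nat \<Rightarrow> real)) set"
    where \<psi>: "\<And>n. \<psi> n \<in> borel_measurable M" and F: "\<And>n. closed (F n)"
    and G: "\<And>n t y. t \<in> space M \<Longrightarrow> (t, y) \<in> G n \<longleftrightarrow> (\<exists>w. (\<psi> n t, y, w) \<in> F n)"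
    by (rule souslin_sequenceE[of M G, OF assms]) blast
  define h where "h n z = (section_seq n (fst z), fst (snd z), \<lambda>k. snd (snd z) (Suc k))"
    for n and z :: "(nat \<Rightarrow> real) \<times> 'y \<times> (nat \<Rightarrow> real)"
  have h: "continuous_on UNIV (h n)" for n
    unfolding h_def
    by (intro continuous_on_Pair continuous_on_fst continuous_on_snd continuous_on_id
        continuous_on_section_seq continuous_on_coordinatewise_then_product
        continuous_on_product_then_coordinatewise[OF continuous_on_snd[OF continuous_on_snd]])
  define g where "g z = snd (snd z) 0" for z :: "(nat \<Rightarrow> real) \<times> 'y \<times> (nat \<Rightarrow> real)"
  have g: "continuous_on UNIV g"
    unfolding g_def
    by (rule continuous_on_product_then_coordinatewise) (intro continuous_on_snd continuous_on_id)
  \<comment> \<open>Entry 0 of the witness names the index \<open>n\<close>, and the rest is a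
    witness for \<open>G n\<close>. Distinct naturals are at distance at least 1, so the union over
    \<open>n\<close> can be written as an intersection of closed conditions.\<close>
  define K where "K = g -` \<nat> \<inter> (\<Inter>n. {z. 1 \<le> \<bar>g z - real n\<bar>} \<union> h n -` F n)"
  have "closed K"
    unfolding K_def
    by (intro closed_Int closed_vimage closed_INT ballI closed_Un closed_Nats F h g
        closed_Collect_le continuous_on_const continuous_on_rabs continuous_on_diff)
  moreover have K: "z \<in> K \<longleftrightarrow> (\<exists>n. g z = real n \<and> h n z \<in> F n)" for z
  proof
    assume "z \<in> K"
    then obtain n where n: "g z = real n" unfolding K_def by (auto elim: Nats_cases)
    with \<open>z \<in> K\<close> have "1 \<le> \<bar>g z - real n\<bar> \<or> h n z \<in> F n" unfolding K_def by blast
    with n show "\<exists>n. g z = real n \<and> h n z \<in> F n" by auto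
  next
    assume "\<exists>n. g z = real n \<and> h n z \<in> F n"
    then obtain n where n: "g z = real n" "h n z \<in> F n" by blast
    have "1 \<le> \<bar>g z - real m\<bar> \<or> h m z \<in> F m" for m
      using n by (cases "m = n") auto
    with n show "z \<in> K" unfolding K_def by auto
  qed
  moreover have "(t, y) \<in> (\<Union>n. G n) \<longleftrightarrow> (\<exists>w. (merge_seq (\<lambda>n. \<psi> n t), y, w) \<in> K)"
    if t: "t \<in> space M" for t y
  proof
    assume "(t, y) \<in> (\<Union>n. G n)"
    then obtain n where "(t, y) \<in> G n" by blast
    then obtain w where "(\<psi> n t, y, w) \<in> F n" using G[OF t] by blast
    then have "(merge_seq (\<lambda>n. \<psi> n t), y, \<lambda>k. case k of 0 \<Rightarrow> real n | Suc k \<Rightarrow> w k) \<in> K"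
      unfolding K by (intro exI[of _ n]) (simp add: g_def h_def)
    then show "\<exists>w. (merge_seq (\<lambda>n. \<psi> n t), y, w) \<in> K" by blast
  next
    assume "\<exists>w. (merge_seq (\<lambda>n. \<psi> n t), y, w) \<in> K"
    then show "(t, y) \<in> (\<Union>n. G n)"
      unfolding K using G[OF t] by (auto simp: h_def)
  qed
  ultimately show ?thesis
    unfolding souslin_def
    by (intro bexI[OF _ measurable_merge_seq[of \<psi> M, OF \<psi>]] exI[of _ K] conjI ballI allI)
qed

lemma souslin_Inter:
  fixes G :: "nat \<Rightarrow> ('a \<times> 'y::metric_space) set"
  assumes "\<And>n. souslin M (G n)"
  shows "souslin M (\<Inter>n. G n)"
proof -
  obtain \<psi> and F :: "nat \<Rightarrow> ((nat \<Rightarrow> real) \<times> 'y \<times> (nat \<Rightarrow> real)) set"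
    where \<psi>: "\<And>n. \<psi> n \<in> borel_measurable M" and F: "\<And>n. closed (F n)"
    and G: "\<And>n t y. t \<in> space M \<Longrightarrow> (t, y) \<in> G n \<longleftrightarrow> (\<exists>w. (\<psi> n t, y, w) \<in> F n)"
    by (rule souslin_sequenceE[of M G, OF assms]) blast
  define h where "h n z = (section_seq n (fst z), fst (snd z), section_seq n (snd (snd z)))"
    for n and z :: "(nat \<Rightarrow> real) \<times> 'y \<times> (nat \<Rightarrow> real)"
  have h: "continuous_on UNIV (h n)" for n
    unfolding h_def
    by (intro continuous_on_Pair continuous_on_fst continuous_on_snd continuous_on_id
        continuous_on_section_seq)
  have "closed (\<Inter>n. h n -` F n)"
    by (intro closed_vimage closed_INT ballI F h)
  moreover have "(t, y) \<in> (\<Inter>n. G n) \<longleftrightarrow> (\<exists>w. (merge_seq (\<lambda>n. \<psi> n t), y, w) \<in> (\<Inter>n. h n -` F n))"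
    if t: "t \<in> space M" for t y
  proof
    assume "(t, y) \<in> (\<Inter>n. G n)"
    then have "\<forall>n. \<exists>w. (\<psi> n t, y, w) \<in> F n" using G[OF t] by blast
    then obtain w where "\<And>n. (\<psi> n t, y, w n) \<in> F n" by metis
    then have "(merge_seq (\<lambda>n. \<psi> n t), y, merge_seq w) \<in> (\<Inter>n. h n -` F n)"
      by (auto simp: h_def)
    then show "\<exists>w. (merge_seq (\<lambda>n. \<psi> n t), y, w) \<in> (\<Inter>n. h n -` F n)" by blast
  next
    assume "\<exists>w. (merge_seq (\<lambda>n. \<psi> n t), y, w) \<in> (\<Inter>n. h n -` F n)"
    then show "(t, y) \<in> (\<Inter>n. G n)"
      using G[OF t] by (auto simp: h_def)
  qed
  ultimately show ?thesis
    unfolding souslin_def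
    by (intro bexI[OF _ measurable_merge_seq[of \<psi> M, OF \<psi>]] exI[of _ "\<Inter>n. h n -` F n"] conjI ballI allI)
qed

lemma souslin_cong:
  assumes "\<And>t y. t \<in> space M \<Longrightarrow> (t, y) \<in> G \<longleftrightarrow> (t, y) \<in> G'"
  shows "souslin M G \<longleftrightarrow> souslin M G'"
  unfolding souslin_def using assms by (simp cong: conj_cong)

lemma souslin_Int:
  assumes "souslin M G" "souslin M G'"
  shows "souslin M (G \<inter> G')"
proof -
  have "souslin M (\<Inter>n::nat. if n = 0 then G else G')"
    using assms by (intro souslin_Inter) auto
  moreover have "(\<Inter>n::nat. if n = 0 then G else G') = G \<inter> G'"
    by (auto split: if_splits)
  ultimately show ?thesis by simp
qed

lemma souslin_Un:
  assumes "souslin M G" "souslin M G'"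
  shows "souslin M (G \<union> G')"
proof -
  have "souslin M (\<Union>n::nat. if n = 0 then G else G')"
    using assms by (intro souslin_Union) auto
  moreover have "(\<Union>n::nat. if n = 0 then G else G') = G \<union> G'"
    by (auto split: if_splits)
  ultimately show ?thesis by simp
qed

lemma open_eq_UN_closed:
  fixes U :: "'y::metric_space set"
  assumes "open U"
  obtains C :: "nat \<Rightarrow> 'y set" where "\<And>n. closed (C n)" "U = (\<Union>n. C n)"
proof (cases "U = UNIV")
  case True
  then show ?thesis using that[of "\<lambda>_. UNIV"] by auto
next
  case False
  define C where "C n = {x. 1 / Suc n \<le> infdist x (- U)}" for n
  have "closed (C n)" for n
    unfolding C_def by (intro closed_Collect_le continuous_intros)
  moreover have "U = (\<Union>n. C n)"
  proof -
    have 1: "x \<in> U \<longleftrightarrow> 0 < infdist x (- U)" for x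
      using in_closed_iff_infdist_zero[of "- U" x] False assms infdist_nonneg[of x "- U"]
      by (auto simp: closed_Compl less_le)
    have 2: "0 < r \<longleftrightarrow> (\<exists>n. 1 / Suc n \<le> r)" for r :: real
    proof
      assume "0 < r"
      then show "\<exists>n. 1 / Suc n \<le> r" by (meson less_imp_le nat_approx_posE)
    next
      assume "\<exists>n. 1 / Suc n \<le> r"
      then obtain n where "1 / Suc n \<le> r" by blast
      then show "0 < r" by (rule less_le_trans[rotated]) simp
    qed
    show ?thesis by (simp only: set_eq_iff UN_iff C_def mem_Collect_eq 1 2) blast
  qed
  ultimately show ?thesis by (rule that)
qed

text \<open>Complements are not among the operations that preserve \<open>souslin\<close>, so the
  induction carries each set together with its complement. Closed sets can start it because open
  sets are countable unions of closed ones.\<close>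

lemma souslin_Times_borel:
  fixes B :: "'y::metric_space set"
  assumes "B \<in> sets borel"
  shows "souslin M (UNIV \<times> B) \<and> souslin M (UNIV \<times> - B)"
proof -
  have eq: "souslin M (UNIV \<times> B) \<longleftrightarrow> souslin M (space M \<times> B)" for B :: "'y set"
    by (intro souslin_cong) auto
  have "B \<in> sigma_sets UNIV (Collect closed)"
    using assms by (simp add: borel_eq_closed)
  then show ?thesis
  proof induct
    case (Basic B)
    then have "closed B" by simp
    then obtain C :: "nat \<Rightarrow> 'y set" where C: "\<And>n. closed (C n)" "- B = (\<Union>n. C n)"
      using open_eq_UN_closed[of "- B"] by (auto simp: open_Compl)
    have "souslin M (\<Union>n. space M \<times> C n)"
      by (intro souslin_Union souslin_Times_closed C) auto
    moreover have "(\<Union>n. space M \<times> C n) = space M \<times> - B"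
      unfolding C(2) by auto
    ultimately show ?case
      using \<open>closed B\<close> by (auto simp: eq intro: souslin_Times_closed)
  next
    case Empty
    show ?case
      using souslin_Times_closed[of "space M" M "{} :: 'y set"]
        souslin_Times_closed[of "space M" M "UNIV :: 'y set"] eq[of UNIV] eq[of "{}"] by simp
  next
    case (Compl B)
    then show ?case by (simp flip: Compl_eq_Diff_UNIV)
  next
    case (Union B)
    have "souslin M (\<Union>i. UNIV \<times> B i)" "souslin M (\<Inter>i. UNIV \<times> - B i)"
      using Union by (auto intro!: souslin_Union souslin_Inter)
    moreover have "UNIV \<times> (\<Union>i. B i) = (\<Union>i. UNIV \<times> B i)" by auto
    moreover have "UNIV \<times> - (\<Union>i. B i) = (\<Inter>i. UNIV \<times> - B i)" by auto
    ultimately show ?case by metis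
  qed
qed

lemma souslin_sets:
  fixes G :: "('a \<times> 'y::metric_space) set"
  assumes "G \<in> sets (M \<Otimes>\<^sub>M borel)"
  shows "souslin M G"
proof -
  have "G \<in> sigma_sets (space M \<times> space borel) {a \<times> b |a b. a \<in> sets M \<and> b \<in> sets borel}"
    using assms by (simp add: sets_pair_measure)
  then have "souslin M G \<and> souslin M (- G)"
  proof induct
    case (Basic G)
    then obtain A B where G: "G = A \<times> B" "A \<in> sets M" "B \<in> sets borel" by blast
    have A: "souslin M (A \<times> (UNIV :: 'y set))" "souslin M ((space M - A) \<times> (UNIV :: 'y set))"
      using G by (auto intro!: souslin_Times_closed)
    have "souslin M (A \<times> UNIV \<inter> UNIV \<times> B)" "souslin M ((space M - A) \<times> UNIV \<union> UNIV \<times> - B)"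
      using A souslin_Times_borel[OF G(3)] by (auto intro: souslin_Int souslin_Un)
    moreover have "A \<times> UNIV \<inter> UNIV \<times> B = G" using G by auto
    moreover have "souslin M ((space M - A) \<times> UNIV \<union> UNIV \<times> - B) \<longleftrightarrow> souslin M (- G)"
      using G by (intro souslin_cong) auto
    ultimately show ?case by simp
  next
    case Empty
    have "souslin M (space M \<times> (UNIV :: 'y set)) \<longleftrightarrow> souslin M (- {} :: ('a \<times> 'y) set)"
      by (intro souslin_cong) auto
    then show ?case
      using souslin_Times_closed[of "{}" M "{} :: 'y set"]
        souslin_Times_closed[of "space M" M "UNIV :: 'y set"] by simp
  next
    case (Compl G)
    have "souslin M (space M \<times> space borel - G) \<longleftrightarrow> souslin M (- G)"
      "souslin M (- (space M \<times> space borel - G)) \<longleftrightarrow> souslin M G"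
      by (intro souslin_cong; auto)+
    then show ?case using Compl by simp
  next
    case (Union G)
    then have "souslin M (\<Union>i. G i)" "souslin M (\<Inter>i. - G i)"
      by (auto intro!: souslin_Union souslin_Inter)
    then show ?case by (simp add: Compl_UN)
  qed
  then show ?thesis ..
qed

text \<open>Kuratowski--Ryll-Nardzewski scheme: \<open>\<Phi> x\<close> is cut successively with the
  first ball of radius \<open>1/2^n\<close> that it meets. The balls are closed, so the pieces stay
  closed and the hitting hypothesis for closed sets reproduces itself.\<close>

lemma measurable_selection_closed:
  fixes \<Phi> :: "'x \<Rightarrow> 'w::{complete_space, second_countable_topology} set"
  assumes closed: "\<And>x. closed (\<Phi> x)"
    and hit: "\<And>C. closed C \<Longrightarrow> {x \<in> space N. \<Phi> x \<inter> C \<noteq> {}} \<in> sets N"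
  obtains g where "g \<in> borel_measurable N" "\<And>x. x \<in> space N \<Longrightarrow> \<Phi> x \<noteq> {} \<Longrightarrow> g x \<in> \<Phi> x"
proof -
  obtain d :: "nat \<Rightarrow> 'w" where d: "\<And>w r. 0 < r \<Longrightarrow> \<exists>i. dist w (d i) < r"
    by (rule dense_sequence) (rule that)
  define least where "least n A = (LEAST i. A \<inter> cball (d i) (1/2^n) \<noteq> {})" for n :: nat and A
  define \<Psi> where "\<Psi> = rec_nat \<Phi> (\<lambda>n P x. P x \<inter> cball (d (least n (P x))) (1/2^n))"
  have \<Psi>0: "\<Psi> 0 = \<Phi>" and \<Psi>S: "\<Psi> (Suc n) x = \<Psi> n x \<inter> cball (d (least n (\<Psi> n x))) (1/2^n)" for n x
    by (auto simp: \<Psi>_def)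
  have least: "A \<inter> cball (d (least n A)) (1/2^n) \<noteq> {}" if "A \<noteq> {}" for A n
  proof -
    obtain w where "w \<in> A" using \<open>A \<noteq> {}\<close> by blast
    moreover obtain i where "dist w (d i) < 1/2^n" using d[of "1/2^n" w] by auto
    ultimately have "w \<in> A \<inter> cball (d i) (1/2^n)" by (simp add: dist_commute)
    then have "\<exists>i. A \<inter> cball (d i) (1/2^n) \<noteq> {}" by blast
    then show ?thesis unfolding least_def by (rule LeastI_ex)
  qed
  have cl: "closed (\<Psi> n x)" for n x
    by (induct n) (auto simp: \<Psi>0 \<Psi>S closed)
  have ne: "\<Psi> n x \<noteq> {}" if "\<Phi> x \<noteq> {}" for n x
    proof (induct n)
    case (Suc n)
    then show ?case unfolding \<Psi>S by (rule least)
  qed (simp add: \<Psi>0 that)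
  have hit': "(\<forall>C. closed C \<longrightarrow> {x \<in> space N. \<Psi> n x \<inter> C \<noteq> {}} \<in> sets N)
     \<and> (\<lambda>x. least n (\<Psi> n x)) \<in> measurable N (count_space UNIV)" for n
  proof (induct n)
    case 0
    have "\<forall>C. closed C \<longrightarrow> {x \<in> space N. \<Psi> 0 x \<inter> C \<noteq> {}} \<in> sets N"
      by (simp add: \<Psi>0 hit)
    then have [measurable]: "Measurable.pred N (\<lambda>x. \<Psi> 0 x \<inter> cball (d i) (1/2^0) \<noteq> {})" for i
      by (simp add: pred_def)
    have "(\<lambda>x. least 0 (\<Psi> 0 x)) \<in> measurable N (count_space UNIV)"
      unfolding least_def by measurable
    with \<open>\<forall>C. closed C \<longrightarrow> _\<close> show ?case by blast
  next
    case (Suc n)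
    then have least_m [measurable]: "(\<lambda>x. least n (\<Psi> n x)) \<in> measurable N (count_space UNIV)" by simp
    have *: "{x \<in> space N. \<Psi> (Suc n) x \<inter> C \<noteq> {}} \<in> sets N" if "closed C" for C
    proof -
      have [measurable]: "{x \<in> space N. \<Psi> n x \<inter> (cball (d i) (1/2^n) \<inter> C) \<noteq> {}} \<in> sets N" for i
        using Suc that by (auto intro!: closed_Int)
      have "{x \<in> space N. \<Psi> (Suc n) x \<inter> C \<noteq> {}} =
        (\<Union>i. {x \<in> space N. least n (\<Psi> n x) = i} \<inter> {x \<in> space N. \<Psi> n x \<inter> (cball (d i) (1/2^n) \<inter> C) \<noteq> {}})"
        by (auto simp: \<Psi>S Int_assoc)
      also have "\<dots> \<in> sets N" by measurable
      finally show ?thesis .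
    qed
    then have [measurable]: "Measurable.pred N (\<lambda>x. \<Psi> (Suc n) x \<inter> cball (d i) (1/2^Suc n) \<noteq> {})" for i
      by (simp add: pred_def)
    have "(\<lambda>x. least (Suc n) (\<Psi> (Suc n) x)) \<in> measurable N (count_space UNIV)"
      unfolding least_def by measurable
    with * show ?case by blast
  qed
  define g where "g x = (if \<Phi> x \<noteq> {} then lim (\<lambda>n. d (least n (\<Psi> n x))) else d 0)" for x
  have lim: "(\<lambda>n. d (least n (\<Psi> n x))) \<longlonglongrightarrow> g x \<and> g x \<in> \<Phi> x" if x: "\<Phi> x \<noteq> {}" for x
  proof -
    have small: "(\<lambda>n. 2 * (1/2^n)) \<longlonglongrightarrow> (0::real)"
      using LIMSEQ_divide_realpow_zero[of 2 2] by simp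
    have "\<exists>w. \<forall>n. w \<in> \<Psi> n x"
    proof (rule decreasing_closed_nest[rule_format])
      show "\<Psi> n x \<subseteq> \<Psi> m x" if "m \<le> n" for m n
        using that by (induct rule: dec_induct) (auto simp: \<Psi>S)
      show "\<exists>n. \<forall>w\<in>\<Psi> n x. \<forall>w'\<in>\<Psi> n x. dist w w' < e" if "0 < e" for e
      proof -
        have "\<forall>\<^sub>F n in sequentially. 2 * (1/2^n) < e"
          using small that by (rule order_tendstoD)
        then obtain n :: nat where n: "2 * (1/2^n) < e"
          by (auto simp: eventually_sequentially)
        have "dist w w' < e" if "w \<in> \<Psi> (Suc n) x" "w' \<in> \<Psi> (Suc n) x" for w w'
        proof -
          have "dist w w' \<le> dist (d (least n (\<Psi> n x))) w + dist (d (least n (\<Psi> n x))) w'"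
            by (rule dist_triangle3)
          then show ?thesis using that n by (auto simp: \<Psi>S)
        qed
        then show ?thesis by blast
      qed
    qed (auto simp: cl ne x)
    then obtain w where w: "\<And>n. w \<in> \<Psi> n x" by blast
    have "\<forall>\<^sub>F n in sequentially. dist (d (least n (\<Psi> n x))) w \<le> 1/2^n"
      unfolding eventually_sequentially
    proof (intro exI allI impI)
      show "dist (d (least n (\<Psi> n x))) w \<le> 1/2^n" for n
        using w[of "Suc n"] by (simp add: \<Psi>S)
    qed
    moreover have "(\<lambda>n. 1/2^n) \<longlonglongrightarrow> (0::real)"
      using LIMSEQ_divide_realpow_zero[of 2 1] by simp
    ultimately have "(\<lambda>n. d (least n (\<Psi> n x))) \<longlonglongrightarrow> w"
      unfolding tendsto_dist_iff[of _ w]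
      by (rule tendsto_sandwich[OF always_eventually[OF allI[OF zero_le_dist]] _ tendsto_const])
    moreover from this have "g x = w" unfolding g_def using x by (simp add: limI)
    ultimately show ?thesis using w[of 0] by (simp add: \<Psi>0)
  qed
  have "g \<in> borel_measurable N"
  proof (rule borel_measurable_LIMSEQ_metric)
    have "{x \<in> space N. \<Phi> x \<noteq> {}} \<in> sets N" using hit[of UNIV] by simp
    then show "(\<lambda>x. if \<Phi> x \<noteq> {} then d (least n (\<Psi> n x)) else d 0) \<in> borel_measurable N" for n
      using hit'[of n] by (intro measurable_If) (auto intro: measurable_compose)
    show "(\<lambda>n. if \<Phi> x \<noteq> {} then d (least n (\<Psi> n x)) else d 0) \<longlonglongrightarrow> g x" for x
      using lim[of x] by (auto simp: g_def)
  qed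
  with lim show ?thesis using that by blast
qed

text \<open>The range is totally bounded, hence has compact closure. A net is asked only for the
  tail from \<open>n\<close> on, because in the application the first terms need not lie in the
  \<open>n\<close>-th cutting set.\<close>

lemma bounded_tail_subseq:
  fixes w :: "nat \<Rightarrow> 'w::complete_space"
  assumes "\<And>n. \<exists>D r. finite D \<and> r \<le> 1/2^n \<and> (\<forall>k\<ge>n. \<exists>d\<in>D. dist d (w k) \<le> r)"
  shows "\<exists>l r. strict_mono r \<and> (w \<circ> r) \<longlonglongrightarrow> l"
proof -
  have "compact (closure (range w))"
    unfolding compact_eq_totally_bounded
  proof (intro conjI allI impI)
    show "complete (closure (range w))" by (simp add: complete_eq_closed)
    fix e :: real assume "0 < e"
    obtain n :: nat where n: "1/2^n < e/2"
      using one_less_power \<open>0 < e\<close> real_arch_pow_inv[of "e/2" "1/2"] by (auto simp: power_one_over)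
    obtain D r where D: "finite D" "r \<le> 1/2^n" "\<And>k. k \<ge> n \<Longrightarrow> \<exists>d\<in>D. dist d (w k) \<le> r"
      using assms[of n] by blast
    have "range w \<subseteq> (\<Union>d\<in>D \<union> w ` {..n}. cball d (e/2))"
    proof
      fix x assume "x \<in> range w"
      then obtain k where k: "x = w k" by blast
      show "x \<in> (\<Union>d\<in>D \<union> w ` {..n}. cball d (e/2))"
      proof (cases "k \<ge> n")
        case True
        then obtain d where "d \<in> D" "dist d (w k) \<le> r" using D by blast
        then show ?thesis using k n D(2) by (intro UN_I[of d]) auto
      next
        case False
        then show ?thesis using k \<open>0 < e\<close> by (intro UN_I[of "w k"]) auto
      qed
    qed
    moreover have "closed (\<Union>d\<in>D \<union> w ` {..n}. cball d (e/2))"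
      using D by (intro closed_UN) auto
    ultimately have "closure (range w) \<subseteq> (\<Union>d\<in>D \<union> w ` {..n}. cball d (e/2))"
      by (rule closure_minimal)
    also have "\<dots> \<subseteq> (\<Union>d\<in>D \<union> w ` {..n}. ball d e)"
      using \<open>0 < e\<close> by (intro UN_mono) auto
    finally show "\<exists>k. finite k \<and> closure (range w) \<subseteq> (\<Union>x\<in>k. ball x e)"
      using D(1) by (intro exI[of _ "D \<union> w ` {..n}"]) auto
  qed
  then have "seq_compact (closure (range w))" by (simp add: compact_eq_seq_compact_metric)
  then show ?thesis
    using seq_compactE[of "closure (range w)" w] closure_subset[of "range w"] by (metis rangeI subsetD)
qed

text \<open>Outer measure is continuous along increasing sequences of arbitrary sets. Measurability
  must not be assumed, since the sets in question are projections whose measurability is the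
  goal.\<close>

lemma (in finite_measure) outer_measure_approx:
  assumes A: "incseq A" "\<And>m. A m \<subseteq> space M" and e: "0 < (e::real)"
  shows "\<exists>m::nat. outer_measure_of M (\<Union>m. A m) \<le> outer_measure_of M (A m) + ennreal e"
proof (rule ccontr)
  assume "\<not> ?thesis"
  then have less: "outer_measure_of M (A m) + ennreal e < outer_measure_of M (\<Union>m. A m)" for m
    by (simp add: not_le)
  have "outer_measure_of M (\<Union>m. A m) + ennreal e = (SUP m. outer_measure_of M (A m)) + ennreal e"
    using SUP_outer_measure_of_incseq[OF A(2) A(1)] by simp
  also have "\<dots> = (SUP m. outer_measure_of M (A m) + ennreal e)"
    by (rule ennreal_SUP_add_left[symmetric]) auto
  also have "\<dots> \<le> outer_measure_of M (\<Union>m. A m)"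
    using less by (intro SUP_least less_imp_le)
  finally have le: "outer_measure_of M (\<Union>m. A m) + ennreal e \<le> outer_measure_of M (\<Union>m. A m)" .
  have "outer_measure_of M (\<Union>m. A m) \<le> outer_measure_of M (space M)"
    using A(2) by (intro outer_measure_of_mono) auto
  also have "\<dots> < \<infinity>" using emeasure_finite by (simp add: less_top[symmetric])
  finally show False using le e
    by (metis add_0_right ennreal_add_left_cancel_le ennreal_eq_0_iff infinity_ennreal_def le_zero_eq less_irrefl not_le)
qed

text \<open>Choquet's capacitability argument: the second factor is cut down to a compact set in countably
  many steps, each of which costs little outer measure of the projection.\<close>

lemma projection_inner_approx:
  fixes F :: "('x::metric_space \<times> 'w::{complete_space, second_countable_topology}) set"
  assumes "finite_measure N" and N: "sets N = sets borel" and "closed F" and "0 < (e::real)"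
  shows "\<exists>H\<in>sets N. \<exists>g\<in>borel_measurable N. (\<forall>x\<in>H. (x, g x) \<in> F) \<and>
    outer_measure_of N (fst ` F) \<le> emeasure N H + ennreal e"
proof -
  interpret finite_measure N by fact
  have space: "space N = UNIV" using sets_eq_imp_space_eq[OF N] by simp
  obtain d :: "nat \<Rightarrow> 'w" where d: "\<And>w r. 0 < r \<Longrightarrow> \<exists>i. dist w (d i) < r"
    by (rule dense_sequence) (rule that)
  \<comment> \<open>Finite unions of small closed balls: a set that lies in one of them for every
    \<open>n\<close> is totally bounded.\<close>
  define L where "L n m = (\<Union>i\<le>m. cball (d i) (1/2^n))" for n m :: nat
  have Lclosed: "closed (L n m)" for n m unfolding L_def by (intro closed_UN) auto
  have Lmono: "L n m \<subseteq> L n m'" if "m \<le> m'" for n m m'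
    unfolding L_def using that by force
  have Lcover: "(\<Union>m. L n m) = UNIV" for n
  proof -
    have "w \<in> (\<Union>m. L n m)" for w
      using d[of "1/2^n" w] by (auto simp: L_def dist_commute intro!: less_imp_le)
    then show ?thesis by blast
  qed
  define cut where "cut n Q m = Q \<inter> UNIV \<times> L n m" for n m and Q :: "('x \<times> 'w) set"
  have "\<exists>m. outer_measure_of N (fst ` Q) \<le> outer_measure_of N (fst ` cut n Q m) + ennreal (e / 2^Suc n)"
    for n Q
  proof -
    have "(\<Union>m. fst ` cut n Q m) = fst ` Q"
    proof -
      have "(\<Union>m. cut n Q m) = Q \<inter> UNIV \<times> (\<Union>m. L n m)" unfolding cut_def by blast
      then show ?thesis using Lcover by (simp flip: image_UN)
    qed
    moreover have "incseq (\<lambda>m. fst ` cut n Q m)"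
      unfolding incseq_def cut_def using Lmono by (intro allI impI image_mono) blast
    ultimately show ?thesis
      using outer_measure_approx[of "\<lambda>m. fst ` cut n Q m" "e / 2^Suc n"] \<open>0 < e\<close> by (simp add: space)
  qed
  note ex_cut = this
  define m where "m n Q = (SOME m. outer_measure_of N (fst ` Q)
      \<le> outer_measure_of N (fst ` cut n Q m) + ennreal (e / 2^Suc n))" for n Q
  have m: "outer_measure_of N (fst ` Q)
      \<le> outer_measure_of N (fst ` cut n Q (m n Q)) + ennreal (e / 2^Suc n)" for n Q
    unfolding m_def by (rule someI_ex) (rule ex_cut)
  define Q where "Q = rec_nat F (\<lambda>n Q. cut n Q (m n Q))"
  have Q0: "Q 0 = F" and QS: "Q (Suc n) = Q n \<inter> UNIV \<times> L n (m n (Q n))" for n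
    by (auto simp: Q_def cut_def)
  define K where "K n = L n (m n (Q n))" for n
  have Q: "Q n = F \<inter> UNIV \<times> (\<Inter>k<n. K k)" for n
    by (induct n) (auto simp: Q0 QS K_def lessThan_Suc)
  \<comment> \<open>The cut with index \<open>n\<close> costs \<open>e / 2^Suc n\<close>, and the
    first \<open>n\<close> of these costs sum to \<open>e * (1 - 1/2^n)\<close>.\<close>
  have outer: "outer_measure_of N (fst ` F) \<le> outer_measure_of N (fst ` Q n) + ennreal (e * (1 - 1/2^n))" for n
  proof (induct n)
    case (Suc n)
    note Suc
    also have "outer_measure_of N (fst ` Q n) \<le> outer_measure_of N (fst ` Q (Suc n)) + ennreal (e / 2^Suc n)"
      using m[of "Q n" n] by (simp add: QS cut_def)
    finally have "outer_measure_of N (fst ` F) \<le>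
      outer_measure_of N (fst ` Q (Suc n)) + (ennreal (e / 2^Suc n) + ennreal (e * (1 - 1/2^n)))"
      by (simp add: add.assoc add_right_mono)
    also have "ennreal (e / 2^Suc n) + ennreal (e * (1 - 1/2^n)) = ennreal (e / 2^Suc n + e * (1 - 1/2^n))"
      using \<open>0 < e\<close> by (intro ennreal_plus[symmetric]) auto
    also have "e / 2^Suc n + e * (1 - 1/2^n) = e * (1 - 1/2^Suc n)" by (simp add: field_simps)
    finally show ?case .
  qed (simp add: Q0)
  \<comment> \<open>For every \<open>k\<close>, all witnesses but finitely many lie in
    \<open>K k\<close>, so a subsequence converges. This compactness is used twice: to see that
    \<open>\<Phi>\<close> meets a closed set on a closed set of \<open>x\<close>, and to identify
    the limit of the projections.\<close>
  have limit: "\<exists>w. (x, w) \<in> F \<and> w \<in> C \<and> (\<forall>n. w \<in> K n)"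
    if x: "x' \<longlonglongrightarrow> x" and w': "\<And>n. (x' n, w' n) \<in> Q n" "\<And>n. w' n \<in> C" and "closed C" for x x' w' C
  proof -
    have wK: "w' n \<in> K k" if "k < n" for n k using w'(1)[of n] that by (auto simp: Q)
    have "\<exists>l r. strict_mono r \<and> (w' \<circ> r) \<longlonglongrightarrow> l"
    proof (rule bounded_tail_subseq)
      fix n
      define D where "D = d ` {..m n (Q n)} \<union> w' ` {..n}"
      have "\<exists>c\<in>D. dist c (w' k) \<le> 1/2^n" for k
      proof (cases "n < k")
        case True
        then have "w' k \<in> (\<Union>i\<le>m n (Q n). cball (d i) (1/2^n))" using wK[of n k] by (simp add: K_def L_def)
        then show ?thesis by (auto simp: D_def)
      qed (auto simp: D_def intro!: bexI[of _ "w' k"])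
      moreover have "finite D" by (simp add: D_def)
      ultimately show "\<exists>D r. finite D \<and> r \<le> 1/2^n \<and> (\<forall>k\<ge>n. \<exists>d\<in>D. dist d (w' k) \<le> r)" by blast
    qed
    then obtain w r where r: "strict_mono r" "(w' \<circ> r) \<longlonglongrightarrow> w" by blast
    have "(\<lambda>n. (x' (r n), w' (r n))) \<longlonglongrightarrow> (x, w)"
      using r LIMSEQ_subseq_LIMSEQ[OF x r(1)] by (intro tendsto_Pair) (auto simp: o_def)
    moreover have "(x' (r n), w' (r n)) \<in> F" for n using w'(1)[of "r n"] by (simp add: Q)
    ultimately have "(x, w) \<in> F" by (rule closed_sequentially[OF \<open>closed F\<close>, rotated])
    moreover have "w \<in> C"
      using closed_sequentially[OF \<open>closed C\<close> _ r(2)] w'(2) by simp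
    moreover have "w \<in> K n" for n
    proof (rule Lim_in_closed_set[OF _ _ _ r(2)])
      show "closed (K n)" by (simp add: K_def Lclosed)
      have "\<forall>k>n. (w' \<circ> r) k \<in> K n" using wK seq_suble[OF r(1)] by (auto intro: less_le_trans)
      then show "\<forall>\<^sub>F k in sequentially. (w' \<circ> r) k \<in> K n" by (intro eventually_mono[OF eventually_gt_at_top[of n]]) blast
    qed simp
    ultimately show ?thesis by blast
  qed
  define \<Phi> where "\<Phi> x = {w. (x, w) \<in> F} \<inter> (\<Inter>n. K n)" for x
  have "closed (\<Phi> x)" for x
  proof -
    have "{w. (x, w) \<in> F} = Pair x -` F" by auto
    moreover have "closed (Pair x -` F)" by (intro closed_vimage \<open>closed F\<close> continuous_intros)
    ultimately show ?thesis unfolding \<Phi>_def K_def by (auto intro!: closed_Int closed_INT Lclosed)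
  qed
  moreover have hit: "closed {x. \<Phi> x \<inter> C \<noteq> {}}" if "closed C" for C
    unfolding closed_sequential_limits
  proof (intro allI impI, elim conjE)
    fix x' x assume "\<forall>n. x' n \<in> {x. \<Phi> x \<inter> C \<noteq> {}}" and lim: "x' \<longlonglongrightarrow> x"
    then have "\<forall>n. \<exists>w. w \<in> \<Phi> (x' n) \<inter> C" by blast
    then obtain w' where "\<And>n. w' n \<in> \<Phi> (x' n) \<inter> C" by metis
    then have "\<And>n. (x' n, w' n) \<in> Q n" "\<And>n. w' n \<in> C" by (auto simp: \<Phi>_def Q)
    from limit[OF lim this \<open>closed C\<close>] show "x \<in> {x. \<Phi> x \<inter> C \<noteq> {}}" by (auto simp: \<Phi>_def)
  qed
  then have "{x \<in> space N. \<Phi> x \<inter> C \<noteq> {}} \<in> sets N" if "closed C" for C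
    using that by (simp add: space N)
  ultimately obtain g where g: "g \<in> borel_measurable N" "\<And>x. \<Phi> x \<noteq> {} \<Longrightarrow> g x \<in> \<Phi> x"
    using measurable_selection_closed[of \<Phi> N] by (auto simp: space)
  define H where "H = {x. \<Phi> x \<noteq> {}}"
  have H: "H \<in> sets N" using hit[of UNIV] by (simp add: N H_def)
  \<comment> \<open>Closures make the projections of \<open>Q n\<close> measurable, and by
    compactness this enlargement gains nothing in the limit.\<close>
  have "(\<Inter>n. closure (fst ` Q n)) \<subseteq> H"
  proof
    fix x assume "x \<in> (\<Inter>n. closure (fst ` Q n))"
    then have "\<exists>x'\<in>fst ` Q n. dist x' x < 1 / Suc n" for n
    proof -
      have "x \<in> closure (fst ` Q n)" "0 < 1 / real (Suc n)" using \<open>x \<in> _\<close> by auto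
      then show ?thesis unfolding closure_approachable by blast
    qed
    then have "\<forall>n. \<exists>z\<in>Q n. dist (fst z) x < 1 / Suc n" by blast
    then obtain z where z: "\<And>n. z n \<in> Q n" "\<And>n. dist (fst (z n)) x < 1 / Suc n"
      by metis
    have "(\<lambda>n. fst (z n)) \<longlonglongrightarrow> x"
      unfolding tendsto_dist_iff[of _ x]
      by (rule tendsto_sandwich[OF always_eventually[OF allI[OF zero_le_dist]]
            always_eventually[OF allI[OF less_imp_le[OF z(2)]]] tendsto_const])
        (use LIMSEQ_inverse_real_of_nat in \<open>simp add: inverse_eq_divide\<close>)
    from limit[OF this, of "\<lambda>n. snd (z n)" UNIV] z(1) show "x \<in> H" by (auto simp: H_def \<Phi>_def)
  qed
  then have "emeasure N (\<Inter>n. closure (fst ` Q n)) \<le> emeasure N H"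
    using H by (rule emeasure_mono)
  moreover have "(INF n. emeasure N (closure (fst ` Q n))) = emeasure N (\<Inter>n. closure (fst ` Q n))"
  proof (rule INF_emeasure_decseq)
    show "range (\<lambda>n. closure (fst ` Q n)) \<subseteq> sets N" by (auto simp: N)
    show "decseq (\<lambda>n. closure (fst ` Q n))"
      unfolding decseq_Suc_iff by (intro allI closure_mono image_mono) (auto simp: QS)
  qed auto
  moreover have "outer_measure_of N (fst ` F) - ennreal e \<le> emeasure N (closure (fst ` Q n))" for n
  proof -
    have "outer_measure_of N (fst ` F) \<le> outer_measure_of N (fst ` Q n) + ennreal (e * (1 - 1/2^n))"
      by (rule outer)
    also have "\<dots> \<le> outer_measure_of N (closure (fst ` Q n)) + ennreal e"
      using \<open>0 < e\<close> by (intro add_mono outer_measure_of_mono closure_subset ennreal_leI) auto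
    also have "outer_measure_of N (closure (fst ` Q n)) = emeasure N (closure (fst ` Q n))"
      by (simp add: N)
    finally show ?thesis by (simp add: ennreal_minus_le_iff add.commute)
  qed
  then have "outer_measure_of N (fst ` F) - ennreal e \<le> (INF n. emeasure N (closure (fst ` Q n)))"
    by (rule INF_greatest)
  ultimately have "outer_measure_of N (fst ` F) - ennreal e \<le> emeasure N H" by simp
  then have "outer_measure_of N (fst ` F) \<le> emeasure N H + ennreal e"
    by (simp add: ennreal_minus_le_iff add.commute)
  moreover have "\<forall>x\<in>H. (x, g x) \<in> F" using g(2) by (auto simp: H_def \<Phi>_def)
  ultimately show ?thesis using H g(1) by blast
qed

text \<open>The union of inner approximations with errors \<open>1 / Suc n\<close> has the same
  measure as a measurable cover of the projection, so only a null set of the cover is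
  missed.\<close>

lemma null_covered_projection:
  fixes F :: "('x::metric_space \<times> 'w::{complete_space, second_countable_topology}) set"
  assumes "finite_measure N" and N: "sets N = sets borel" and "closed F"
  shows "\<exists>H\<in>sets N. \<exists>g\<in>borel_measurable N. \<exists>B\<in>null_sets N.
    (\<forall>x\<in>H. (x, g x) \<in> F) \<and> fst ` F \<subseteq> H \<union> B"
proof -
  interpret finite_measure N by fact
  have space: "space N = UNIV" using sets_eq_imp_space_eq[OF N] by simp
  have "\<forall>n. \<exists>Hg. fst Hg \<in> sets N \<and> snd Hg \<in> borel_measurable N \<and> (\<forall>x\<in>fst Hg. (x, snd Hg x) \<in> F) \<and>
    outer_measure_of N (fst ` F) \<le> emeasure N (fst Hg) + ennreal (1 / Suc n)"
  proof
    fix n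
    show "\<exists>Hg. fst Hg \<in> sets N \<and> snd Hg \<in> borel_measurable N \<and> (\<forall>x\<in>fst Hg. (x, snd Hg x) \<in> F) \<and>
      outer_measure_of N (fst ` F) \<le> emeasure N (fst Hg) + ennreal (1 / Suc n)"
      using projection_inner_approx[OF assms, of "1 / Suc n"] by force
  qed
  then obtain Hg where Hg: "\<And>n. fst (Hg n) \<in> sets N" "\<And>n. snd (Hg n) \<in> borel_measurable N"
    "\<And>n x. x \<in> fst (Hg n) \<Longrightarrow> (x, snd (Hg n) x) \<in> F"
    "\<And>n. outer_measure_of N (fst ` F) \<le> emeasure N (fst (Hg n)) + ennreal (1 / Suc n)"
    by metis
  define H where "H = (\<Union>n. fst (Hg n))"
  have H[measurable]: "H \<in> sets N" unfolding H_def using Hg(1) by auto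
  define k where "k x = (LEAST n. x \<in> fst (Hg n))" for x
  define g where "g x = snd (Hg (k x)) x" for x
  have k: "x \<in> fst (Hg (k x))" if "x \<in> H" for x
    unfolding k_def using that LeastI_ex[of "\<lambda>n. x \<in> fst (Hg n)"] by (auto simp: H_def)
  have [measurable]: "fst (Hg n) \<in> sets N" "snd (Hg n) \<in> borel_measurable N" for n
    by (rule Hg)+
  have "k \<in> measurable N (count_space UNIV)"
    unfolding k_def by measurable
  then have "g \<in> borel_measurable N"
    unfolding g_def by (rule measurable_compose_countable[OF Hg(2)])
  moreover have "\<forall>x\<in>H. (x, g x) \<in> F"
    using Hg(3) k unfolding g_def by blast
  moreover obtain B where B: "B \<in> sets N" "fst ` F \<subseteq> B" "outer_measure_of N (fst ` F) = emeasure N B"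
    using outer_measure_of_attain[of "fst ` F" N] by (auto simp: space)
  have "B - H \<in> null_sets N"
  proof -
    have sub: "H \<subseteq> B" using B(2) Hg(3) unfolding H_def by force
    have "emeasure N B \<le> emeasure N H + ennreal (1 / Suc n)" for n
    proof -
      have "emeasure N (fst (Hg n)) \<le> emeasure N H" by (intro emeasure_mono) (auto simp: H_def)
      with Hg(4)[of n] show ?thesis unfolding B(3) by (meson add_right_mono order_trans)
    qed
    then have le: "measure N B \<le> measure N H + 1 / Suc n" for n
      unfolding emeasure_eq_measure by (simp flip: ennreal_plus)
    have "measure N B \<le> measure N H"
      by (rule field_le_epsilon) (meson le nat_approx_posE less_imp_le add_left_mono order_trans)
    then have "measure N (B - H) = 0"
      using finite_measure_Diff[OF B(1) H sub] finite_measure_mono[OF sub B(1)] by simp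
    then show ?thesis using B(1) by (simp add: emeasure_eq_measure null_setsI)
  qed
  moreover have "fst ` F \<subseteq> H \<union> (B - H)" using B(2) by blast
  ultimately show ?thesis using H by blast
qed

text \<open>The finite measure with density \<open>h\<close> is transported by \<open>\<psi>\<close>
  to real sequences, where the closed set is projected. As \<open>h\<close> is positive, null sets
  of the image pull back to null sets of \<open>M\<close>, and completeness of \<open>M\<close> then
  makes the projection measurable.\<close>

theorem measurable_projection_selection:
  fixes G :: "('a \<times> 'y::{complete_space, second_countable_topology}) set"
  assumes "complete_measure M" "sigma_finite_measure M" and G: "G \<in> sets (M \<Otimes>\<^sub>M borel)"
  shows "fst ` G \<in> sets M" and "\<exists>g\<in>borel_measurable M. AE t in M. t \<in> fst ` G \<longrightarrow> (t, g t) \<in> G"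
proof -
  interpret complete_measure M by fact
  interpret sigma_finite_measure M by fact
  obtain \<psi> :: "'a \<Rightarrow> nat \<Rightarrow> real" and F :: "((nat \<Rightarrow> real) \<times> 'y \<times> (nat \<Rightarrow> real)) set"
    where \<psi>[measurable]: "\<psi> \<in> borel_measurable M" and F: "closed F"
      and GF: "\<And>t y. t \<in> space M \<Longrightarrow> (t, y) \<in> G \<longleftrightarrow> (\<exists>w. (\<psi> t, y, w) \<in> F)"
    using souslin_sets[OF G] unfolding souslin_def by blast
  obtain h :: "'a \<Rightarrow> ennreal" where h[measurable]: "h \<in> borel_measurable M"
    and hfin: "integral\<^sup>N M h \<noteq> \<infinity>" and hpos: "\<forall>t\<in>space M. 0 < h t \<and> h t < \<infinity>"
    using Ex_finite_integrable_function by blast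
  define N where "N = distr (density M h) borel \<psi>"
  have "finite_measure (density M h)"
    using hfin by (intro finite_measureI) (simp add: emeasure_density cong: nn_integral_cong)
  then have "finite_measure N"
    unfolding N_def by (rule finite_measure.finite_measure_distr) simp
  then obtain H g B where H: "H \<in> sets N" and g: "g \<in> borel_measurable N" and B: "B \<in> null_sets N"
    and HF: "\<And>x. x \<in> H \<Longrightarrow> (x, g x) \<in> F" and FHB: "fst ` F \<subseteq> H \<union> B"
    using null_covered_projection[of N F] F by (auto simp: N_def)
  have [measurable]: "H \<in> sets borel" "g \<in> borel_measurable borel" using H g by (auto simp: N_def)
  have "AE x in distr (density M h) borel \<psi>. x \<notin> B" using B unfolding N_def by (rule AE_not_in)
  then have "AE t in density M h. \<psi> t \<notin> B"
    using B by (subst (asm) AE_distr_iff) (auto simp: N_def null_sets_def)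
  then have "AE t in M. 0 < h t \<longrightarrow> \<psi> t \<notin> B" by (simp add: AE_density)
  then have aeB: "AE t in M. \<psi> t \<notin> B" using hpos by (auto elim!: AE_mp)
  have GH: "t \<in> fst ` G" "(t, fst (g (\<psi> t))) \<in> G" if "t \<in> space M" "\<psi> t \<in> H" for t
  proof -
    have "(\<psi> t, fst (g (\<psi> t)), snd (g (\<psi> t))) \<in> F" using HF[OF that(2)] by simp
    then show "(t, fst (g (\<psi> t))) \<in> G" using GF[OF that(1)] by blast
    then show "t \<in> fst ` G" by force
  qed
  have space: "fst ` G \<subseteq> space M"
    using sets.sets_into_space[OF G] by (auto simp: space_pair_measure)
  have HG: "\<psi> t \<in> H" if "t \<in> fst ` G" "\<psi> t \<notin> B" for t
  proof -
    obtain y where "(t, y) \<in> G" using \<open>t \<in> fst ` G\<close> by auto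
    then obtain w where "(\<psi> t, y, w) \<in> F" using GF[of t y] space by force
    then have "\<psi> t \<in> H \<union> B" using FHB by force
    then show ?thesis using \<open>\<psi> t \<notin> B\<close> by simp
  qed
  show "fst ` G \<in> sets M"
  proof (rule in_sets_AE)
    show "\<psi> -` H \<inter> space M \<in> sets M" by measurable
    show "AE t in M. t \<in> \<psi> -` H \<inter> space M \<longleftrightarrow> t \<in> fst ` G"
      using aeB AE_space by eventually_elim (use GH HG space in auto)
  qed fact
  show "\<exists>g\<in>borel_measurable M. AE t in M. t \<in> fst ` G \<longrightarrow> (t, g t) \<in> G"
  proof
    show "AE t in M. t \<in> fst ` G \<longrightarrow> (t, fst (g (\<psi> t))) \<in> G"
      using aeB AE_space by eventually_elim (use GH HG in blast)
    have "(\<lambda>t. g (\<psi> t)) \<in> borel_measurable M" by measurable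
    then show "(\<lambda>t. fst (g (\<psi> t))) \<in> borel_measurable M" 
      by (rule borel_measurable_continuous_on[rotated]) (intro continuous_on_fst continuous_on_id)
  qed
qed

section \<open>Tangency in measure\<close>

lemma (in complete_measure) borel_measurable_AE_cong:
  fixes f g :: "'a \<Rightarrow> 'b::topological_space"
  assumes g: "g \<in> borel_measurable M" and eq: "AE t in M. f t = g t"
  shows "f \<in> borel_measurable M"
proof (rule measurableI)
  fix B :: "'b set" assume "B \<in> sets borel"
  then have A: "g -` B \<inter> space M \<in> sets M" using g by (rule measurable_sets[rotated])
  have ae: "AE t in M. t \<in> g -` B \<inter> space M \<longleftrightarrow> t \<in> f -` B \<inter> space M"
    using eq by eventually_elim auto
  show "f -` B \<inter> space M \<in> sets M"
    by (rule in_sets_AE[OF ae A]) simp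
qed simp

lemma (in complete_measure) strongly_measurable_iff_borel_measurable:
  fixes f :: "'a \<Rightarrow> 'b::{banach, second_countable_topology}"
  shows "strongly_measurable M f \<longleftrightarrow> f \<in> borel_measurable M"
proof
  assume "strongly_measurable M f"
  then obtain s where s: "\<And>i. simple_function M (s i)" "AE t in M. (\<lambda>i. s i t) \<longlonglongrightarrow> f t"
    unfolding strongly_measurable_def by blast
  have "(\<lambda>t. lim (\<lambda>i. s i t)) \<in> borel_measurable M"
    using s(1) by (intro borel_measurable_lim_metric borel_measurable_simple_function)
  moreover have "AE t in M. f t = lim (\<lambda>i. s i t)"
    using s(2) by eventually_elim (simp add: limI)
  ultimately show "f \<in> borel_measurable M" by (rule borel_measurable_AE_cong)
next
  assume "f \<in> borel_measurable M"
  from borel_measurable_implies_sequence_metric[OF this, of 0] obtain s where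
    s: "\<forall>i. simple_function M (s i)" "\<forall>t\<in>space M. (\<lambda>i. s i t) \<longlonglongrightarrow> f t" by blast
  then show "strongly_measurable M f"
    unfolding strongly_measurable_def by (intro exI[of _ s]) auto
qed

definition graph_over :: "'a measure \<Rightarrow> ('a \<Rightarrow> 'y set) \<Rightarrow> ('a \<times> 'y) set" where
  "graph_over M E = {(t, y). t \<in> space M \<and> y \<in> E t}"

text \<open>A point outside the closed set \<open>S t\<close> has a basic neighbourhood that misses
  \<open>S t\<close>, so the complement is a countable union of measurable rectangles.\<close>

lemma graph_measurable:
  fixes S :: "'a \<Rightarrow> 'z::second_countable_topology set"
  assumes S: "measurable_multifunction M S" and closed: "\<And>t. t \<in> space M \<Longrightarrow> closed (S t)"
  shows "graph_over M S \<in> sets (M \<Otimes>\<^sub>M borel)"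
proof -
  obtain \<B> :: "'z set set" where \<B>: "countable \<B>" "topological_basis \<B>"
    using ex_countable_basis by blast
  have [measurable]: "{t \<in> space M. S t \<inter> U \<noteq> {}} \<in> sets M" if "U \<in> \<B>" for U
    using S topological_basis_open[OF \<B>(2) that] unfolding measurable_multifunction_def by blast
  have "graph_over M S = space M \<times> UNIV - (\<Union>U\<in>\<B>. (space M - {t \<in> space M. S t \<inter> U \<noteq> {}}) \<times> U)" (is "_ = ?R")
  proof (intro set_eqI iffI)
    fix z assume "z \<in> graph_over M S"
    then show "z \<in> ?R" unfolding graph_over_def by auto
  next
    fix z assume z: "z \<in> ?R"
    obtain t y where ty: "z = (t, y)" "t \<in> space M" using z by auto
    have "y \<in> S t"
    proof (rule ccontr)
      assume "y \<notin> S t"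
      then have "y \<in> - S t" by simp
      moreover have "open (- S t)" using closed[OF ty(2)] by (rule open_Compl)
      ultimately obtain U where U: "U \<in> \<B>" "y \<in> U" "U \<subseteq> - S t"
        using topological_basisE[OF \<B>(2)] by metis
      then show False using z ty by blast
    qed
    with ty show "z \<in> graph_over M S" by (simp add: graph_over_def)
  qed
  also have "?R \<in> sets (M \<Otimes>\<^sub>M borel)"
  proof (intro sets.Diff sets.countable_UN'' \<B>(1))
    fix U assume U: "U \<in> \<B>"
    have "U \<in> sets borel" using topological_basis_open[OF \<B>(2) U] by simp
    then show "(space M - {t \<in> space M. S t \<inter> U \<noteq> {}}) \<times> U \<in> sets (M \<Otimes>\<^sub>M borel)"
      using U by (intro pair_measureI) auto
  qed (metis pair_measureI sets.top space_borel)
  finally show ?thesis .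
qed

section \<open>Multifunctions with product-measurable graph\<close>

context
  fixes M :: "'a measure" and E :: "'a \<Rightarrow> 'y::{banach, second_countable_topology} set"
  assumes complete: "complete_measure M" and sigma_finite: "sigma_finite_measure M"
    and graph: "graph_over M E \<in> sets (M \<Otimes>\<^sub>M borel)"
begin

lemma hit_measurable:
  assumes "U \<in> sets borel"
  shows "{t \<in> space M. E t \<inter> U \<noteq> {}} \<in> sets M"
proof -
  have "graph_over M E \<inter> space M \<times> U \<in> sets (M \<Otimes>\<^sub>M borel)"
    using graph assms by (intro sets.Int pair_measureI) auto
  from measurable_projection_selection(1)[OF complete sigma_finite this]
  have "fst ` (graph_over M E \<inter> space M \<times> U) \<in> sets M" .
  also have "fst ` (graph_over M E \<inter> space M \<times> U) = {t \<in> space M. E t \<inter> U \<noteq> {}}"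
    by (force simp: graph_over_def)
  finally show ?thesis .
qed

text \<open>The centre \<open>c z\<close> moves with \<open>z\<close>. A point \<open>d\<close> of a
  dense set and a rational radius \<open>q\<close> separate the condition on \<open>E\<close> from
  the condition on \<open>c\<close>, leaving countably many measurable pieces.\<close>

lemma hit_ball_measurable:
  assumes [measurable]: "c \<in> borel_measurable (M \<Otimes>\<^sub>M borel)"
  shows "{z \<in> space (M \<Otimes>\<^sub>M borel). \<exists>u\<in>E (fst z). norm (u - c z) < \<rho>} \<in> sets (M \<Otimes>\<^sub>M borel)"
proof -
  obtain c' :: "nat \<Rightarrow> 'y" where dense: "\<And>w r. 0 < r \<Longrightarrow> \<exists>i. dist w (c' i) < r"
    by (rule dense_sequence) (rule that)
  define D where "D = range c'"
  have "{z \<in> space (M \<Otimes>\<^sub>M borel). \<exists>u\<in>E (fst z). norm (u - c z) < \<rho>} =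
     (\<Union>d\<in>D. \<Union>q\<in>\<rat>. ({t \<in> space M. E t \<inter> ball d q \<noteq> {}} \<times> UNIV) \<inter>
        {z \<in> space (M \<Otimes>\<^sub>M borel). dist d (c z) < \<rho> - q})" (is "?L = ?R")
  proof (intro set_eqI iffI)
    fix z assume z: "z \<in> ?L"
    then obtain u where u: "u \<in> E (fst z)" "dist u (c z) < \<rho>" by (auto simp: dist_norm)
    define r where "r = (\<rho> - dist u (c z)) / 3"
    have "0 < r" using u by (simp add: r_def)
    then obtain d where d: "d \<in> D" "dist u d < r" using dense[of r u] by (auto simp: D_def)
    obtain q where q: "q \<in> \<rat>" "r < q" "q < 2 * r"
      using Rats_dense_in_real[of r "2 * r"] \<open>0 < r\<close> by auto
    have "u \<in> ball d q" using d q by (simp add: dist_commute)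
    moreover have "dist d (c z) < \<rho> - q"
    proof -
      have "dist d (c z) \<le> dist u d + dist u (c z)" by (rule dist_triangle3)
      then show ?thesis using d(2) q(3) unfolding r_def by (simp add: field_simps)
    qed
    moreover have "fst z \<in> space M" using z by (auto simp: space_pair_measure)
    ultimately have 1: "fst z \<in> {t \<in> space M. E t \<inter> ball d q \<noteq> {}}"
      and 2: "z \<in> {z \<in> space (M \<Otimes>\<^sub>M borel). dist d (c z) < \<rho> - q}"
      using z u(1) by blast+
    have "z \<in> {t \<in> space M. E t \<inter> ball d q \<noteq> {}} \<times> UNIV"
      using 1 unfolding mem_Times_iff by (intro conjI UNIV_I)
    then have "z \<in> ({t \<in> space M. E t \<inter> ball d q \<noteq> {}} \<times> UNIV) \<inter>
        {z \<in> space (M \<Otimes>\<^sub>M borel). dist d (c z) < \<rho> - q}"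
      using 2 by (rule IntI)
    then show "z \<in> ?R" by (intro UN_I[OF d(1)] UN_I[OF q(1)])
  next
    fix z assume "z \<in> ?R"
    then obtain d q u where "z \<in> space (M \<Otimes>\<^sub>M borel)" and u: "u \<in> E (fst z)" "dist d u < q" "dist d (c z) < \<rho> - q"
      by auto
    moreover have "dist u (c z) \<le> dist d u + dist d (c z)" by (rule dist_triangle3)
    ultimately show "z \<in> ?L" by (auto simp: dist_norm[symmetric] intro!: bexI[of _ u])
  qed
  also have "?R \<in> sets (M \<Otimes>\<^sub>M borel)"
  proof (intro sets.countable_UN'' countable_rat sets.Int)
    show "countable D" by (simp add: D_def)
  next
    fix d q
    show "{t \<in> space M. E t \<inter> ball d q \<noteq> {}} \<times> UNIV \<in> sets (M \<Otimes>\<^sub>M borel)"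
      by (intro pair_measureI hit_measurable) auto
    show "{z \<in> space (M \<Otimes>\<^sub>M borel). dist d (c z) < \<rho> - q} \<in> sets (M \<Otimes>\<^sub>M borel)"
      by measurable
  qed
  finally show ?thesis .
qed

text \<open>In the hypothesis \<open>tangent\<close> the step \<open>s\<close> is the same for all \<open>t\<close> and the exceptional set
  may depend on it. The conclusion holds because, by the drop lemma, a point of \<open>E t\<close> where
  tangency fails at some scale yields a nearby one where it fails at every smaller scale.\<close>

theorem tangent_in_measure_imp_Clarke:
  assumes closed: "AE t in M. closed (E t)" and e0: "AE t in M. e0 t \<in> E t"
    and [measurable]: "e0 \<in> borel_measurable M" "v \<in> borel_measurable M" "h \<in> borel_measurable M"
    and h: "\<And>t. t \<in> space M \<Longrightarrow> 0 < (h t :: real)"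
    and tangent: "\<And>e. 0 < e \<Longrightarrow> \<exists>d>0. \<exists>l>0. \<forall>y\<in>borel_measurable M.
      (AE t in M. y t \<in> E t \<and> norm (y t - e0 t) \<le> d * h t) \<longrightarrow>
      (\<forall>s. 0 < s \<longrightarrow> s \<le> l \<longrightarrow> (\<exists>B\<in>sets M. emeasure M B \<le> ennreal e \<and>
        (AE t in M. t \<notin> B \<longrightarrow> (\<exists>u\<in>E t. norm (u - (y t + s *\<^sub>R v t)) \<le> e * s))))"
  shows "AE t in M. v t \<in> Clarke_tangent_cone UNIV norm (E t) (e0 t)"
proof -
  \<comment> \<open>Restricting to rational scales keeps the condition measurable. Nothing is lost,
    since the drop lemma produces failure at all sufficiently small scales.\<close>
  define bad where "bad m k z \<longleftrightarrow>
     (\<forall>s\<in>\<rat>. 0 < s \<longrightarrow> s \<le> 1 / Suc k \<longrightarrow> \<not> (\<exists>u\<in>E (fst z). norm (u - (snd z + s *\<^sub>R v (fst z))) < 1 / Suc m * s))"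
    for m k :: nat and z
  have bad_m [measurable]: "Measurable.pred (M \<Otimes>\<^sub>M borel) (bad m k)" for m k
  proof -
    have [measurable]: "Measurable.pred (M \<Otimes>\<^sub>M borel) (\<lambda>z. \<exists>u\<in>E (fst z). norm (u - (snd z + s *\<^sub>R v (fst z))) < r)" for s r
      unfolding pred_def by (rule hit_ball_measurable) measurable
    show ?thesis unfolding bad_def[abs_def] pred_def
      by (intro sets.sets_Collect_countable_All' countable_rat) measurable
  qed
  have bad_mono: "bad m k' z" if "bad m k z" "k \<le> k'" for m k k' z
    using that unfolding bad_def by (force simp: frac_le intro: order_trans)
  define Q where "Q m n = {z \<in> graph_over M E. norm (snd z - e0 (fst z)) < h (fst z) / Suc n \<and> (\<exists>k. bad m k z)}"
    for m n
  have Q: "Q m n \<in> sets (M \<Otimes>\<^sub>M borel)" for m n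
  proof -
    have "Q m n = graph_over M E \<inter> {z \<in> space (M \<Otimes>\<^sub>M borel). norm (snd z - e0 (fst z)) < h (fst z) / Suc n \<and> (\<exists>k. bad m k z)}"
      by (auto simp: Q_def graph_over_def space_pair_measure)
    also have "\<dots> \<in> sets (M \<Otimes>\<^sub>M borel)"
      by (intro sets.Int graph) measurable
    finally show ?thesis .
  qed
  note P = measurable_projection_selection[OF complete sigma_finite Q]
  \<comment> \<open>At a point \<open>t\<close> of \<open>D m\<close> there are bad points
    arbitrarily close to \<open>e0 t\<close>. Off all the \<open>D m\<close>, the drop lemma will
    yield tangency.\<close>
  define D where "D m = (\<Inter>n. fst ` Q m n)" for m
  have D_sets [measurable]: "D m \<in> sets M" for m
    unfolding D_def using P(1) by auto
  have D_null: "emeasure M (D m) = 0" for m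
  proof (rule ccontr)
    assume "emeasure M (D m) \<noteq> 0"
    then obtain c' where c': "0 < c'" "c' < emeasure M (D m)"
      using dense[of 0 "emeasure M (D m)"] by (auto simp: zero_less_iff_neq_zero)
    then obtain c where c: "c' = ennreal c" "0 < c"
      by (cases c') auto
    \<comment> \<open>\<open>e < 1 / Suc m\<close> makes the tangency estimate contradict badness
      off the exceptional set, and \<open>e \<le> c\<close> makes the exceptional set too small to
      contain \<open>W k\<close>.\<close>
    define e where "e = min (1 / Suc m / 2) c"
    have half: "x / 2 < x" if "0 < x" for x :: real using that by simp
    have "e \<le> 1 / Suc m / 2" unfolding e_def by (rule min.cobounded1)
    also have "\<dots> < 1 / Suc m" by (rule half) simp
    finally have "e < 1 / Suc m" .
    then have e: "0 < e" "e < 1 / Suc m" "e \<le> c" using c(2) by (auto simp: e_def)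
    obtain d l where "0 < d" "0 < l" and dl: "\<forall>y\<in>borel_measurable M.
      (AE t in M. y t \<in> E t \<and> norm (y t - e0 t) \<le> d * h t) \<longrightarrow>
      (\<forall>s. 0 < s \<longrightarrow> s \<le> l \<longrightarrow> (\<exists>B\<in>sets M. emeasure M B \<le> ennreal e \<and>
        (AE t in M. t \<notin> B \<longrightarrow> (\<exists>u\<in>E t. norm (u - (y t + s *\<^sub>R v t)) \<le> e * s))))"
      using tangent[OF e(1)] by (elim exE conjE) (rule that)
    obtain n where n: "1 / Suc n < d" using nat_approx_posE[OF \<open>0 < d\<close>] by blast
    obtain g where g [measurable]: "g \<in> borel_measurable M" and gQ: "AE t in M. t \<in> fst ` Q m n \<longrightarrow> (t, g t) \<in> Q m n"
      using P(2)[of m n] by blast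
    note [measurable] = P(1)[of m n]
    define y where "y t = (if t \<in> fst ` Q m n then g t else e0 t)" for t
    have y [measurable]: "y \<in> borel_measurable M" unfolding y_def by measurable
    have "AE t in M. y t \<in> E t \<and> norm (y t - e0 t) \<le> d * h t"
      using gQ e0 AE_space
    proof eventually_elim
      case (elim t)
      show ?case
      proof (cases "t \<in> fst ` Q m n")
        case True
        then have "y t \<in> E t" "norm (y t - e0 t) < h t / Suc n"
          using elim by (auto simp: y_def Q_def graph_over_def)
        moreover have "h t / Suc n \<le> d * h t"
          using n mult_right_mono[of "1 / Suc n" d "h t"] h[OF \<open>t \<in> space M\<close>] by simp
        ultimately show ?thesis by simp
      next
        case False
        then show ?thesis using elim h[OF \<open>t \<in> space M\<close>] \<open>0 < d\<close> by (simp add: y_def)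
      qed
    qed
    note dl = dl[rule_format, OF y this]
    \<comment> \<open>The index \<open>k\<close> of badness varies with \<open>t\<close>. By
      continuity of the measure a single \<open>k\<close> already serves on a set of measure above
      \<open>c\<close>, and one rational step below \<open>1 / Suc k\<close> then tests all these
      \<open>t\<close> simultaneously.\<close>
    define W where "W k = {t \<in> space M. t \<in> D m \<and> bad m k (t, y t)}" for k
    have W [measurable]: "W k \<in> sets M" for k unfolding W_def by measurable
    have "AE t in M. t \<in> D m \<longleftrightarrow> t \<in> (\<Union>k. W k)"
      using gQ AE_space
    proof eventually_elim
      case (elim t)
      have "\<exists>k. bad m k (t, y t)" if "t \<in> D m"
      proof -
        have "t \<in> fst ` Q m n" using that by (auto simp: D_def)
        then show ?thesis using elim by (auto simp: y_def Q_def)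
      qed
      then show ?case using elim by (auto simp: W_def)
    qed
    then have "emeasure M (D m) = emeasure M (\<Union>k. W k)"
      by (intro emeasure_eq_AE) auto
    also have "\<dots> = (SUP k. emeasure M (W k))"
      by (intro SUP_emeasure_incseq[symmetric] incseq_SucI) (auto simp: W_def intro: bad_mono)
    finally have "c' < (SUP k. emeasure M (W k))" using c'(2) by simp
    then obtain k where k: "c' < emeasure M (W k)" unfolding less_SUP_iff by blast
    obtain s where s: "s \<in> \<rat>" "0 < s" "s < min (1 / Suc k) l"
      using Rats_dense_in_real[of 0 "min (1 / Suc k) l"] \<open>0 < l\<close> by auto
    then obtain B where B: "B \<in> sets M" "emeasure M B \<le> ennreal e"
      "AE t in M. t \<notin> B \<longrightarrow> (\<exists>u\<in>E t. norm (u - (y t + s *\<^sub>R v t)) \<le> e * s)"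
      using dl[of s] by auto
    have "AE t in M. t \<in> W k \<longrightarrow> t \<in> B"
      using B(3)
    proof eventually_elim
      case (elim t)
      show ?case
      proof (intro impI, rule ccontr)
        assume "t \<in> W k" "t \<notin> B"
        then obtain u where u: "u \<in> E t" "norm (u - (y t + s *\<^sub>R v t)) \<le> e * s" using elim by blast
        have "e * s < 1 / Suc m * s" using e s by (intro mult_strict_right_mono) auto
        with u(2) have "norm (u - (y t + s *\<^sub>R v t)) < 1 / Suc m * s" by (rule le_less_trans)
        moreover have "s \<le> 1 / Suc k" using s by simp
        ultimately show False using \<open>t \<in> W k\<close> u(1) s unfolding W_def bad_def fst_conv snd_conv by blast
      qed
    qed
    then have "emeasure M (W k) \<le> emeasure M B" using B(1) by (intro emeasure_mono_AE) auto
    also have "\<dots> \<le> c'" using B(2) e(3) c by (auto intro: order_trans ennreal_leI)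
    finally show False using k by simp
  qed
  have "AE t in M. t \<notin> D m" for m
    using D_null D_sets by (intro AE_not_in null_setsI)
  then have "AE t in M. \<forall>m. t \<notin> D m" by (simp add: AE_all_countable)
  with closed AE_space show ?thesis
  proof eventually_elim
    case (elim t)
    show ?case
    proof (rule Clarke_tangent_coneI)
      fix e :: real assume e: "0 < e"
      then obtain m where m: "1 / Suc m < e" using nat_approx_posE by blast
      define em where "em = 1 / Suc m"
      have em: "0 < em" "em \<le> e" using m by (auto simp: em_def)
      obtain n where "t \<notin> fst ` Q m n" using elim(3) by (auto simp: D_def)
      then have good: "\<not> bad m k (t, y)" if "y \<in> E t" "norm (y - e0 t) < h t / Suc n" for y k
        using that elim(2) by (force simp: Q_def graph_over_def)
      define H where "H = h t / Suc n"
      have "0 < H" using h[OF elim(2)] by (simp add: H_def)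
      \<comment> \<open>Room for the drop: \<open>y\<close> is within \<open>r\<close> of
        \<open>e0 t\<close>, the drop displaces it by at most \<open>r * (norm (v t) + em)\<close>,
        and the result must be strictly inside \<open>H\<close>. Strictness is the reason for
        \<open>2\<close> instead of \<open>1\<close>.\<close>
      define r where "r = H / (norm (v t) + em + 2)"
      have den: "0 < norm (v t) + em + 2" using em by (simp add: add_nonneg_pos)
      have "0 < r" using \<open>0 < H\<close> den by (simp add: r_def)
      have rH: "r + r * (norm (v t) + em) < H"
      proof -
        have "r * (norm (v t) + em + 2) = H" using den by (simp add: r_def)
        then show ?thesis using \<open>0 < r\<close> by (simp add: algebra_simps)
      qed
      have "\<exists>b. norm b \<le> 1 \<and> y + s *\<^sub>R (v t + e *\<^sub>R b) \<in> E t"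
        if y: "y \<in> E t" "norm (y - e0 t) \<le> r" and s: "0 \<le> s" "s \<le> r" for y s
      proof (cases "s = 0")
        case True
        then show ?thesis using y by (intro exI[of _ 0]) auto
      next
        case False
        then have "0 < s" using s by simp
        have "\<exists>u\<in>E t. norm (u - (y + s *\<^sub>R v t)) \<le> em * s"
        proof (rule ccontr)
          assume "\<not> ?thesis"
          then have "\<And>u. u \<in> E t \<Longrightarrow> em * s < norm (u - (y + s *\<^sub>R v t))" by (auto simp: not_le)
          from drop_maximal[OF elim(1) y(1) \<open>0 < s\<close> em(1) this] obtain y' l
            where y': "y' \<in> E t" "norm (y' - y) \<le> s * (norm (v t) + em)" and "0 < l"
              and miss: "\<And>s u. 0 < s \<Longrightarrow> s \<le> l \<Longrightarrow> u \<in> E t \<Longrightarrow> em * s < norm (u - (y' + s *\<^sub>R v t))" by blast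
          have "s * (norm (v t) + em) \<le> r * (norm (v t) + em)"
            using s em by (intro mult_right_mono) auto
          then have "norm (y' - e0 t) < H"
            using norm_triangle_ineq[of "y' - y" "y - e0 t"] y'(2) y(2) rH by simp
          moreover obtain k where k: "1 / Suc k < l" using nat_approx_posE[OF \<open>0 < l\<close>] by blast
          ultimately have "\<not> bad m k (t, y')" using good[OF y'(1)] by (simp add: H_def)
          then obtain q u where "0 < q" "q \<le> 1 / Suc k" "u \<in> E t" "norm (u - (y' + q *\<^sub>R v t)) < em * q"
            by (auto simp: bad_def em_def)
          with miss[of q u] k show False by (simp add: order.strict_implies_order order_trans)
        qed
        then obtain u where u: "u \<in> E t" "norm (u - (y + s *\<^sub>R v t)) \<le> em * s" by blast
        define b where "b = (1 / (s * e)) *\<^sub>R (u - (y + s *\<^sub>R v t))"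
        have "norm b = norm (u - (y + s *\<^sub>R v t)) / (s * e)" using \<open>0 < s\<close> e by (simp add: b_def)
        also have "\<dots> \<le> 1"
        proof -
          have "em * s \<le> s * e" using em \<open>0 < s\<close> by (simp add: mult.commute)
          then have "norm (u - (y + s *\<^sub>R v t)) \<le> s * e" using u(2) by (rule order_trans[rotated])
          then show ?thesis using \<open>0 < s\<close> e by (simp add: divide_le_eq_1_pos)
        qed
        finally have "norm b \<le> 1" .
        moreover have "y + s *\<^sub>R (v t + e *\<^sub>R b) = u"
          using \<open>0 < s\<close> e by (simp add: b_def algebra_simps)
        ultimately show ?thesis using u(1) by metis
      qed
      then show "\<exists>r>0. \<forall>y\<in>E t. norm (y - e0 t) \<le> r \<longrightarrow> (\<forall>s. 0 \<le> s \<longrightarrow> s \<le> r \<longrightarrow>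
          (\<exists>b\<in>UNIV. norm b \<le> 1 \<and> y + s *\<^sub>R (v t + e *\<^sub>R b) \<in> E t))"
        using \<open>0 < r\<close> by (intro exI[of _ r]) auto
    qed simp
  qed
qed

end

section \<open>Measurable selections of polar cones\<close>

text \<open>Hiai--Umegaki: a family that is closed under pasting has a sequence that is dense in it
  pointwise almost everywhere, although the family need not be separable in any norm. For every
  \<open>z\<close> of a dense sequence take a minimizing sequence of \<open>\<integral> min 1 (dist (u t) z) d\<nu>\<close>.\<close>

theorem essentially_dense_sequence:
  fixes \<C> :: "('a \<Rightarrow> 'y::{metric_space, second_countable_topology}) set"
  assumes "sigma_finite_measure M" and meas: "\<C> \<subseteq> borel_measurable M" and "\<C> \<noteq> {}"
    and paste: "\<And>u w A. u \<in> \<C> \<Longrightarrow> w \<in> \<C> \<Longrightarrow> A \<in> sets M \<Longrightarrow> (\<lambda>t. if t \<in> A then u t else w t) \<in> \<C>"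
  shows "\<exists>c :: nat \<Rightarrow> 'a \<Rightarrow> 'y. (\<forall>n. c n \<in> \<C>) \<and> (\<forall>u\<in>\<C>. AE t in M. u t \<in> closure (range (\<lambda>n. c n t)))"
proof -
  interpret sigma_finite_measure M by fact
  obtain h :: "'a \<Rightarrow> real" where h [measurable]: "h \<in> borel_measurable M" and hpos: "\<And>t. 0 < h t"
    and hint: "integrable M h"
    by (rule obtain_positive_integrable_function) (rule that)
  obtain d :: "nat \<Rightarrow> 'y" where d: "\<And>w r. 0 < r \<Longrightarrow> \<exists>i. dist w (d i) < r"
    by (rule dense_sequence) (rule that)
  \<comment> \<open>Truncation and the weight \<open>h\<close> make the distance integrable for
    every member of the family; the truncation at 1 is invisible to the radii
    \<open>r \<le> 1\<close> used below.\<close>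
  define F where "F u k t = min 1 (dist (u t) (d k)) * h t" for u :: "'a \<Rightarrow> 'y" and k t
  define J where "J u k = (\<integral>t. F u k t \<partial>M)" for u :: "'a \<Rightarrow> 'y" and k
  have Fint: "integrable M (F u k)" if "u \<in> \<C>" for u k
  proof (rule Bochner_Integration.integrable_bound[OF hint])
    have [measurable]: "u \<in> borel_measurable M" using that meas by blast
    show "F u k \<in> borel_measurable M" unfolding F_def by measurable
    show "AE t in M. norm (F u k t) \<le> norm (h t)"
      using hpos by (intro AE_I2) (simp add: F_def abs_mult mult_le_cancel_right1 less_imp_le)
  qed
  have Jpos: "0 \<le> J u k" for u k
    unfolding J_def F_def using hpos by (intro integral_nonneg_AE AE_I2) (simp add: less_imp_le)
  define m where "m k = (INF u\<in>\<C>. J u k)" for k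
  have m_le: "m k \<le> J u k" if "u \<in> \<C>" for u k
    unfolding m_def using that Jpos by (intro cINF_lower bdd_belowI2[of _ 0]) auto
  have "\<exists>u. u \<in> \<C> \<and> J u k < m k + 1 / Suc j" for k j
  proof -
    have "(INF u\<in>\<C>. J u k) < m k + 1 / Suc j" by (simp add: m_def)
    then show ?thesis
      using cINF_less_iff[OF \<open>\<C> \<noteq> {}\<close>, of "\<lambda>u. J u k"] Jpos by (metis bdd_belowI2)
  qed
  then obtain w where w: "\<And>k j. w k j \<in> \<C>" "\<And>k j. J (w k j) k < m k + 1 / Suc j" by metis
  have [measurable]: "w k j \<in> borel_measurable M" for k j using w(1) meas by blast
  define c where "c n = w (fst (prod_decode n)) (snd (prod_decode n))" for n
  have approx: "AE t in M. dist (u t) (d k) < r \<longrightarrow> (\<exists>j. dist (w k j t) (d k) < r)"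
    if u: "u \<in> \<C>" and r: "r \<le> 1" for u k r
  proof -
    have [measurable]: "u \<in> borel_measurable M" using u meas by blast
    \<comment> \<open>On \<open>A\<close>, \<open>u\<close> enters the ball and no
      \<open>w k j\<close> does. Pasting \<open>u\<close> on \<open>A\<close> into
      \<open>w k j\<close> lowers \<open>J\<close> by at least the integral of \<open>g\<close>, and
      near minimality bounds this by \<open>1 / Suc j\<close> for every \<open>j\<close>.\<close>
    define A where "A = {t \<in> space M. dist (u t) (d k) < r \<and> (\<forall>j. r \<le> dist (w k j t) (d k))}"
    have A [measurable]: "A \<in> sets M" unfolding A_def by measurable
    define g where "g t = indicator A t * ((r - dist (u t) (d k)) * h t)" for t
    have g0: "0 \<le> g t" for t
      using hpos[of t] by (auto simp: g_def A_def indicator_def)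
    have gint: "integrable M g"
    proof (rule Bochner_Integration.integrable_bound[OF hint])
      show "g \<in> borel_measurable M" unfolding g_def by measurable
      show "AE t in M. norm (g t) \<le> norm (h t)"
      proof (intro AE_I2)
        fix t
        have "\<bar>r - dist (u t) (d k)\<bar> \<le> 1" if "t \<in> A"
        proof -
          have "dist (u t) (d k) < r" using that by (simp add: A_def)
          moreover have "0 \<le> dist (u t) (d k)" by simp
          ultimately show ?thesis using r by linarith
        qed
        then show "norm (g t) \<le> norm (h t)" using hpos[of t]
          by (auto simp: g_def indicator_def abs_mult mult_le_cancel_right1)
      qed
    qed
    have "(\<integral>t. g t \<partial>M) \<le> 1 / Suc j" for j
    proof -
      define w' where "w' t = (if t \<in> A then u t else w k j t)" for t
      have w': "w' \<in> \<C>" unfolding w'_def by (intro paste u w A)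
      have "(\<integral>t. g t \<partial>M) \<le> (\<integral>t. F (w k j) k t - F w' k t \<partial>M)"
      proof (rule integral_mono[OF gint])
        show "integrable M (\<lambda>t. F (w k j) k t - F w' k t)"
          by (intro Bochner_Integration.integrable_diff Fint w w')
        fix t
        show "g t \<le> F (w k j) k t - F w' k t"
        proof (cases "t \<in> A")
          case True
          then have "r - dist (u t) (d k) \<le> min 1 (dist (w k j t) (d k)) - min 1 (dist (u t) (d k))"
            using r by (auto simp: A_def)
          then have "(r - dist (u t) (d k)) * h t \<le> (min 1 (dist (w k j t) (d k)) - min 1 (dist (u t) (d k))) * h t"
            using hpos[of t] by (intro mult_right_mono) auto
          then show ?thesis using True by (simp add: g_def F_def w'_def left_diff_distrib)
        qed (simp add: g_def F_def w'_def)
      qed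
      also have "\<dots> = J (w k j) k - J w' k"
        unfolding J_def by (intro Bochner_Integration.integral_diff Fint w w')
      also have "\<dots> \<le> 1 / Suc j" using w(2)[of k j] m_le[OF w', of k] by simp
      finally show ?thesis .
    qed
    note le_j = this
    have "(\<integral>t. g t \<partial>M) \<le> 0"
    proof (rule field_le_epsilon)
      fix e :: real assume "0 < e"
      then obtain j where "1 / Suc j < e" using nat_approx_posE by blast
      with le_j[of j] show "(\<integral>t. g t \<partial>M) \<le> 0 + e" by linarith
    qed
    then have "(\<integral>t. g t \<partial>M) = 0" using g0 by (intro antisym integral_nonneg_AE AE_I2)
    then have "AE t in M. g t = 0"
      using integral_nonneg_eq_0_iff_AE[OF gint] g0 by auto
    then show ?thesis
      using AE_space
    proof eventually_elim
      case (elim t)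
      show ?case
      proof (intro impI, rule ccontr)
        assume *: "dist (u t) (d k) < r" "\<not> (\<exists>j. dist (w k j t) (d k) < r)"
        then have "t \<in> A" using elim by (auto simp: A_def not_less)
        then have "g t = (r - dist (u t) (d k)) * h t" by (simp add: g_def)
        then show False using elim * hpos[of t] by simp
      qed
    qed
  qed
  show ?thesis
  proof (intro exI[of _ c] conjI allI ballI)
    show "c n \<in> \<C>" for n by (simp add: c_def w)
    fix u assume u: "u \<in> \<C>"
    have "AE t in M. \<forall>k. \<forall>i::nat. dist (u t) (d k) < 1 / Suc i \<longrightarrow> (\<exists>j. dist (w k j t) (d k) < 1 / Suc i)"
      unfolding AE_all_countable by (intro allI approx u) simp
    then show "AE t in M. u t \<in> closure (range (\<lambda>n. c n t))"
    proof eventually_elim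
      case (elim t)
      show ?case unfolding closure_approachable
      proof (intro allI impI)
        fix e :: real assume "0 < e"
        then obtain i where i: "1 / Suc i < e / 2" using nat_approx_posE[of "e/2"] by auto
        obtain k where k: "dist (u t) (d k) < 1 / Suc i" using d[of "1 / Suc i" "u t"] by auto
        with elim obtain j where j: "dist (w k j t) (d k) < 1 / Suc i" by blast
        have "dist (w k j t) (u t) \<le> dist (w k j t) (d k) + dist (u t) (d k)" by (rule dist_triangle2)
        then have "dist (w k j t) (u t) < e" using i j k by simp
        moreover have "w k j t = c (prod_encode (k, j)) t" by (simp add: c_def)
        ultimately show "\<exists>y\<in>range (\<lambda>n. c n t). dist y (u t) < e" by (metis rangeI)
      qed
    qed
  qed
qed

text \<open>Only countably many relations can be asserted almost everywhere at once, hence rational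
  factors and sums of members of \<open>R\<close>; continuity extends both operations to the
  closure.\<close>

lemma convex_cone_closureI:
  fixes R :: "'y::real_normed_vector set"
  assumes "R \<noteq> {}" and add: "\<And>x y. x \<in> R \<Longrightarrow> y \<in> R \<Longrightarrow> x + y \<in> closure R"
    and scale: "\<And>q x. q \<in> \<rat> \<Longrightarrow> 0 \<le> q \<Longrightarrow> x \<in> R \<Longrightarrow> q *\<^sub>R x \<in> closure R"
  shows "convex_cone (closure R)"
  unfolding convex_cone_iff
proof (intro conjI ballI allI impI)
  obtain x where "x \<in> R" using \<open>R \<noteq> {}\<close> by blast
  then show "0 \<in> closure R" using scale[of 0 x] by simp
next
  fix x y assume "x \<in> closure R" "y \<in> closure R"
  moreover have "(\<lambda>z. fst z + snd z) ` closure (R \<times> R) \<subseteq> closure R"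
    using add by (intro image_closure_subset continuous_intros) auto
  ultimately show "x + y \<in> closure R" by (force simp: closure_Times)
next
  fix x :: 'y and r :: real assume "x \<in> closure R" "0 \<le> r"
  have "r \<in> closure (\<rat> \<inter> {0..})"
    unfolding closure_approachable
  proof (intro allI impI)
    fix e :: real assume "0 < e"
    then obtain q where "q \<in> \<rat>" "r < q" "q < r + e" using Rats_dense_in_real[of r "r + e"] by auto
    then show "\<exists>q\<in>\<rat> \<inter> {0..}. dist q r < e" using \<open>0 \<le> r\<close> by (intro bexI[of _ q]) (auto simp: dist_real_def)
  qed
  moreover have "(\<lambda>z. fst z *\<^sub>R snd z) ` closure ((\<rat> \<inter> {0..}) \<times> R) \<subseteq> closure R"
    using scale by (intro image_closure_subset continuous_intros) auto
  ultimately show "r *\<^sub>R x \<in> closure R" using \<open>x \<in> closure R\<close> by (force simp: closure_Times)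
qed

text \<open>The cones \<open>K t\<close> may depend on \<open>t\<close> in a nonmeasurable way. They
  are replaced by the closure of the values of an essentially dense sequence of selections. This is
  a closed convex cone in the closure of \<open>K t\<close>, so it inherits non-density; its
  distance function is a countable infimum; and it contains almost all values of each measurable
  selection of \<open>K\<close>.\<close>

theorem measurable_polar_selection:
  fixes K :: "'a \<Rightarrow> 'y::{real_normed_vector, second_countable_topology} set"
  assumes sf: "sigma_finite_measure M" and cone: "AE t in M. convex_cone (K t)"
    and ndense: "AE t in M. \<exists>x. \<exists>e>0. \<forall>k\<in>K t. e \<le> norm (x - k)"
  shows "\<exists>f :: 'a \<Rightarrow> 'y \<Rightarrow> real. (\<forall>x. (\<lambda>t. f t x) \<in> borel_measurable M) \<and> (\<forall>t\<in>space M. bounded_linear (f t)) \<and>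
    (AE t in M. \<exists>x. 0 < f t x) \<and>
    (\<forall>c\<in>borel_measurable M. (AE t in M. c t \<in> K t) \<longrightarrow> (AE t in M. f t (c t) \<le> 0))"
proof -
  define \<C> where "\<C> = {c \<in> borel_measurable M. AE t in M. c t \<in> K t}"
  have 0: "(\<lambda>_. 0) \<in> \<C>"
    using cone by (auto simp: \<C>_def convex_cone_contains_0)
  obtain c where c: "\<And>n::nat. c n \<in> \<C>" "\<And>u. u \<in> \<C> \<Longrightarrow> AE t in M. u t \<in> closure (range (\<lambda>n. c n t))"
  proof -
    have "\<exists>c :: nat \<Rightarrow> 'a \<Rightarrow> 'y. (\<forall>n. c n \<in> \<C>) \<and> (\<forall>u\<in>\<C>. AE t in M. u t \<in> closure (range (\<lambda>n. c n t)))"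
    proof (rule essentially_dense_sequence[OF sf])
      show "(\<lambda>t. if t \<in> A then u t else w t) \<in> \<C>" if "u \<in> \<C>" "w \<in> \<C>" "A \<in> sets M" for u w A
        using that by (auto simp: \<C>_def intro!: measurable_If_set)
      show "\<C> \<subseteq> borel_measurable M" by (auto simp: \<C>_def)
      show "\<C> \<noteq> {}" using 0 by blast
    qed
    then show ?thesis using that by blast
  qed
  have [measurable]: "c n \<in> borel_measurable M" for n using c(1)[of n] by (simp add: \<C>_def)
  define R where "R t = range (\<lambda>n. c n t)" for t
  have "AE t in M. c n t + c m t \<in> closure (R t)" for n m
    unfolding R_def
  proof (rule c(2))
    have "AE t in M. c n t \<in> K t" "AE t in M. c m t \<in> K t" using c(1) by (auto simp: \<C>_def)
    with cone have "AE t in M. c n t + c m t \<in> K t" by eventually_elim (rule convex_cone_add)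
    then show "(\<lambda>t. c n t + c m t) \<in> \<C>" by (simp add: \<C>_def)
  qed
  then have add: "AE t in M. \<forall>n m. c n t + c m t \<in> closure (R t)" by (simp add: AE_all_countable)
  have "AE t in M. 0 \<le> real_of_rat q \<longrightarrow> real_of_rat q *\<^sub>R c n t \<in> closure (R t)" for n q
  proof (cases "0 \<le> real_of_rat q")
    case True
    have "AE t in M. real_of_rat q *\<^sub>R c n t \<in> closure (R t)"
      unfolding R_def
    proof (rule c(2))
      have "AE t in M. c n t \<in> K t" using c(1) by (auto simp: \<C>_def)
      with cone have "AE t in M. real_of_rat q *\<^sub>R c n t \<in> K t"
        by eventually_elim (rule convex_cone_scaleR[OF _ True])
      then show "(\<lambda>t. real_of_rat q *\<^sub>R c n t) \<in> \<C>" by (simp add: \<C>_def)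
    qed
    then show ?thesis by simp
  qed simp
  then have scale: "AE t in M. \<forall>n q. 0 \<le> real_of_rat q \<longrightarrow> real_of_rat q *\<^sub>R c n t \<in> closure (R t)"
    by (simp add: AE_all_countable)
  have "AE t in M. \<forall>n. c n t \<in> K t" unfolding AE_all_countable using c(1) by (auto simp: \<C>_def)
  with add scale ndense have "AE t in M. convex_cone (closure (R t)) \<and> (\<exists>x. 0 < infdist x (closure (R t)))"
  proof eventually_elim
    case (elim t)
    have "convex_cone (closure (R t))"
    proof (rule convex_cone_closureI)
      show "q *\<^sub>R x \<in> closure (R t)" if q: "q \<in> \<rat>" "0 \<le> q" and x: "x \<in> R t" for q x
      proof -
        obtain q' where "q = real_of_rat q'" using q(1) by (auto elim: Rats_cases)
        moreover obtain n where "x = c n t" using x by (auto simp: R_def)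
        ultimately show ?thesis using elim(2) q(2) by blast
      qed
    qed (use elim(1) in \<open>auto simp: R_def\<close>)
    moreover obtain x e where "0 < e" and e: "\<And>k. k \<in> K t \<Longrightarrow> e \<le> norm (x - k)" using elim(3) by blast
    have "e \<le> infdist x (R t)"
      using e elim(4) by (subst infdist_notempty) (auto simp: R_def dist_norm intro!: cINF_greatest)
    then have "x \<notin> closure (R t)"
      using in_closure_iff_infdist_zero[of "R t" x] \<open>0 < e\<close> by (auto simp: R_def)
    then have "0 < infdist x (closure (R t))"
      using in_closure_iff_infdist_zero[of "closure (R t)" x] infdist_nonneg[of x "closure (R t)"]
      by (auto simp: R_def less_le)
    ultimately show ?case by blast
  qed
  then obtain N where N: "N \<in> null_sets M"
    and good: "\<And>t. t \<in> space M - N \<Longrightarrow> convex_cone (closure (R t)) \<and> (\<exists>x. 0 < infdist x (closure (R t)))"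
    by (auto elim!: AE_E3)
  have [measurable]: "N \<in> sets M" using N by blast
  \<comment> \<open>The norm on the null set \<open>N\<close> is a filler that makes
    \<open>p t\<close> sublinear at every point, as \<open>measurable_Hahn_Banach\<close>
    requires.\<close>
  define p where "p t x = (if t \<in> N then norm x else infdist x (closure (R t)))" for t x
  have "\<exists>f. (\<forall>x. (\<lambda>t. f t x) \<in> borel_measurable M) \<and>
    (\<forall>t\<in>space M. bounded_linear (f t) \<and> (\<forall>x. f t x \<le> p t x) \<and> ((\<exists>x. 0 < p t x) \<longrightarrow> (\<exists>x. 0 < f t x)))"
  proof (rule measurable_Hahn_Banach)
    show "sublin (p t)" if "t \<in> space M" for t
    proof (cases "t \<in> N")
      case True
      have "sublin (norm :: 'y \<Rightarrow> real)" by (auto simp: sublin_def norm_triangle_ineq)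
      then show ?thesis using True by (simp add: p_def[abs_def])
    next
      case False
      then show ?thesis using sublin_infdist[of "closure (R t)"] good[of t] that by (simp add: p_def[abs_def])
    qed
    show "(\<lambda>t. p t x) \<in> borel_measurable M" for x
    proof -
      have eq: "infdist x (closure (R t)) = (INF n. dist x (c n t))" for t
      proof -
        have "infdist x (closure (R t)) = infdist x (R t)" by (simp add: infdist_eq_setdist)
        also have "\<dots> = (INF n. dist x (c n t))"
          by (subst infdist_notempty) (auto simp: R_def image_comp)
        finally show ?thesis .
      qed
      have "(\<lambda>t. INF n. dist x (c n t)) \<in> borel_measurable M"
        by (intro borel_measurable_cINF_real) auto
      then show ?thesis unfolding p_def eq by measurable
    qed
  qed
  then obtain f where f: "\<And>x. (\<lambda>t. f t x) \<in> borel_measurable M"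
    "\<And>t. t \<in> space M \<Longrightarrow> bounded_linear (f t)" "\<And>t x. t \<in> space M \<Longrightarrow> f t x \<le> p t x"
    "\<And>t. t \<in> space M \<Longrightarrow> (\<exists>x. 0 < p t x) \<Longrightarrow> (\<exists>x. 0 < f t x)"
    by blast
  have notN: "AE t in M. t \<notin> N" using N by (rule AE_not_in)
  show ?thesis
  proof (intro exI[of _ f] conjI ballI impI)
    show "\<forall>x. (\<lambda>t. f t x) \<in> borel_measurable M" using f(1) by blast
    show "bounded_linear (f t)" if "t \<in> space M" for t using that by (rule f(2))
    show "AE t in M. \<exists>x. 0 < f t x"
      using notN AE_space by eventually_elim (use f(4) good in \<open>auto simp: p_def\<close>)
    fix u assume "u \<in> borel_measurable M" "AE t in M. u t \<in> K t"
    then have "AE t in M. u t \<in> closure (R t)" unfolding R_def by (intro c(2)) (simp add: \<C>_def)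
    with notN AE_space show "AE t in M. f t (u t) \<le> 0"
    proof eventually_elim
      case (elim t)
      then show ?case using f(3)[of t "u t"] by (simp add: p_def)
    qed
  qed
qed

section \<open>Lebesgue--Bochner spaces\<close>

lemma powr_add_le:
  fixes a b p :: real
  assumes "0 \<le> a" "0 \<le> b" "0 \<le> p"
  shows "(a + b) powr p \<le> 2 powr p * (a powr p + b powr p)"
proof -
  have "(a + b) powr p \<le> (2 * max a b) powr p"
    using assms by (intro powr_mono2) auto
  also have "\<dots> = 2 powr p * max a b powr p" using assms by (simp add: powr_mult)
  also have "max a b powr p \<le> a powr p + b powr p" by (simp add: max_def)
  finally show ?thesis by simp
qed

lemma (in complete_measure) mem_Lp_space_iff:
  fixes f :: "'a \<Rightarrow> 'b::{banach, second_countable_topology}"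
  shows "f \<in> Lp_space (ereal p) M \<longleftrightarrow> f \<in> borel_measurable M \<and> integrable M (\<lambda>t. norm (f t) powr p)"
  by (simp add: Lp_space_def strongly_measurable_iff_borel_measurable)

lemma (in complete_measure) mem_L1_space_iff:
  fixes f :: "'a \<Rightarrow> 'b::{banach, second_countable_topology}"
  shows "f \<in> Lp_space 1 M \<longleftrightarrow> integrable M f"
  unfolding one_ereal_def mem_Lp_space_iff by (auto simp: integrable_norm_iff)

lemma (in complete_measure) Lp_norm_near:
  fixes x y :: "'a \<Rightarrow> 'b::{banach, second_countable_topology}"
  assumes p: "1 \<le> p" and x: "x \<in> Lp_space (ereal p) M" and [measurable]: "y \<in> borel_measurable M"
    and k: "integrable M k" "(\<integral>t. k t \<partial>M) \<le> r powr p" "0 \<le> r"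
    and le: "AE t in M. norm (y t - x t) powr p \<le> k t"
  shows "y \<in> Lp_space (ereal p) M" "Lp_norm p M (y - x) \<le> r"
proof -
  have [measurable]: "x \<in> borel_measurable M" and xi: "integrable M (\<lambda>t. norm (x t) powr p)"
    using x by (auto simp: mem_Lp_space_iff)
  have int: "integrable M (\<lambda>t. norm (y t - x t) powr p)"
    using k(1)
  proof (rule Bochner_Integration.integrable_bound)
    show "AE t in M. norm (norm (y t - x t) powr p) \<le> norm (k t)"
      using le by eventually_elim simp
  qed measurable
  have "integrable M (\<lambda>t. norm (y t) powr p)"
  proof (rule Bochner_Integration.integrable_bound)
    show "integrable M (\<lambda>t. 2 powr p * (norm (x t) powr p + norm (y t - x t) powr p))"
      using int xi by simp
    show "AE t in M. norm (norm (y t) powr p) \<le> norm (2 powr p * (norm (x t) powr p + norm (y t - x t) powr p))"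
    proof (rule AE_I2)
      fix t
      have "norm (y t) powr p \<le> (norm (x t) + norm (y t - x t)) powr p"
        using p norm_triangle_ineq[of "x t" "y t - x t"] by (intro powr_mono2) auto
      also have "\<dots> \<le> 2 powr p * (norm (x t) powr p + norm (y t - x t) powr p)"
        using p by (intro powr_add_le) auto
      finally show "norm (norm (y t) powr p) \<le> norm (2 powr p * (norm (x t) powr p + norm (y t - x t) powr p))"
        by simp
    qed
  qed measurable
  then show "y \<in> Lp_space (ereal p) M" by (simp add: mem_Lp_space_iff)
  have "(\<integral>t. norm (y t - x t) powr p \<partial>M) \<le> (\<integral>t. k t \<partial>M)"
    using int k(1) le by (rule integral_mono_AE)
  then have "(\<integral>t. norm (y t - x t) powr p \<partial>M) powr (1/p) \<le> (r powr p) powr (1/p)"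
    using p k(2) by (intro powr_mono2) auto
  then show "Lp_norm p M (y - x) \<le> r"
    using p k(3) by (simp add: Lp_norm_def powr_powr)
qed

text \<open>Since \<open>d * h t \<le> 1\<close>, the \<open>p\<close>-th power of the difference is
  below its first power, so the integral of \<open>h\<close> alone determines \<open>d\<close>. The
  weight makes pointwise closeness meaningful on a space of infinite measure.\<close>

lemma (in complete_measure) Lp_near_scaled:
  assumes p: "1 \<le> p" and h: "integrable M h" "\<And>t. 0 \<le> h t" "\<And>t. h t \<le> (1::real)" and "0 < r"
  shows "\<exists>d>0. \<forall>x\<in>Lp_space (ereal p) M. \<forall>y\<in>borel_measurable M.
    (AE t in M. norm (y t - x t) \<le> d * h t) \<longrightarrow>
    y \<in> Lp_space (ereal p) M \<and> Lp_norm p M (y - x :: 'a \<Rightarrow> 'b::{banach, second_countable_topology}) \<le> r"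
proof -
  define d where "d = min 1 (r powr p / ((\<integral>t. h t \<partial>M) + 1))"
  have H: "0 \<le> (\<integral>t. h t \<partial>M)" using h by simp
  have d: "0 < d" "d \<le> 1" using \<open>0 < r\<close> H by (auto simp: d_def)
  have "d \<le> r powr p / ((\<integral>t. h t \<partial>M) + 1)" unfolding d_def by (rule min.cobounded2)
  then have "d * ((\<integral>t. h t \<partial>M) + 1) \<le> r powr p" using H by (simp add: pos_le_divide_eq)
  then have dH: "(\<integral>t. d * h t \<partial>M) \<le> r powr p" using d by (simp add: algebra_simps)
  have "y \<in> Lp_space (ereal p) M \<and> Lp_norm p M (y - x) \<le> r"
    if x: "x \<in> Lp_space (ereal p) M" and y: "y \<in> borel_measurable M" and le: "AE t in M. norm (y t - x t) \<le> d * h t"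
    for x y :: "'a \<Rightarrow> 'b"
  proof -
    have "AE t in M. norm (y t - x t) powr p \<le> d * h t"
      using le
    proof eventually_elim
      case (elim t)
      have "d * h t \<le> 1" using d h(2,3)[of t] by (simp add: mult_le_one)
      then have "norm (y t - x t) \<le> 1" using elim by linarith
      then have "norm (y t - x t) powr p \<le> norm (y t - x t) powr 1" using p by (intro powr_mono') auto
      with elim show ?case by simp
    qed
    with Lp_norm_near[OF p x y _ dH] h(1) \<open>0 < r\<close> show ?thesis by simp
  qed
  with d(1) show ?thesis by blast
qed

text \<open>As \<open>e / e'\<close> is at least 1, \<open>norm (b t)\<close> reaching it implies
  that the \<open>p\<close>-th power reaches it too, so Markov's inequality gives the same bound
  \<open>e' / e\<close> for every \<open>p\<close>.\<close>

lemma (in complete_measure) Lp_unit_ball_Chebyshev: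
  fixes b :: "'a \<Rightarrow> 'b::{banach, second_countable_topology}"
  assumes p: "1 \<le> p" and b: "b \<in> Lp_space (ereal p) M" "Lp_norm p M b \<le> 1"
    and e: "0 < e'" "e' \<le> e"
  shows "{t \<in> space M. e \<le> e' * norm (b t)} \<in> sets M"
    "emeasure M {t \<in> space M. e \<le> e' * norm (b t)} \<le> ennreal (e' / e)"
proof -
  have [measurable]: "b \<in> borel_measurable M" and int: "integrable M (\<lambda>t. norm (b t) powr p)"
    using b(1) by (auto simp: mem_Lp_space_iff)
  show meas: "{t \<in> space M. e \<le> e' * norm (b t)} \<in> sets M" by measurable
  have le1: "(\<integral>t. norm (b t) powr p \<partial>M) \<le> 1"
  proof (rule ccontr)
    assume "\<not> ?thesis"
    then have "1 powr (1/p) < (\<integral>t. norm (b t) powr p \<partial>M) powr (1/p)"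
      using p by (intro powr_less_mono2) auto
    then show False using b(2) by (simp add: Lp_norm_def)
  qed
  have e0: "0 < e" using e by simp
  have "emeasure M {t \<in> space M. e \<le> e' * norm (b t)} \<le> emeasure M {t \<in> space M. e / e' \<le> norm (b t) powr p}"
  proof (rule emeasure_mono)
    show "{t \<in> space M. e \<le> e' * norm (b t)} \<subseteq> {t \<in> space M. e / e' \<le> norm (b t) powr p}"
    proof safe
      fix t assume "e \<le> e' * norm (b t)"
      then have 1: "e / e' \<le> norm (b t)" using e by (simp add: field_simps)
      have "1 \<le> e / e'" using e by simp
      with 1 have "1 \<le> norm (b t)" by linarith
      then have "norm (b t) powr 1 \<le> norm (b t) powr p" using p by (intro powr_mono) auto
      with 1 show "e / e' \<le> norm (b t) powr p" by simp
    qed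
  qed measurable
  also have "\<dots> \<le> ennreal (1 / (e / e') * (\<integral>t. norm (b t) powr p \<partial>M))"
    by (rule integral_Markov_inequality) (use int e e0 in auto)
  also have "\<dots> \<le> ennreal (e' / e)"
    using mult_left_mono[OF le1, of "e' / e"] e e0 by (intro ennreal_leI) simp
  finally show "emeasure M {t \<in> space M. e \<le> e' * norm (b t)} \<le> ennreal (e' / e)" .
qed

text \<open>The correction allowed in the tangent cone of \<open>L\<^sup>p\<close> is small in norm,
  hence pointwise small off a set of small measure; this is the hypothesis of
  \<open>tangent_in_measure_imp_Clarke\<close>.\<close>

theorem Clarke_tangent_Sel_pointwise:
  fixes S :: "'a \<Rightarrow> 'z::{banach, second_countable_topology} set"
  assumes cm: "complete_measure M" and sf: "sigma_finite_measure M" and p: "1 \<le> p"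
    and graph: "graph_over M S \<in> sets (M \<Otimes>\<^sub>M borel)" and closed: "AE t in M. closed (S t)"
    and x0: "x0 \<in> Sel p M S"
    and v: "v \<in> Clarke_tangent_cone (Lp_space (ereal p) M) (Lp_norm p M) (Sel p M S) x0"
  shows "AE t in M. v t \<in> Clarke_tangent_cone UNIV norm (S t) (x0 t)"
proof -
  interpret complete_measure M by fact
  interpret sigma_finite_measure M by fact
  obtain h :: "'a \<Rightarrow> real" where h [measurable]: "h \<in> borel_measurable M" and hpos: "\<And>t. 0 < h t"
    and h1: "\<And>t. h t \<le> 1" and hint: "integrable M h"
    by (rule obtain_positive_integrable_function) (rule that)
  have x0L: "x0 \<in> Lp_space (ereal p) M" and x0S: "AE t in M. x0 t \<in> S t"
    using x0 by (auto simp: Sel_def)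
  have vL: "v \<in> Lp_space (ereal p) M" using v by (simp add: Clarke_tangent_cone_def)
  show ?thesis
  proof (rule tangent_in_measure_imp_Clarke[OF cm sf graph closed x0S _ _ h hpos])
    show "x0 \<in> borel_measurable M" "v \<in> borel_measurable M"
      using x0L vL by (auto simp: mem_Lp_space_iff)
    fix e :: real assume e: "0 < e"
    \<comment> \<open>\<open>e' \<le> e\<close> is what the Chebyshev bound asks for, and
      \<open>e' \<le> e * e\<close> brings the measure bound \<open>e' / e\<close> down to
      \<open>e\<close>.\<close>
    define e' where "e' = min e (e * e)"
    have e': "0 < e'" "e' \<le> e" "e' / e \<le> e"
      using e by (auto simp: e'_def pos_divide_le_eq)
    obtain r where r: "0 < r" and step: "\<And>y s. y \<in> Sel p M S \<Longrightarrow> Lp_norm p M (y - x0) \<le> r \<Longrightarrow> 0 \<le> s \<Longrightarrow> s \<le> r \<Longrightarrow>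
        \<exists>b\<in>Lp_space (ereal p) M. Lp_norm p M b \<le> 1 \<and> y + s *\<^sub>R (v + e' *\<^sub>R b) \<in> Sel p M S"
      using Clarke_tangent_coneD[OF v e'(1)] by blast
    obtain d where d: "0 < d" and near: "\<And>x y :: 'a \<Rightarrow> 'z. x \<in> Lp_space (ereal p) M \<Longrightarrow> y \<in> borel_measurable M \<Longrightarrow>
        AE t in M. norm (y t - x t) \<le> d * h t \<Longrightarrow> y \<in> Lp_space (ereal p) M \<and> Lp_norm p M (y - x) \<le> r"
      using Lp_near_scaled[OF p hint less_imp_le[OF hpos] h1 r, where 'b='z] by blast
    have claim: "\<exists>B\<in>sets M. emeasure M B \<le> ennreal e \<and>
        (AE t in M. t \<notin> B \<longrightarrow> (\<exists>u\<in>S t. norm (u - (y t + s *\<^sub>R v t)) \<le> e * s))"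
      if y: "y \<in> borel_measurable M" "AE t in M. y t \<in> S t \<and> norm (y t - x0 t) \<le> d * h t"
        and s: "0 < s" "s \<le> r" for y s
    proof -
      have yS: "AE t in M. y t \<in> S t" and yx: "AE t in M. norm (y t - x0 t) \<le> d * h t"
        using y(2) by (auto elim: AE_mp)
      have "y \<in> Sel p M S" "Lp_norm p M (y - x0) \<le> r"
        using near[OF x0L y(1) yx] yS by (auto simp: Sel_def)
      then obtain b where b: "b \<in> Lp_space (ereal p) M" "Lp_norm p M b \<le> 1"
        and yb: "y + s *\<^sub>R (v + e' *\<^sub>R b) \<in> Sel p M S"
        using step s by (metis less_imp_le)
      define B where "B = {t \<in> space M. e \<le> e' * norm (b t)}"
      note B = Lp_unit_ball_Chebyshev[OF p b e'(1,2), folded B_def]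
      have "emeasure M B \<le> ennreal e" using B(2) e'(3) by (meson ennreal_leI order_trans)
      moreover have "AE t in M. t \<notin> B \<longrightarrow> (\<exists>u\<in>S t. norm (u - (y t + s *\<^sub>R v t)) \<le> e * s)"
      proof -
        have "AE t in M. y t + s *\<^sub>R (v t + e' *\<^sub>R b t) \<in> S t"
          using yb by (auto simp: Sel_def scaleR_fun_def)
        then show ?thesis using AE_space
        proof eventually_elim
          case (elim t)
          show ?case
          proof
            assume "t \<notin> B"
            then have "e' * norm (b t) < e" using elim by (simp add: B_def not_le)
            then have "s * (e' * norm (b t)) \<le> s * e" using s by simp
            moreover have "(y t + s *\<^sub>R (v t + e' *\<^sub>R b t)) - (y t + s *\<^sub>R v t) = (s * e') *\<^sub>R b t"
              by (simp add: algebra_simps)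
            ultimately have "norm ((y t + s *\<^sub>R (v t + e' *\<^sub>R b t)) - (y t + s *\<^sub>R v t)) \<le> e * s"
              using s e' by (simp add: mult.commute mult.left_commute)
            with elim(1) show "\<exists>u\<in>S t. norm (u - (y t + s *\<^sub>R v t)) \<le> e * s" by blast
          qed
        qed
      qed
      ultimately show ?thesis using B(1) by blast
    qed
    show "\<exists>d>0. \<exists>l>0. \<forall>y\<in>borel_measurable M.
      (AE t in M. y t \<in> S t \<and> norm (y t - x0 t) \<le> d * h t) \<longrightarrow>
      (\<forall>s. 0 < s \<longrightarrow> s \<le> l \<longrightarrow> (\<exists>B\<in>sets M. emeasure M B \<le> ennreal e \<and>
        (AE t in M. t \<notin> B \<longrightarrow> (\<exists>u\<in>S t. norm (u - (y t + s *\<^sub>R v t)) \<le> e * s))))"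
      by (intro exI[of _ d] exI[of _ r] conjI ballI impI allI claim; (rule d r | assumption))
  qed
qed

lemma norm_Pair_le_sum: "norm (x, y) \<le> norm x + norm y"
  unfolding norm_Pair by (rule sqrt_sum_squares_le_sum) auto

theorem Clarke_tangent_Sel1_pointwise:
  fixes E :: "'a \<Rightarrow> ('z::{banach, second_countable_topology} \<times> real) set"
  assumes cm: "complete_measure M" and sf: "sigma_finite_measure M" and p: "1 \<le> p"
    and graph: "graph_over M E \<in> sets (M \<Otimes>\<^sub>M borel)" and closed: "AE t in M. closed (E t)"
    and x0: "(x0, a0) \<in> Sel1 p M E"
    and v: "(w, \<sigma>) \<in> Clarke_tangent_cone (Lp_space (ereal p) M \<times> Lp_space 1 M)
       (sum_norm (Lp_norm p M) (Lp_norm 1 M)) (Sel1 p M E) (x0, a0)"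
  shows "AE t in M. (w t, \<sigma> t) \<in> Clarke_tangent_cone UNIV norm (E t) (x0 t, a0 t)"
proof -
  interpret complete_measure M by fact
  interpret sigma_finite_measure M by fact
  obtain h :: "'a \<Rightarrow> real" where h [measurable]: "h \<in> borel_measurable M" and hpos: "\<And>t. 0 < h t"
    and h1: "\<And>t. h t \<le> 1" and hint: "integrable M h"
    by (rule obtain_positive_integrable_function) (rule that)
  have x0L: "x0 \<in> Lp_space (ereal p) M" and a0L: "a0 \<in> Lp_space (ereal 1) M" and x0E: "AE t in M. (x0 t, a0 t) \<in> E t"
    using x0 by (auto simp: Sel1_def one_ereal_def)
  have wL: "w \<in> Lp_space (ereal p) M" and \<sigma>L: "\<sigma> \<in> Lp_space (ereal 1) M"
    using v by (auto simp: Clarke_tangent_cone_def one_ereal_def)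
  have [measurable]: "x0 \<in> borel_measurable M" "w \<in> borel_measurable M" "a0 \<in> borel_measurable M" "\<sigma> \<in> borel_measurable M"
    using x0L wL a0L \<sigma>L unfolding mem_Lp_space_iff by blast+
  show ?thesis
  proof (rule tangent_in_measure_imp_Clarke[OF cm sf graph closed x0E _ _ h hpos, where v="\<lambda>t. (w t, \<sigma> t)"])
    show "(\<lambda>t. (x0 t, a0 t)) \<in> borel_measurable M" "(\<lambda>t. (w t, \<sigma> t)) \<in> borel_measurable M"
      by (intro borel_measurable_Pair; measurable)+
    fix e :: real assume e: "0 < e"
    \<comment> \<open>Two components produce two exceptional sets and two pointwise errors, so each
      is given half of \<open>e\<close>.\<close>
    define e' where "e' = min (e/2) ((e/2) * (e/2))"
    have e': "0 < e'" "e' \<le> e/2" "e' / (e/2) \<le> e/2"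
    proof -
      show "0 < e'" "e' \<le> e/2" using e by (auto simp: e'_def)
      have "e' \<le> (e/2) * (e/2)" unfolding e'_def by (rule min.cobounded2)
      then show "e' / (e/2) \<le> e/2" using e by (subst pos_divide_le_eq) auto
    qed
    obtain r where r: "0 < r" and step: "\<And>y s. y \<in> Sel1 p M E \<Longrightarrow>
        sum_norm (Lp_norm p M) (Lp_norm 1 M) (y - (x0, a0)) \<le> r \<Longrightarrow> 0 \<le> s \<Longrightarrow> s \<le> r \<Longrightarrow>
        \<exists>b\<in>Lp_space (ereal p) M \<times> Lp_space 1 M. sum_norm (Lp_norm p M) (Lp_norm 1 M) b \<le> 1 \<and>
          y + s *\<^sub>R ((w, \<sigma>) + e' *\<^sub>R b) \<in> Sel1 p M E"
      using Clarke_tangent_coneD[OF v e'(1)] by blast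
    have r2: "0 < r / 2" using r by simp
    obtain d1 where d1: "0 < d1" and near1: "\<And>x y :: 'a \<Rightarrow> 'z. x \<in> Lp_space (ereal p) M \<Longrightarrow> y \<in> borel_measurable M \<Longrightarrow>
        AE t in M. norm (y t - x t) \<le> d1 * h t \<Longrightarrow> y \<in> Lp_space (ereal p) M \<and> Lp_norm p M (y - x) \<le> r / 2"
      using Lp_near_scaled[OF p hint less_imp_le[OF hpos] h1 r2, where 'b='z] by blast
    obtain d2 where d2: "0 < d2" and near2: "\<And>x y :: 'a \<Rightarrow> real. x \<in> Lp_space (ereal 1) M \<Longrightarrow> y \<in> borel_measurable M \<Longrightarrow>
        AE t in M. norm (y t - x t) \<le> d2 * h t \<Longrightarrow> y \<in> Lp_space (ereal 1) M \<and> Lp_norm 1 M (y - x) \<le> r / 2"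
      using Lp_near_scaled[OF order_refl hint less_imp_le[OF hpos] h1 r2, where 'b=real] by blast
    define d where "d = min d1 d2"
    have d: "0 < d" "d \<le> d1" "d \<le> d2" using d1 d2 by (auto simp: d_def)
    have claim: "\<exists>B\<in>sets M. emeasure M B \<le> ennreal e \<and>
        (AE t in M. t \<notin> B \<longrightarrow> (\<exists>u\<in>E t. norm (u - (y t + s *\<^sub>R (w t, \<sigma> t))) \<le> e * s))"
      if y: "y \<in> borel_measurable M" "AE t in M. y t \<in> E t \<and> norm (y t - (x0 t, a0 t)) \<le> d * h t"
        and s: "0 < s" "s \<le> r" for y s
    proof -
      define y1 where "y1 t = fst (y t)" for t
      define y2 where "y2 t = snd (y t)" for t
      have yy: "y t = (y1 t, y2 t)" for t by (simp add: y1_def y2_def)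
      have [measurable]: "y1 \<in> borel_measurable M" "y2 \<in> borel_measurable M"
        unfolding y1_def[abs_def] y2_def[abs_def]
        by (rule borel_measurable_continuous_on[OF _ y(1)]; intro continuous_intros)+
      have "AE t in M. norm (y1 t - x0 t) \<le> d1 * h t \<and> norm (y2 t - a0 t) \<le> d2 * h t"
        using y(2)
      proof eventually_elim
        case (elim t)
        have "norm (y1 t - x0 t) \<le> norm (y t - (x0 t, a0 t))" "norm (y2 t - a0 t) \<le> norm (y t - (x0 t, a0 t))"
          using norm_fst_le[of "y1 t - x0 t" "y2 t - a0 t"] norm_snd_le[of "y2 t - a0 t" "y1 t - x0 t"] by (auto simp: yy)
        moreover have "d * h t \<le> d1 * h t" "d * h t \<le> d2 * h t"
          using d hpos[of t] by (auto intro!: mult_right_mono less_imp_le)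
        ultimately show ?case using elim by linarith
      qed
      then have "AE t in M. norm (y1 t - x0 t) \<le> d1 * h t" "AE t in M. norm (y2 t - a0 t) \<le> d2 * h t"
        by (auto elim: AE_mp)
      then have 1: "y1 \<in> Lp_space (ereal p) M \<and> Lp_norm p M (y1 - x0) \<le> r / 2"
        and 2: "y2 \<in> Lp_space (ereal 1) M \<and> Lp_norm 1 M (y2 - a0) \<le> r / 2"
        using near1[OF x0L, of y1] near2[OF a0L, of y2] by auto
      have "AE t in M. (y1 t, y2 t) \<in> E t" using y(2) by (auto simp: yy[symmetric] elim: AE_mp)
      with 1 2 have "(y1, y2) \<in> Sel1 p M E" by (simp add: Sel1_def one_ereal_def)
      moreover have "sum_norm (Lp_norm p M) (Lp_norm 1 M) ((y1, y2) - (x0, a0)) \<le> r"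
        using 1 2 by (simp add: sum_norm_def)
      ultimately obtain b where b: "b \<in> Lp_space (ereal p) M \<times> Lp_space 1 M" "sum_norm (Lp_norm p M) (Lp_norm 1 M) b \<le> 1"
        "(y1, y2) + s *\<^sub>R ((w, \<sigma>) + e' *\<^sub>R b) \<in> Sel1 p M E"
        using step s by (metis less_imp_le)
      obtain b1 b2 where bb: "b = (b1, b2)" by (cases b)
      have "0 \<le> Lp_norm p M b1" "0 \<le> Lp_norm 1 M b2" by (auto simp: Lp_norm_def)
      then have b1: "b1 \<in> Lp_space (ereal p) M" "Lp_norm p M b1 \<le> 1"
        and b2: "b2 \<in> Lp_space (ereal 1) M" "Lp_norm 1 M b2 \<le> 1"
        using b(1,2) by (auto simp: bb sum_norm_def one_ereal_def)
      define B1 where "B1 = {t \<in> space M. e/2 \<le> e' * norm (b1 t)}"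
      define B2 where "B2 = {t \<in> space M. e/2 \<le> e' * norm (b2 t)}"
      note B1 = Lp_unit_ball_Chebyshev[OF p b1 e'(1,2), folded B1_def]
      note B2 = Lp_unit_ball_Chebyshev[OF order_refl b2 e'(1,2), folded B2_def]
      have "emeasure M (B1 \<union> B2) \<le> emeasure M B1 + emeasure M B2"
        by (rule emeasure_subadditive[OF B1(1) B2(1)])
      also have "\<dots> \<le> ennreal (e/2) + ennreal (e/2)"
        using B1(2) B2(2) e'(3) by (intro add_mono) (meson ennreal_leI order_trans)+
      also have "\<dots> = ennreal e" using e by (simp flip: ennreal_plus)
      finally have "emeasure M (B1 \<union> B2) \<le> ennreal e" .
      moreover have "AE t in M. t \<notin> B1 \<union> B2 \<longrightarrow> (\<exists>u\<in>E t. norm (u - (y t + s *\<^sub>R (w t, \<sigma> t))) \<le> e * s)"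
      proof -
        have "AE t in M. (y1 t + s *\<^sub>R (w t + e' *\<^sub>R b1 t), y2 t + s *\<^sub>R (\<sigma> t + e' *\<^sub>R b2 t)) \<in> E t"
          using b(3) by (simp add: Sel1_def scaleR_fun_def bb)
        then show ?thesis using AE_space
        proof eventually_elim
          case (elim t)
          show ?case
          proof
            assume "t \<notin> B1 \<union> B2"
            then have "e' * norm (b1 t) < e/2" "e' * norm (b2 t) < e/2"
              using elim by (auto simp: B1_def B2_def not_le)
            then have "e' * (norm (b1 t) + norm (b2 t)) \<le> e" by (simp add: distrib_left)
            moreover have "e' * norm (b1 t, b2 t) \<le> e' * (norm (b1 t) + norm (b2 t))"
              using e'(1) by (intro mult_left_mono norm_Pair_le_sum) auto
            ultimately have "s * (e' * norm (b1 t, b2 t)) \<le> s * e" using s by (intro mult_left_mono) auto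
            moreover have "(y1 t + s *\<^sub>R (w t + e' *\<^sub>R b1 t), y2 t + s *\<^sub>R (\<sigma> t + e' *\<^sub>R b2 t)) - (y t + s *\<^sub>R (w t, \<sigma> t))
                = (s * e') *\<^sub>R (b1 t, b2 t)"
              by (simp add: yy algebra_simps)
            ultimately have "norm ((y1 t + s *\<^sub>R (w t + e' *\<^sub>R b1 t), y2 t + s *\<^sub>R (\<sigma> t + e' *\<^sub>R b2 t)) - (y t + s *\<^sub>R (w t, \<sigma> t))) \<le> e * s"
              using s e' by (simp only: norm_scaleR) (simp add: mult.commute mult.left_commute)
            with elim(1) show "\<exists>u\<in>E t. norm (u - (y t + s *\<^sub>R (w t, \<sigma> t))) \<le> e * s" by blast
          qed
        qed
      qed
      ultimately show ?thesis using B1(1) B2(1) by blast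
    qed
    show "\<exists>d>0. \<exists>l>0. \<forall>y\<in>borel_measurable M.
      (AE t in M. y t \<in> E t \<and> norm (y t - (x0 t, a0 t)) \<le> d * h t) \<longrightarrow>
      (\<forall>s. 0 < s \<longrightarrow> s \<le> l \<longrightarrow> (\<exists>B\<in>sets M. emeasure M B \<le> ennreal e \<and>
        (AE t in M. t \<notin> B \<longrightarrow> (\<exists>u\<in>E t. norm (u - (y t + s *\<^sub>R (w t, \<sigma> t))) \<le> e * s))))"
      by (intro exI[of _ d] exI[of _ r] conjI ballI impI allI claim; (rule d r | assumption))
  qed
qed

section \<open>Pointwise optimality and multipliers\<close>

text \<open>Inside a piece of finite measure, a subset of smaller positive measure and its
  complement split \<open>B\<close>, and the lighter of the two has at most half the measure.
  Repeated halving gets below \<open>e\<close>.\<close>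

lemma nonatomic_small_subset:
  assumes sf: "sigma_finite_measure M" and na: "nonatomic M" and A: "A \<in> sets M" "emeasure M A \<noteq> 0"
    and "0 < (e::real)"
  obtains B where "B \<in> sets M" "B \<subseteq> A" "emeasure M B < \<infinity>" "0 < measure M B" "measure M B < e"
proof -
  interpret sigma_finite_measure M by fact
  obtain F :: "nat \<Rightarrow> 'a set" where F: "range F \<subseteq> sets M" "(\<Union>i. F i) = space M" "\<And>i. emeasure M (F i) \<noteq> \<infinity>"
    using sigma_finite by blast
  have "\<exists>i. emeasure M (A \<inter> F i) \<noteq> 0"
  proof (rule ccontr)
    assume "\<not> ?thesis"
    then have "(\<Union>i. A \<inter> F i) \<in> null_sets M"
      using A F(1) by (intro null_sets_UN) (auto intro!: null_setsI)
    moreover have "(\<Union>i. A \<inter> F i) = A" using F(2) sets.sets_into_space[OF A(1)] by auto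
    ultimately show False using A(2) by (simp add: null_sets_def)
  qed
  then obtain i where i: "emeasure M (A \<inter> F i) \<noteq> 0" by blast
  define C where "C = A \<inter> F i"
  have C: "C \<in> sets M" "C \<subseteq> A" using A F(1) by (auto simp: C_def)
  have "emeasure M C \<le> emeasure M (F i)" using A F(1) by (intro emeasure_mono) (auto simp: C_def)
  then have Cfin: "emeasure M C < \<infinity>" using F(3)[of i] by (simp add: less_top[symmetric] top_unique) 
      (metis infinity_ennreal_def top_unique)
  have fin: "emeasure M B < \<infinity>" if "B \<in> sets M" "B \<subseteq> C" for B
    using emeasure_mono[OF that(2) C(1)] Cfin by (rule le_less_trans)
  have "\<exists>B\<in>sets M. B \<subseteq> C \<and> 0 < measure M B \<and> measure M B \<le> measure M C / 2^n" for n
  proof (induct n)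
    case 0
    have "0 < measure M C"
      using i Cfin by (simp add: C_def measure_def enn2real_positive_iff zero_less_iff_neq_zero)
    then show ?case using C by auto
  next
    case (Suc n)
    then obtain B where B: "B \<in> sets M" "B \<subseteq> C" "0 < measure M B" "measure M B \<le> measure M C / 2^n" by blast
    have eq: "emeasure M B' = ennreal (measure M B')" if "B' \<in> sets M" "B' \<subseteq> C" for B'
      using fin[OF that] by (intro emeasure_eq_ennreal_measure) auto
    have "0 < emeasure M B" using B eq[of B] by simp
    then obtain B' where B': "B' \<in> sets M" "B' \<subseteq> B" "0 < emeasure M B'" "emeasure M B' < emeasure M B"
      using na B(1) unfolding nonatomic_def by blast
    have "0 < measure M B'" "measure M B' < measure M B"
      using B' B eq[of B'] eq[of B] by (auto simp: ennreal_less_iff)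
    moreover have "measure M (B - B') = measure M B - measure M B'"
      using B B' fin[of B] by (intro measure_Diff) auto
    moreover have "measure M C / 2^Suc n = measure M C / 2^n / 2" by simp
    ultimately have "0 < measure M B' \<and> measure M B' \<le> measure M C / 2^Suc n \<or>
        0 < measure M (B - B') \<and> measure M (B - B') \<le> measure M C / 2^Suc n"
      using B(4) by argo
    then show ?case
    proof
      assume "0 < measure M B' \<and> measure M B' \<le> measure M C / 2^Suc n"
      then show ?case using B B' by (intro bexI[of _ B']) auto
    next
      assume "0 < measure M (B - B') \<and> measure M (B - B') \<le> measure M C / 2^Suc n"
      then show ?case using B B' by (intro bexI[of _ "B - B'"]) auto
    qed
  qed
  note small = this
  obtain n :: nat where "measure M C / 2^n < e"
  proof -
    have "(\<lambda>n. measure M C / 2^n) \<longlonglongrightarrow> 0" by (rule LIMSEQ_divide_realpow_zero) simp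
    then have "\<forall>\<^sub>F n in sequentially. measure M C / 2^n < e" using \<open>0 < e\<close> by (rule order_tendstoD)
    then show ?thesis using that by (auto simp: eventually_sequentially)
  qed
  with small[of n] obtain B where "B \<in> sets M" "B \<subseteq> C" "0 < measure M B" "measure M B < e"
    by (meson le_less_trans)
  with C(2) fin[of B] show ?thesis by (intro that[of B]) auto
qed

text \<open>A finite infimum provides an integrable majorant \<open>\<sigma>\<close>, but no
  integrable minorant at once. Lowering \<open>\<sigma>\<close> by a truncated gap gives another
  majorant, so the truncations have bounded integrals, and monotone convergence makes the whole gap
  integrable.\<close>

lemma upper_integral_functional_finite:
  assumes cm: "complete_measure M" and sf: "sigma_finite_measure M"
    and f [measurable]: "(\<lambda>t. \<phi> t (x t)) \<in> borel_measurable M" and ninf: "AE t in M. \<phi> t (x t) \<noteq> -\<infinity>"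
    and fin: "\<bar>upper_integral_functional M \<phi> x\<bar> \<noteq> \<infinity>"
  shows "AE t in M. \<phi> t (x t) = ereal (real_of_ereal (\<phi> t (x t)))"
    "integrable M (\<lambda>t. real_of_ereal (\<phi> t (x t)))"
    "upper_integral_functional M \<phi> x = ereal (\<integral>t. real_of_ereal (\<phi> t (x t)) \<partial>M)"
proof -
  interpret complete_measure M by fact
  interpret sigma_finite_measure M by fact
  define a where "a t = real_of_ereal (\<phi> t (x t))" for t
  have [measurable]: "a \<in> borel_measurable M" unfolding a_def[abs_def] by measurable
  define V where "V = {ereal (\<integral>t. \<sigma> t \<partial>M) |\<sigma>. \<sigma> \<in> Lp_space 1 M \<and> (AE t in M. \<phi> t (x t) \<le> ereal (\<sigma> t))}"
  have I: "upper_integral_functional M \<phi> x = Inf V"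
    by (simp add: upper_integral_functional_def V_def)
  obtain i where i: "Inf V = ereal i" using fin unfolding I by (cases "Inf V") auto
  have lower: "i \<le> (\<integral>t. \<sigma> t \<partial>M)" if "integrable M \<sigma>" "AE t in M. \<phi> t (x t) \<le> ereal (\<sigma> t)" for \<sigma>
  proof -
    have "Inf V \<le> ereal (\<integral>t. \<sigma> t \<partial>M)"
      using that by (intro Inf_lower) (auto simp: V_def mem_L1_space_iff)
    then show ?thesis by (simp add: i)
  qed
  have "V \<noteq> {}" using i by (auto simp: top_ereal_def)
  then obtain \<sigma> where \<sigma>: "integrable M \<sigma>" "AE t in M. \<phi> t (x t) \<le> ereal (\<sigma> t)"
    by (auto simp: V_def mem_L1_space_iff)
  have [measurable]: "\<sigma> \<in> borel_measurable M" using \<sigma>(1) by simp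
  have eq: "AE t in M. \<phi> t (x t) = ereal (a t)"
    using \<sigma>(2) ninf unfolding a_def by eventually_elim (metis MInfty_neq_ereal(1) ereal_infty_less_eq(1) ereal_real' ereal_less_eq(1) PInfty_neq_ereal(1) abs_eq_infinity_cases)
  then show "AE t in M. \<phi> t (x t) = ereal (real_of_ereal (\<phi> t (x t)))" by (simp add: a_def)
  have le: "AE t in M. a t \<le> \<sigma> t" using eq \<sigma>(2) by eventually_elim simp
  obtain h :: "'a \<Rightarrow> real" where h [measurable]: "h \<in> borel_measurable M" and hpos: "\<And>t. 0 < h t"
    and hint: "integrable M h"
    by (rule obtain_positive_integrable_function) (rule that)
  define g where "g t = max 0 (\<sigma> t - a t)" for t
  \<comment> \<open>Multiples of a positive integrable function truncate integrably even on a space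
    of infinite measure, and they still exhaust \<open>g\<close> pointwise.\<close>
  define u where "u n t = min (g t) (real n * h t)" for n t
  have [measurable]: "g \<in> borel_measurable M" "u n \<in> borel_measurable M" for n
    unfolding g_def[abs_def] u_def[abs_def] by measurable
  have u0: "0 \<le> u n t" for n t using hpos[of t] by (simp add: u_def g_def)
  have uint: "integrable M (u n)" for n
  proof (rule Bochner_Integration.integrable_bound)
    show "integrable M (\<lambda>t. real n * h t)" using hint by simp
    show "AE t in M. norm (u n t) \<le> norm (real n * h t)"
    proof (rule AE_I2)
      fix t
      have "u n t \<le> real n * h t" by (simp add: u_def)
      then show "norm (u n t) \<le> norm (real n * h t)" using u0[of n t] by simp
    qed
  qed measurable
  have ub: "(\<integral>t. u n t \<partial>M) \<le> (\<integral>t. \<sigma> t \<partial>M) - i" for n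
  proof -
    have "AE t in M. \<phi> t (x t) \<le> ereal (\<sigma> t - u n t)"
      using eq le
    proof eventually_elim
      case (elim t)
      have "u n t \<le> \<sigma> t - a t" using elim(2) by (simp add: u_def g_def min_le_iff_disj)
      then show ?case using elim(1) by simp
    qed
    then have "i \<le> (\<integral>t. \<sigma> t - u n t \<partial>M)" using \<sigma>(1) uint by (intro lower) auto
    also have "\<dots> = (\<integral>t. \<sigma> t \<partial>M) - (\<integral>t. u n t \<partial>M)"
      using \<sigma>(1) uint by (rule Bochner_Integration.integral_diff)
    finally show ?thesis by simp
  qed
  have umono: "u n t \<le> u m t" if "n \<le> m" for n m t
    unfolding u_def using that hpos[of t] by (intro min.mono mult_right_mono) auto
  have "incseq (\<lambda>n. \<integral>t. u n t \<partial>M)"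
    unfolding incseq_def using umono uint by (intro allI impI integral_mono) auto
  then obtain L where L: "(\<lambda>n. \<integral>t. u n t \<partial>M) \<longlonglongrightarrow> L"
    using incseq_convergent[of "\<lambda>n. \<integral>t. u n t \<partial>M" "(\<integral>t. \<sigma> t \<partial>M) - i"] ub by blast
  have "integrable M g"
  proof (rule integrable_monotone_convergence[OF uint _ _ L])
    show "AE t in M. mono (\<lambda>n. u n t)" using umono by (intro AE_I2) (auto simp: mono_def)
    show "AE t in M. (\<lambda>n. u n t) \<longlonglongrightarrow> g t"
    proof (rule AE_I2)
      fix t
      obtain n where n: "g t < real n * h t" using reals_Archimedean3[OF hpos] by blast
      have "\<forall>m\<ge>n. u m t = g t"
      proof (intro allI impI)
        fix m assume "n \<le> m"
        then have "real n * h t \<le> real m * h t" using hpos[of t] by (intro mult_right_mono) auto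
        then show "u m t = g t" using n by (simp add: u_def)
      qed
      then show "(\<lambda>n. u n t) \<longlonglongrightarrow> g t"
        by (intro tendsto_eventually) (auto simp: eventually_sequentially)
    qed
  qed measurable
  then have "integrable M (\<lambda>t. \<sigma> t - g t)" using \<sigma>(1) by simp
  moreover have "AE t in M. \<sigma> t - g t = a t" using le by eventually_elim (simp add: g_def)
  ultimately have aint: "integrable M a"
    by (subst (asm) integrable_cong_AE[of _ _ a]) auto
  then show "integrable M (\<lambda>t. real_of_ereal (\<phi> t (x t)))" by (simp add: a_def[abs_def])
  have "Inf V = ereal (\<integral>t. a t \<partial>M)"
  proof (rule antisym)
    show "Inf V \<le> ereal (\<integral>t. a t \<partial>M)"
      using aint eq by (intro Inf_lower) (auto simp: V_def mem_L1_space_iff elim!: AE_mp)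
    show "ereal (\<integral>t. a t \<partial>M) \<le> Inf V"
    proof (rule Inf_greatest)
      fix c assume "c \<in> V"
      then obtain \<sigma>' where \<sigma>': "c = ereal (\<integral>t. \<sigma>' t \<partial>M)" "integrable M \<sigma>'" "AE t in M. \<phi> t (x t) \<le> ereal (\<sigma>' t)"
        by (auto simp: V_def mem_L1_space_iff)
      have "AE t in M. a t \<le> \<sigma>' t" using eq \<sigma>'(3) by eventually_elim simp
      then show "ereal (\<integral>t. a t \<partial>M) \<le> c"
        using aint \<sigma>' by (simp add: integral_mono_AE)
    qed
  qed
  then show "upper_integral_functional M \<phi> x = ereal (\<integral>t. real_of_ereal (\<phi> t (x t)) \<partial>M)"
    by (simp add: I a_def)
qed

text \<open>On a nonatomic space every \<open>L\<^sup>p\<close>-neighbourhood contains functions that take arbitrary values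
  of \<open>S\<close> on some set of positive measure; hence local optimality is pointwise global optimality.\<close>

theorem local_solution_pointwise:
  fixes S :: "'a \<Rightarrow> 'z::{banach, second_countable_topology} set"
  assumes cm: "complete_measure M" and sf: "sigma_finite_measure M" and na: "nonatomic M" and p: "1 \<le> p"
    and graph: "graph_over M S \<in> sets (M \<Otimes>\<^sub>M borel)"
    and \<phi>: "(\<lambda>(t, u). \<phi> t u) \<in> borel_measurable (M \<Otimes>\<^sub>M borel)"
    and sol: "local_solution p M \<phi> S x0"
    and a: "AE t in M. \<phi> t (x0 t) = ereal (a t)" "integrable M a"
      "upper_integral_functional M \<phi> x0 = ereal (\<integral>t. a t \<partial>M)"
  shows "AE t in M. \<forall>u\<in>S t. \<phi> t (x0 t) \<le> \<phi> t u"
proof -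
  interpret complete_measure M by fact
  interpret sigma_finite_measure M by fact
  have x0: "x0 \<in> Lp_space (ereal p) M" "AE t in M. x0 t \<in> S t"
    using sol by (auto simp: local_solution_def Sel_def)
  obtain r where r: "0 < r" and opt: "\<And>x. x \<in> Sel p M S \<Longrightarrow> Lp_norm p M (x - x0) < r \<Longrightarrow>
      upper_integral_functional M \<phi> x0 \<le> upper_integral_functional M \<phi> x"
    using sol unfolding local_solution_def by blast
  have [measurable]: "x0 \<in> borel_measurable M" using x0 by (simp add: mem_Lp_space_iff)
  have [measurable]: "(\<lambda>z. \<phi> (fst z) (snd z)) \<in> borel_measurable (M \<Otimes>\<^sub>M borel)"
    using \<phi> by (simp add: case_prod_beta')
  have "(\<lambda>z. x0 (fst z)) \<in> borel_measurable (M \<Otimes>\<^sub>M borel)" by measurable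
  from measurable_compose[OF measurable_Pair[OF measurable_fst this] \<phi>]
  have [measurable]: "(\<lambda>z. \<phi> (fst z) (x0 (fst z))) \<in> borel_measurable (M \<Otimes>\<^sub>M borel)" by simp
  define G where "G = graph_over M S \<inter> {z \<in> space (M \<Otimes>\<^sub>M borel). \<phi> (fst z) (snd z) < \<phi> (fst z) (x0 (fst z))}"
  have G [measurable]: "G \<in> sets (M \<Otimes>\<^sub>M borel)"
    unfolding G_def by (intro sets.Int graph) measurable
  note D = measurable_projection_selection[OF cm sf G]
  obtain g where g [measurable]: "g \<in> borel_measurable M" and gG: "AE t in M. t \<in> fst ` G \<longrightarrow> (t, g t) \<in> G"
    using D(2) by blast
  note [measurable] = D(1)
  have [measurable]: "(\<lambda>t. \<phi> t (g t)) \<in> borel_measurable M" "a \<in> borel_measurable M"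
    using measurable_compose[OF measurable_Pair[OF measurable_ident g] \<phi>] a(2) by (auto simp: id_def)
  \<comment> \<open>Bounded displacement and a definite gain: up to null sets these sets exhaust the
    set where improvement is possible, so one of them has positive measure if that set has.\<close>
  define A where "A m = {t \<in> space M. (t, g t) \<in> G \<and> norm (g t - x0 t) \<le> real (Suc m) \<and>
      \<phi> t (g t) + ereal (1 / Suc m) \<le> ereal (a t)}" for m :: nat
  have A [measurable]: "A m \<in> sets M" for m unfolding A_def by measurable
  have "fst ` G \<in> null_sets M"
  proof (rule ccontr)
    assume nnull: "fst ` G \<notin> null_sets M"
    have "AE t in M. t \<in> fst ` G \<longrightarrow> t \<in> (\<Union>m. A m)"
      using gG a(1) AE_space
    proof eventually_elim
      case (elim t)
      show ?case
      proof
        assume "t \<in> fst ` G"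
        then have tG: "(t, g t) \<in> G" using elim by blast
        then have less: "\<phi> t (g t) < ereal (a t)" using elim(2) by (simp add: G_def)
        obtain n1 where n1: "norm (g t - x0 t) \<le> real n1" using real_arch_simple by blast
        obtain n2 :: nat where n2: "\<phi> t (g t) + ereal (1 / Suc n2) \<le> ereal (a t)"
        proof (cases "\<phi> t (g t)")
          case (real c)
          then obtain n where "1 / Suc n < a t - c" using less nat_approx_posE[of "a t - c"] by auto
          then show ?thesis using real by (intro that[of n]) simp
        next
          case MInf
          then show ?thesis by (intro that[of 0]) simp
        qed (use less in simp)
        have "1 / Suc (max n1 n2) \<le> 1 / Suc n2" by (intro divide_left_mono) auto
        then have "\<phi> t (g t) + ereal (1 / Suc (max n1 n2)) \<le> ereal (a t)"
          using n2 by (meson add_left_mono ereal_less_eq(3) order_trans)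
        then have "t \<in> A (max n1 n2)" using tG n1 elim by (auto simp: A_def)
        then show "t \<in> (\<Union>m. A m)" by blast
      qed
    qed
    then have "emeasure M (fst ` G) \<le> emeasure M (\<Union>m. A m)" by (intro emeasure_mono_AE) auto
    moreover have "emeasure M (fst ` G) \<noteq> 0" using nnull D(1) by (auto simp: null_sets_def)
    ultimately have "emeasure M (\<Union>m. A m) \<noteq> 0" by auto
    then obtain m where m: "emeasure M (A m) \<noteq> 0"
      using null_sets_UN[of A M] A by (auto simp: null_sets_def)
    \<comment> \<open>Chosen so that a change of size at most \<open>Suc m\<close> on a set of
      measure below \<open>e\<close> has \<open>L\<^sup>p\<close>-norm at most
      \<open>r / 2\<close>.\<close>
    define e where "e = (r/2) powr p / real (Suc m) powr p"
    have "0 < e" using r by (simp add: e_def)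
    obtain B where B [measurable]: "B \<in> sets M" and BA: "B \<subseteq> A m" and Bfin: "emeasure M B < \<infinity>"
      and Bpos: "0 < measure M B" "measure M B < e"
      using nonatomic_small_subset[OF sf na A m \<open>0 < e\<close>] by blast
    have indint: "integrable M (\<lambda>t. c * indicator B t)" for c :: real using Bfin by simp
    define x where "x t = (if t \<in> B then g t else x0 t)" for t
    have [measurable]: "x \<in> borel_measurable M" unfolding x_def[abs_def] by measurable
    have near: "x \<in> Lp_space (ereal p) M" "Lp_norm p M (x - x0) \<le> r / 2"
    proof -
      have 1: "AE t in M. norm (x t - x0 t) powr p \<le> real (Suc m) powr p * indicator B t"
      proof (rule AE_I2)
        fix t
        show "norm (x t - x0 t) powr p \<le> real (Suc m) powr p * indicator B t"
          using BA p by (auto simp: x_def indicator_def A_def intro!: powr_mono2)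
      qed
      have "(\<integral>t. real (Suc m) powr p * indicator B t \<partial>M) = real (Suc m) powr p * measure M B"
        using B by (simp add: Int_absorb2 sets.sets_into_space)
      also have "\<dots> \<le> real (Suc m) powr p * e" using Bpos by (intro mult_left_mono) auto
      also have "\<dots> = (r/2) powr p" by (simp add: e_def)
      finally have 2: "(\<integral>t. real (Suc m) powr p * indicator B t \<partial>M) \<le> (r/2) powr p" .
      show "x \<in> Lp_space (ereal p) M" "Lp_norm p M (x - x0) \<le> r / 2"
        by (rule Lp_norm_near[OF p x0(1) _ indint 2 _ 1]; use r in simp)+
    qed
    have "AE t in M. x t \<in> S t" using x0(2)
    proof eventually_elim
      case (elim t)
      then show ?case using BA by (auto simp: x_def A_def G_def graph_over_def)
    qed
    with near(1) have "x \<in> Sel p M S" by (simp add: Sel_def)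
    moreover have "Lp_norm p M (x - x0) < r" using near(2) r by simp
    ultimately have "ereal (\<integral>t. a t \<partial>M) \<le> upper_integral_functional M \<phi> x"
      using opt a(3) by metis
    \<comment> \<open>On \<open>B\<close> the integrand along \<open>x\<close> may be far below
      \<open>a\<close>, even nonintegrable; an explicit integrable majorant is enough to bound the
      upper integral.\<close>
    also have "\<dots> \<le> ereal (\<integral>t. a t - (1 / Suc m) * indicator B t \<partial>M)"
      unfolding upper_integral_functional_def
    proof (rule Inf_lower, intro CollectI exI[of _ "\<lambda>t. a t - (1 / Suc m) * indicator B t"] conjI refl)
      show "(\<lambda>t. a t - (1 / Suc m) * indicator B t) \<in> Lp_space 1 M"
        unfolding mem_L1_space_iff by (intro Bochner_Integration.integrable_diff a(2) indint)
      show "AE t in M. \<phi> t (x t) \<le> ereal (a t - (1 / Suc m) * indicator B t)"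
        using a(1)
      proof eventually_elim
        case (elim t)
        show ?case
        proof (cases "t \<in> B")
          case True
          then have "\<phi> t (g t) + ereal (1 / Suc m) \<le> ereal (a t)" using BA by (auto simp: A_def)
          then have "\<phi> t (g t) \<le> ereal (a t - 1 / Suc m)"
            by (cases "\<phi> t (g t)") auto
          then show ?thesis using True by (simp add: x_def)
        qed (simp add: x_def elim)
      qed
    qed
    also have "(\<integral>t. a t - (1 / Suc m) * indicator B t \<partial>M) = (\<integral>t. a t \<partial>M) - (\<integral>t. (1 / Suc m) * indicator B t \<partial>M)"
      by (rule Bochner_Integration.integral_diff[OF a(2) indint])
    also have "(\<integral>t. (1 / Suc m) * indicator B t \<partial>M) = (1 / Suc m) * measure M B"
      using B by (simp add: Int_absorb2 sets.sets_into_space)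
    finally have "(1 / Suc m) * measure M B \<le> 0" by simp
    moreover have "0 < (1 / Suc m) * measure M B" using Bpos(1) by (intro mult_pos_pos) auto
    ultimately show False by linarith
  qed
  then have "AE t in M. t \<notin> fst ` G" by (rule AE_not_in)
  then show ?thesis using AE_space
  proof eventually_elim
    case (elim t)
    show ?case
    proof (intro ballI, rule ccontr)
      fix u assume "u \<in> S t" "\<not> \<phi> t (x0 t) \<le> \<phi> t u"
      then have "(t, u) \<in> G" using elim by (auto simp: G_def graph_over_def space_pair_measure not_le)
      then show False using elim by force
    qed
  qed
qed

text \<open>The multipliers at a point are the functionals that are nonpositive on this cone.\<close>

definition multiplier_cone :: "('z::real_normed_vector \<Rightarrow> ereal) \<Rightarrow> 'z set \<Rightarrow> 'z \<Rightarrow> real \<Rightarrow> ('z \<times> real) set" where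
  "multiplier_cone f C x a = {(v, - s) - w |v s w. v \<in> Clarke_tangent_cone UNIV norm C x \<and> 0 \<le> s \<and>
     w \<in> Clarke_tangent_cone UNIV norm (epi f) (x, a)}"

lemma multiplier_coneI:
  "v \<in> Clarke_tangent_cone UNIV norm C x \<Longrightarrow> 0 \<le> s \<Longrightarrow>
    w \<in> Clarke_tangent_cone UNIV norm (epi f) (x, a) \<Longrightarrow> (v, - s) - w \<in> multiplier_cone f C x a"
  unfolding multiplier_cone_def by blast

lemma convex_cone_multiplier_cone: "convex_cone (multiplier_cone f C x a)"
  unfolding convex_cone_iff
proof (intro conjI ballI allI impI)
  note T = convex_cone_Clarke_tangent_cone
  show "0 \<in> multiplier_cone f C x a"
    using multiplier_coneI[OF convex_cone_contains_0[OF T] order_refl convex_cone_contains_0[OF T], of f C x a]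
    by (simp add: zero_prod_def)
  fix k assume "k \<in> multiplier_cone f C x a"
  then obtain v s w where k: "k = (v, - s) - w" "v \<in> Clarke_tangent_cone UNIV norm C x" "0 \<le> s"
    "w \<in> Clarke_tangent_cone UNIV norm (epi f) (x, a)"
    unfolding multiplier_cone_def by blast
  {
    fix k' assume "k' \<in> multiplier_cone f C x a"
    then obtain v' s' w' where k': "k' = (v', - s') - w'" "v' \<in> Clarke_tangent_cone UNIV norm C x" "0 \<le> s'"
      "w' \<in> Clarke_tangent_cone UNIV norm (epi f) (x, a)"
      unfolding multiplier_cone_def by blast
    have "k + k' = (v + v', - (s + s')) - (w + w')" by (simp add: k(1) k'(1) prod_eq_iff)
    then show "k + k' \<in> multiplier_cone f C x a"
      using multiplier_coneI[OF convex_cone_add[OF T k(2) k'(2)] _ convex_cone_add[OF T k(4) k'(4)], of "s + s'"]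
        k(3) k'(3) by simp
  }
  fix c :: real assume c: "0 \<le> c"
  have "c *\<^sub>R k = (c *\<^sub>R v, - (c * s)) - c *\<^sub>R w" by (simp add: k(1) algebra_simps prod_eq_iff)
  then show "c *\<^sub>R k \<in> multiplier_cone f C x a"
    using multiplier_coneI[OF convex_cone_scaleR[OF T c k(2)] _ convex_cone_scaleR[OF T c k(4)], of "c * s"]
      k(3) c by simp
qed

text \<open>The correction vanishes in the second coordinate, because the half-line is invariant
  under decrease.\<close>

lemma Clarke_tangent_cone_Times_atMost:
  fixes C :: "'z::real_normed_vector set"
  assumes v: "v \<in> Clarke_tangent_cone UNIV norm C x" and "0 \<le> (s::real)"
  shows "(v, - s) \<in> Clarke_tangent_cone UNIV norm (C \<times> {..a}) (x, a)"
proof (rule Clarke_tangent_coneI)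
  fix e :: real assume e: "0 < e"
  obtain r where r: "0 < r" and step: "\<And>y \<eta>. y \<in> C \<Longrightarrow> norm (y - x) \<le> r \<Longrightarrow> 0 \<le> \<eta> \<Longrightarrow> \<eta> \<le> r \<Longrightarrow>
      \<exists>b\<in>UNIV. norm b \<le> 1 \<and> y + \<eta> *\<^sub>R (v + e *\<^sub>R b) \<in> C"
    using Clarke_tangent_coneD[OF v e] by blast
  have "\<exists>b\<in>UNIV. norm b \<le> 1 \<and> y + \<eta> *\<^sub>R ((v, - s) + e *\<^sub>R b) \<in> C \<times> {..a}"
    if y: "y \<in> C \<times> {..a}" "norm (y - (x, a)) \<le> r" and \<eta>: "0 \<le> \<eta>" "\<eta> \<le> r" for y \<eta>
  proof -
    have "norm (fst y - x) \<le> r"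
      using y(2) norm_fst_le[of "fst y - x" "snd y - a"] by (cases y) auto
    then obtain b where b: "norm b \<le> 1" "fst y + \<eta> *\<^sub>R (v + e *\<^sub>R b) \<in> C"
      using step[of "fst y" \<eta>] y(1) \<eta> by auto
    have "snd y + \<eta> * (- s) \<le> a" using y(1) mult_nonneg_nonneg[OF \<eta>(1) \<open>0 \<le> s\<close>] by auto
    with b show ?thesis by (intro bexI[of _ "(b, 0)"]) (auto simp: mem_Times_iff)
  qed
  with r show "\<exists>r>0. \<forall>y\<in>C \<times> {..a}. norm (y - (x, a)) \<le> r \<longrightarrow> (\<forall>\<eta>. 0 \<le> \<eta> \<longrightarrow> \<eta> \<le> r \<longrightarrow>
      (\<exists>b\<in>UNIV. norm b \<le> 1 \<and> y + \<eta> *\<^sub>R ((v, - s) + e *\<^sub>R b) \<in> C \<times> {..a}))"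
    by blast
qed simp

lemma multiplier_cone_not_dense:
  fixes C :: "'z::banach set"
  assumes cel: "compactly_epi_Lipschitz_at (sum_norm norm norm) (epi f) (x, a)"
    and "closed C" "x \<in> C" and opt: "\<And>u. u \<in> C \<Longrightarrow> ereal a \<le> f u"
  shows "\<exists>y. \<exists>e>0. \<forall>k\<in>multiplier_cone f C x a. e \<le> norm (y - k)"
proof -
  have "\<exists>y. \<exists>e>0. \<forall>v\<in>Clarke_tangent_cone UNIV norm (epi f) (x, a).
      \<forall>w\<in>Clarke_tangent_cone UNIV norm (C \<times> {..a}) (x, a). e \<le> norm (y - (v - w))"
  \<comment> \<open>The shift is vertical: lowering \<open>C \<times> {..a}\<close> by any
    \<open>c > 0\<close> detaches it from the epigraph, because \<open>f\<close> is at least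
    \<open>a\<close> on \<open>C\<close>.\<close>
  proof (rule extremal_tangent_cones_not_dense[OF cel, where ?z0.0="(0, 1)"])
    show "sum_norm norm norm z \<le> 2 * norm z" for z :: "'z \<times> real"
      using norm_fst_le[of "fst z" "snd z"] norm_snd_le[of "snd z" "fst z"]
      by (cases z) (simp add: sum_norm_def)
    show "closed (C \<times> {..a})" using \<open>closed C\<close> by (intro closed_Times) auto
    show "(x, a) \<in> C \<times> {..a}" using \<open>x \<in> C\<close> by simp
    fix y z :: "'z \<times> real" and c :: real
    assume y: "y \<in> epi f" and z: "z \<in> C \<times> {..a}" and "0 < c"
    show "y - z + c *\<^sub>R (0, 1) \<noteq> 0"
    proof
      assume "y - z + c *\<^sub>R (0, 1) = 0"
      then have "fst y = fst z" "snd y = snd z - c" by (auto simp: prod_eq_iff)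
      moreover have "f (fst y) \<le> ereal (snd y)" using y by (auto simp: epi_def)
      moreover have "ereal a \<le> f (fst z)" "snd z \<le> a" using z opt by auto
      ultimately have "ereal a \<le> ereal (snd z - c)" by (metis order_trans)
      then show False using \<open>snd z \<le> a\<close> \<open>0 < c\<close> by simp
    qed
  qed
  then obtain y e where "0 < e" and e: "\<And>v w. v \<in> Clarke_tangent_cone UNIV norm (epi f) (x, a) \<Longrightarrow>
      w \<in> Clarke_tangent_cone UNIV norm (C \<times> {..a}) (x, a) \<Longrightarrow> e \<le> norm (y - (v - w))" by blast
  \<comment> \<open>Elements of the multiplier cone are negatives of the differences of tangent
    vectors just bounded, hence the point \<open>- y\<close>.\<close>
  have "e \<le> norm (- y - k)" if k: "k \<in> multiplier_cone f C x a" for k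
  proof -
    obtain v s w where "k = (v, - s) - w" "v \<in> Clarke_tangent_cone UNIV norm C x" "0 \<le> s"
      "w \<in> Clarke_tangent_cone UNIV norm (epi f) (x, a)"
      using k unfolding multiplier_cone_def by blast
    moreover from this have "e \<le> norm (y - (w - (v, - s)))"
      by (intro e Clarke_tangent_cone_Times_atMost)
    moreover have "norm (- y - ((v, - s) - w)) = norm (y - (w - (v, - s)))"
      using norm_minus_cancel[of "y - (w - (v, - s))"] by (simp add: algebra_simps)
    ultimately show ?thesis by simp
  qed
  with \<open>0 < e\<close> show ?thesis by blast
qed

section \<open>Conjugate exponents and dominated functionals\<close>

lemma conjugate_exponent_cases:
  assumes "1 \<le> p" "conjugate_exponent p q"
  obtains (one) "p = 1" "q = \<infinity>" | (gt) r where "q = ereal r" "1 < p" "1 < r" "1 / p + 1 / r = 1"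
proof (cases "p = 1")
  case True
  then show ?thesis using assms one by (simp add: conjugate_exponent_def)
next
  case False
  then have p: "1 < p" and eq: "ereal (1 / p) + 1 / q = 1"
    using assms by (auto simp: conjugate_exponent_def)
  show ?thesis
  proof (cases q)
    case (real r)
    have "r \<noteq> 0" using eq real by (auto simp: divide_ereal_def)
    then have r: "1 / p + 1 / r = 1" using eq real by (simp add: one_ereal_def)
    have "1 / r = 1 - 1 / p" using r by simp
    moreover have "0 < 1 - 1 / p" "1 - 1 / p < 1" using p by auto
    ultimately have "0 < 1 / r" "1 / r < 1" by simp_all
    then have "1 < r" by (simp add: divide_less_eq_1 split: if_splits)
    then show ?thesis using gt real p r by blast
  qed (use eq p in \<open>auto simp: one_ereal_def\<close>)
qed

text \<open>For \<open>p > 1\<close> this is Young's inequality; for \<open>p = 1\<close> the weight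
  is essentially bounded.\<close>

lemma (in complete_measure) Lp_conjugate_product_integrable:
  fixes w :: "'a \<Rightarrow> 'z::{banach, second_countable_topology}" and \<theta> :: "'a \<Rightarrow> real"
  assumes pq: "1 \<le> p" "conjugate_exponent p q" and w: "w \<in> Lp_space (ereal p) M" and \<theta>: "\<theta> \<in> Lp_space q M"
  shows "integrable M (\<lambda>t. \<theta> t * norm (w t))"
proof -
  have [measurable]: "\<theta> \<in> borel_measurable M"
    using \<theta> by (simp add: Lp_space_def strongly_measurable_iff_borel_measurable)
  have [measurable]: "w \<in> borel_measurable M" and wi: "integrable M (\<lambda>t. norm (w t) powr p)"
    using w by (auto simp: mem_Lp_space_iff)
  from pq show ?thesis
  proof (cases rule: conjugate_exponent_cases)
    case one
    then obtain C where C: "AE t in M. norm (\<theta> t) \<le> C" using \<theta> by (auto simp: Lp_space_def)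
    have "integrable M (\<lambda>t. C * norm (w t))" using wi one by simp
    then show ?thesis
    proof (rule Bochner_Integration.integrable_bound)
      show "AE t in M. norm (\<theta> t * norm (w t)) \<le> norm (C * norm (w t))"
        using C
      proof eventually_elim
        case (elim t)
        then have "\<bar>\<theta> t\<bar> * norm (w t) \<le> \<bar>C\<bar> * norm (w t)" by (intro mult_right_mono) auto
        then show ?case by (simp add: abs_mult)
      qed
    qed measurable
  next
    case (gt r)
    then have \<theta>i: "integrable M (\<lambda>t. norm (\<theta> t) powr r)" using \<theta> by (simp add: Lp_space_def)
    have "integrable M (\<lambda>t. norm (\<theta> t) powr r / r + norm (w t) powr p / p)" using \<theta>i wi by simp
    then show ?thesis
    proof (rule Bochner_Integration.integrable_bound)
      show "AE t in M. norm (\<theta> t * norm (w t)) \<le> norm (norm (\<theta> t) powr r / r + norm (w t) powr p / p)"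
      proof (rule AE_I2)
        fix t
        have "norm (\<theta> t) * norm (w t) \<le> norm (\<theta> t) powr r / r + norm (w t) powr p / p"
          using gt by (intro Youngs_inequality) auto
        then show "norm (\<theta> t * norm (w t)) \<le> norm (norm (\<theta> t) powr r / r + norm (w t) powr p / p)"
          by (simp add: abs_mult)
      qed
    qed measurable
  qed
qed

lemma Lp_space_blinfun_dominated:
  fixes \<xi> :: "'a \<Rightarrow> 'z::{real_normed_vector, second_countable_topology} \<Rightarrow>\<^sub>L real" and \<theta> :: "'a \<Rightarrow> real"
  assumes refl: "reflexive_space TYPE('z)"
    and \<xi>: "\<And>z. (\<lambda>t. blinfun_apply (\<xi> t) z) \<in> borel_measurable M"
    and \<theta>: "\<theta> \<in> Lp_space q M" and "0 \<le> q" and le: "AE t in M. norm (\<xi> t) \<le> norm (\<theta> t)"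
  shows "\<xi> \<in> Lp_space q M"
proof (cases "q = \<infinity>")
  case True
  then obtain C where "AE t in M. norm (\<theta> t) \<le> C" using \<theta> by (auto simp: Lp_space_def)
  with le have "AE t in M. norm (\<xi> t) \<le> C" by eventually_elim simp
  then show ?thesis using True strongly_measurable_blinfun[OF refl \<xi>] by (auto simp: Lp_space_def)
next
  case False
  then have \<theta>i: "integrable M (\<lambda>t. norm (\<theta> t) powr real_of_ereal q)" using \<theta> by (simp add: Lp_space_def)
  have [measurable]: "(\<lambda>t. norm (\<xi> t)) \<in> borel_measurable M" by (rule norm_blinfun_measurable[OF \<xi>])
  from \<theta>i have "integrable M (\<lambda>t. norm (\<xi> t) powr real_of_ereal q)"
  proof (rule Bochner_Integration.integrable_bound)
    show "AE t in M. norm (norm (\<xi> t) powr real_of_ereal q) \<le> norm (norm (\<theta> t) powr real_of_ereal q)"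
      using le
    proof eventually_elim
      case (elim t)
      then show ?case using \<open>0 \<le> q\<close> by (simp add: powr_mono2 real_of_ereal_pos)
    qed
  qed measurable
  then show ?thesis using False strongly_measurable_blinfun[OF refl \<xi>] by (simp add: Lp_space_def)
qed

theorem theorem4:
  fixes M :: "'a measure"
    and S :: "'a \<Rightarrow> 'z::{banach, second_countable_topology} set"
    and \<phi> :: "'a \<Rightarrow> 'z \<Rightarrow> ereal"
    and p :: real and q :: ereal
    and x0 :: "'a \<Rightarrow> 'z" and \<theta> :: "'a \<Rightarrow> real"
  assumes "complete_measure M" and "sigma_finite_measure M" and "nonatomic M"
    and "reflexive_space TYPE('z)"
    and "1 \<le> p" and "conjugate_exponent p q"
    and "measurable_multifunction M S"
    and "\<And>t. t \<in> space M \<Longrightarrow> S t \<noteq> {} \<and> closed (S t)"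
    and "normal_integrand M \<phi>"
    and "local_solution p M \<phi> S x0"
    and "\<bar>upper_integral_functional M \<phi> x0\<bar> \<noteq> \<infinity>"
    and "AE t in M. compactly_epi_Lipschitz_at (sum_norm norm norm) (epi (\<phi> t))
           (x0 t, real_of_ereal (\<phi> t (x0 t)))"
    and "\<theta> \<in> Lp_space q M \<inter> Lp_space \<infinity> M" and "AE t in M. 0 < \<theta> t"
  shows "\<exists>\<xi> \<eta>.
    \<xi> \<in> Lp_space q M \<and> \<eta> \<in> Lp_space \<infinity> M \<and>
    (AE t in M. 0 \<le> \<eta> t \<and> \<eta> t \<le> \<theta> t \<and> norm (\<xi> t :: 'z \<Rightarrow>\<^sub>L real) + \<eta> t = \<theta> t) \<and>
    (\<forall>v \<in> Clarke_tangent_cone (Lp_space (ereal p) M) (Lp_norm p M) (Sel p M S) x0.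
       (\<integral>t. blinfun_apply (\<xi> t) (v t) \<partial>M) \<le> 0) \<and>
    (\<forall>(w, \<sigma>) \<in> Clarke_tangent_cone
         (Lp_space (ereal p) M \<times> Lp_space 1 M) (sum_norm (Lp_norm p M) (Lp_norm 1 M))
         (Sel1 p M (\<lambda>t. epi (\<phi> t))) (x0, \<lambda>t. real_of_ereal (\<phi> t (x0 t))).
       (\<integral>t. blinfun_apply (\<xi> t) (w t) \<partial>M) + (\<integral>t. \<eta> t * \<sigma> t \<partial>M) \<ge> 0)"
proof -
  note cm = assms(1) and sf = assms(2) and p = assms(5) and cel = assms(12)
  interpret complete_measure M by fact
  interpret sigma_finite_measure M by fact
  define a0 where "a0 t = real_of_ereal (\<phi> t (x0 t))" for t
  define E where "E t = epi (\<phi> t)" for t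
  note a0_eta = a0_def[abs_def, symmetric] and E_eta = E_def[abs_def, symmetric]
  have \<phi>: "(\<lambda>(t, u). \<phi> t u) \<in> borel_measurable (M \<Otimes>\<^sub>M borel)"
    and proper: "\<And>t u. t \<in> space M \<Longrightarrow> \<phi> t u \<noteq> - \<infinity>"
    using assms(9) by (auto simp: normal_integrand_def)
  have x0S: "x0 \<in> Sel p M S" and x0L: "x0 \<in> Lp_space (ereal p) M" and x0mem: "AE t in M. x0 t \<in> S t"
    using assms(10) by (auto simp: local_solution_def Sel_def)
  have [measurable]: "x0 \<in> borel_measurable M" using x0L by (simp add: mem_Lp_space_iff)
  have graphS: "graph_over M S \<in> sets (M \<Otimes>\<^sub>M borel)"
    using assms(7,8) by (intro graph_measurable) auto
  have closedS: "AE t in M. closed (S t)" using assms(8) by (intro AE_I2) auto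
  have graphE: "graph_over M E \<in> sets (M \<Otimes>\<^sub>M borel)"
  proof -
    have "(\<lambda>z. fst (snd z)) \<in> borel_measurable (M \<Otimes>\<^sub>M (borel :: ('z \<times> real) measure))"
      by (rule borel_measurable_continuous_on[OF _ measurable_snd]) (intro continuous_intros)
    from measurable_compose[OF measurable_Pair[OF measurable_fst this] \<phi>]
    have [measurable]: "(\<lambda>z. \<phi> (fst z) (fst (snd z))) \<in> borel_measurable (M \<Otimes>\<^sub>M (borel :: ('z \<times> real) measure))"
      by simp
    have [measurable]: "(\<lambda>z. snd (snd z)) \<in> borel_measurable (M \<Otimes>\<^sub>M (borel :: ('z \<times> real) measure))"
      by (rule borel_measurable_continuous_on[OF _ measurable_snd]) (intro continuous_intros)
    have "graph_over M E = {z \<in> space (M \<Otimes>\<^sub>M borel). \<phi> (fst z) (fst (snd z)) \<le> ereal (snd (snd z))}"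
      by (auto simp: graph_over_def E_def epi_def space_pair_measure)
    also have "\<dots> \<in> sets (M \<Otimes>\<^sub>M borel)" by measurable
    finally show ?thesis .
  qed
  have closedE: "AE t in M. closed (E t)"
    using cel by eventually_elim (simp add: E_def compactly_epi_Lipschitz_at_def)
  have \<phi>x0: "(\<lambda>t. \<phi> t (x0 t)) \<in> borel_measurable M"
    using measurable_compose[OF measurable_Pair[OF measurable_ident_sets[OF refl] \<open>x0 \<in> borel_measurable M\<close>] \<phi>] by simp
  have ninf: "AE t in M. \<phi> t (x0 t) \<noteq> - \<infinity>" using proper by (intro AE_I2) auto
  have a0: "AE t in M. \<phi> t (x0 t) = ereal (a0 t)" "integrable M a0"
    "upper_integral_functional M \<phi> x0 = ereal (\<integral>t. a0 t \<partial>M)"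
    using upper_integral_functional_finite[of M \<phi> x0, OF cm sf \<phi>x0 ninf assms(11)]
    by (simp_all add: a0_def[abs_def])
  have x0E: "(x0, a0) \<in> Sel1 p M E"
    using x0L a0 by (auto simp: Sel1_def mem_L1_space_iff E_def epi_def elim!: AE_mp)
  have opt: "AE t in M. \<forall>u\<in>S t. \<phi> t (x0 t) \<le> \<phi> t u"
    by (rule local_solution_pointwise[OF cm sf assms(3) p graphS \<phi> assms(10) a0])
  define K where "K t = multiplier_cone (\<phi> t) (S t) (x0 t) (a0 t)" for t
  have cone: "AE t in M. convex_cone (K t)" by (simp add: K_def convex_cone_multiplier_cone)
  have not_dense: "AE t in M. \<exists>x. \<exists>e>0. \<forall>k\<in>K t. e \<le> norm (x - k)"
    using cel closedS x0mem opt a0(1)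
  proof eventually_elim
    case (elim t)
    show ?case unfolding K_def
    proof (rule multiplier_cone_not_dense)
      show "compactly_epi_Lipschitz_at (sum_norm norm norm) (epi (\<phi> t)) (x0 t, a0 t)"
        using elim(1) by (simp only: a0_def)
      show "ereal (a0 t) \<le> \<phi> t u" if "u \<in> S t" for u
        using elim(4) that unfolding elim(5)[symmetric] by blast
    qed fact+
  qed
  obtain f :: "'a \<Rightarrow> 'z \<times> real \<Rightarrow> real"
    where f: "\<forall>x. (\<lambda>t. f t x) \<in> borel_measurable M" "\<forall>t\<in>space M. bounded_linear (f t)"
      and fpos: "AE t in M. \<exists>x. 0 < f t x"
      and fK: "\<forall>c\<in>borel_measurable M. (AE t in M. c t \<in> K t) \<longrightarrow> (AE t in M. f t (c t) \<le> 0)"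
    using measurable_polar_selection[OF sf cone not_dense] by (elim exE conjE) (rule that)
  note fm = f(1)[rule_format] and flin = f(2)[rule_format] and fK = fK[rule_format]
  \<comment> \<open>Splits \<open>f t\<close> into a functional on \<open>'z\<close> and a
    coefficient. Linearity of \<open>f t\<close> is known only on \<open>space M\<close>, so
    \<open>Blinfun\<close> is evaluated only there.\<close>
  define \<xi>' where "\<xi>' t = Blinfun (\<lambda>z. f t (z, 0))" for t
  define \<eta>' where "\<eta>' t = f t (0, 1)" for t
  have \<xi>'_apply: "blinfun_apply (\<xi>' t) z = f t (z, 0)" if "t \<in> space M" for t z
  proof -
    have "bounded_linear (\<lambda>z. f t (z, 0))"
      using bounded_linear_compose[OF flin[OF that] bounded_linear_Pair[OF bounded_linear_ident bounded_linear_zero]]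
      by simp
    then show ?thesis by (simp add: \<xi>'_def bounded_linear_Blinfun_apply)
  qed
  have f_split: "f t (z, s) = blinfun_apply (\<xi>' t) z + s * \<eta>' t" if t: "t \<in> space M" for t z s
  proof -
    have "f t (z, s) = f t ((z, 0) + s *\<^sub>R (0, 1))" by simp
    also have "\<dots> = f t (z, 0) + s * f t (0, 1)"
      using bounded_linear.linear[OF flin[OF t]] by (simp only: linear_add linear_scale real_scaleR_def)
    finally show ?thesis by (simp add: \<xi>'_apply[OF t] \<eta>'_def)
  qed
  note zero = convex_cone_contains_0[OF convex_cone_Clarke_tangent_cone]
  have \<xi>'_m: "(\<lambda>t. blinfun_apply (\<xi>' t) z) \<in> borel_measurable M" for z
    by (subst measurable_cong[OF \<xi>'_apply]) (simp_all add: fm)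
  have [measurable]: "\<eta>' \<in> borel_measurable M" unfolding \<eta>'_def[abs_def] by (rule fm)
  have [measurable]: "(\<lambda>t. norm (\<xi>' t)) \<in> borel_measurable M"
    by (rule norm_blinfun_measurable[OF \<xi>'_m])
  \<comment> \<open>The direction \<open>(0, -1)\<close> comes from the half-line; that
    \<open>f t\<close> is nonpositive on it is the sign of \<open>\<eta>'\<close>.\<close>
  have \<eta>'_nonneg: "AE t in M. 0 \<le> \<eta>' t"
  proof -
    have "(0, -1) \<in> K t" for t
      using multiplier_coneI[OF zero zero_le_one zero, of "\<phi> t" "S t" "x0 t" "a0 t"] by (simp add: K_def)
    then have "AE t in M. f t (0, -1) \<le> 0" by (intro fK) auto
    then show ?thesis using AE_space by eventually_elim (simp add: f_split blinfun.zero_right)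
  qed
  define \<rho> where "\<rho> t = norm (\<xi>' t) + \<eta>' t" for t
  \<comment> \<open>\<open>f t\<close> is nonzero, so two nonnegative summands cannot both vanish.
    Dividing by \<open>\<rho> t\<close> and multiplying by \<open>\<theta> t\<close> gives the
    normalization in (a).\<close>
  have \<rho>_pos: "AE t in M. 0 < \<rho> t"
    using \<eta>'_nonneg fpos AE_space
  proof eventually_elim
    case (elim t)
    have "\<rho> t \<noteq> 0"
    proof
      assume "\<rho> t = 0"
      then have "\<xi>' t = 0" "\<eta>' t = 0"
        using elim(1) norm_ge_zero[of "\<xi>' t"] by (auto simp: \<rho>_def add_nonneg_eq_0_iff)
      then have "f t x = 0" for x using f_split[OF elim(3), of "fst x" "snd x"] by simp
      then show False using elim(2) by auto
    qed
    then show ?case using elim(1) norm_ge_zero[of "\<xi>' t"] by (simp add: \<rho>_def less_le)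
  qed
  have \<theta>L: "\<theta> \<in> Lp_space q M" "\<theta> \<in> Lp_space \<infinity> M" using assms(13) by auto
  have [measurable]: "\<theta> \<in> borel_measurable M"
    using \<theta>L(1) by (simp add: Lp_space_def strongly_measurable_iff_borel_measurable)
  have [measurable]: "\<rho> \<in> borel_measurable M" unfolding \<rho>_def[abs_def] by measurable
  define \<xi> where "\<xi> t = (\<theta> t / \<rho> t) *\<^sub>R \<xi>' t" for t
  define \<eta> where "\<eta> t = (\<theta> t / \<rho> t) * \<eta>' t" for t
  have \<xi>_m [measurable]: "(\<lambda>t. blinfun_apply (\<xi> t) z) \<in> borel_measurable M" for z
    unfolding \<xi>_def by (simp add: blinfun.scaleR_left) (intro borel_measurable_times borel_measurable_divide \<xi>'_m; measurable)
  have [measurable]: "\<eta> \<in> borel_measurable M" unfolding \<eta>_def[abs_def] by measurable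
  have normalized: "AE t in M. 0 \<le> \<eta> t \<and> \<eta> t \<le> \<theta> t \<and> norm (\<xi> t) + \<eta> t = \<theta> t"
    using \<eta>'_nonneg \<rho>_pos assms(14)
  proof eventually_elim
    case (elim t)
    have "0 \<le> \<eta> t" using elim by (simp add: \<eta>_def)
    moreover have "norm (\<xi> t) + \<eta> t = (\<theta> t / \<rho> t) * \<rho> t"
      using elim by (simp add: \<xi>_def \<eta>_def \<rho>_def distrib_left)
    then have "norm (\<xi> t) + \<eta> t = \<theta> t" using elim by simp
    ultimately show ?case using norm_ge_zero[of "\<xi> t"] by linarith
  qed
  have q0: "0 \<le> q" using p assms(6) by (cases rule: conjugate_exponent_cases) auto
  have \<xi>_le: "AE t in M. norm (\<xi> t) \<le> norm (\<theta> t)" using normalized by eventually_elim auto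
  have \<xi>L: "\<xi> \<in> Lp_space q M"
    by (rule Lp_space_blinfun_dominated[OF assms(4) \<xi>_m \<theta>L(1) q0 \<xi>_le])
  obtain C where C: "AE t in M. norm (\<theta> t) \<le> C" using \<theta>L(2) by (auto simp: Lp_space_def)
  have \<eta>C: "AE t in M. norm (\<eta> t) \<le> C" using normalized C by eventually_elim auto
  then have \<eta>L: "\<eta> \<in> Lp_space \<infinity> M"
    by (auto simp: Lp_space_def strongly_measurable_iff_borel_measurable)
  have scaled: "blinfun_apply (\<xi> t) z + \<eta> t * s = (\<theta> t / \<rho> t) * f t (z, s)" if "t \<in> space M" for t z s
    using f_split[OF that] by (simp add: \<xi>_def \<eta>_def blinfun.scaleR_left algebra_simps)
  have b: "(\<integral>t. blinfun_apply (\<xi> t) (v t) \<partial>M) \<le> 0"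
    if v: "v \<in> Clarke_tangent_cone (Lp_space (ereal p) M) (Lp_norm p M) (Sel p M S) x0" for v
  proof -
    have "v \<in> Lp_space (ereal p) M" using v by (simp add: Clarke_tangent_cone_def)
    then have [measurable]: "v \<in> borel_measurable M" by (simp add: mem_Lp_space_iff)
    have "AE t in M. v t \<in> Clarke_tangent_cone UNIV norm (S t) (x0 t)"
      by (rule Clarke_tangent_Sel_pointwise[OF cm sf p graphS closedS x0S v])
    then have "AE t in M. (v t, 0) \<in> K t"
    proof eventually_elim
      case (elim t)
      show ?case using multiplier_coneI[OF elim order_refl zero, of "\<phi> t" "a0 t"] by (simp add: K_def)
    qed
    then have "AE t in M. f t (v t, 0) \<le> 0" by (intro fK borel_measurable_Pair) auto
    then have "AE t in M. 0 \<le> - blinfun_apply (\<xi> t) (v t)"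
      using \<rho>_pos assms(14) AE_space
    proof eventually_elim
      case (elim t)
      then have "(\<theta> t / \<rho> t) * f t (v t, 0) \<le> 0" by (intro mult_nonneg_nonpos) auto
      then show ?case unfolding scaled[OF elim(4), of "v t" 0, symmetric] by simp
    qed
    then have "0 \<le> (\<integral>t. - blinfun_apply (\<xi> t) (v t) \<partial>M)" by (rule integral_nonneg_AE)
    then show ?thesis by simp
  qed
  have c: "0 \<le> (\<integral>t. blinfun_apply (\<xi> t) (w t) \<partial>M) + (\<integral>t. \<eta> t * \<sigma> t \<partial>M)"
    if w: "(w, \<sigma>) \<in> Clarke_tangent_cone (Lp_space (ereal p) M \<times> Lp_space 1 M)
         (sum_norm (Lp_norm p M) (Lp_norm 1 M)) (Sel1 p M E) (x0, a0)" for w \<sigma>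
  proof -
    have wL: "w \<in> Lp_space (ereal p) M" and \<sigma>i: "integrable M \<sigma>"
      using w by (auto simp: Clarke_tangent_cone_def mem_L1_space_iff)
    have [measurable]: "w \<in> borel_measurable M" "\<sigma> \<in> borel_measurable M"
      using wL \<sigma>i by (auto simp: mem_Lp_space_iff)
    have "AE t in M. (w t, \<sigma> t) \<in> Clarke_tangent_cone UNIV norm (E t) (x0 t, a0 t)"
      by (rule Clarke_tangent_Sel1_pointwise[OF cm sf p graphE closedE x0E w])
    \<comment> \<open>Taking \<open>v = 0\<close> and \<open>s = 0\<close> in the multiplier cone
      leaves the negative of a tangent vector of the epigraph, which turns polarity into the
      inequality of (c).\<close>
    then have "AE t in M. (- w t, - \<sigma> t) \<in> K t"
    proof eventually_elim
      case (elim t)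
      show ?case using multiplier_coneI[OF zero order_refl elim[unfolded E_def], of "S t"] by (simp add: K_def)
    qed
    then have "AE t in M. f t (- w t, - \<sigma> t) \<le> 0" by (intro fK borel_measurable_Pair) auto
    then have nonneg: "AE t in M. 0 \<le> blinfun_apply (\<xi> t) (w t) + \<eta> t * \<sigma> t"
      using \<rho>_pos assms(14) AE_space
    proof eventually_elim
      case (elim t)
      have "0 \<le> f t (w t, \<sigma> t)"
        using elim(1) f_split[OF elim(4), of "- w t" "- \<sigma> t"] f_split[OF elim(4), of "w t" "\<sigma> t"]
        by (simp add: blinfun.minus_right)
      then show ?case unfolding scaled[OF elim(4)] using elim by (intro mult_nonneg_nonneg) auto
    qed
    \<comment> \<open>Measurability at each fixed vector does not directly give measurability along
      \<open>w\<close>. Approximating \<open>\<xi>\<close> by simple functions reduces it to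
      finitely many fixed functionals at a time.\<close>
    have prod_m: "(\<lambda>t. blinfun_apply (\<xi> t) (w t)) \<in> borel_measurable M"
    proof -
      have "strongly_measurable M \<xi>" using \<xi>L by (simp add: Lp_space_def)
      then obtain s where s: "\<And>i. simple_function M (s i)" "AE t in M. (\<lambda>i. s i t) \<longlonglongrightarrow> \<xi> t"
        unfolding strongly_measurable_def by blast
      have "(\<lambda>t. blinfun_apply (s i t) (w t)) \<in> borel_measurable M" for i
      proof (rule measurable_compose_countable'[where f="\<lambda>g t. blinfun_apply g (w t)" and I="s i ` space M"])
        show "s i \<in> measurable M (count_space (s i ` space M))"
          using measurable_sets[OF measurable_simple_function[OF s(1)]] by (intro measurableI) auto
        show "countable (s i ` space M)" using simple_functionD(1)[OF s(1)] by (rule countable_finite)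
        show "(\<lambda>t. blinfun_apply g (w t)) \<in> borel_measurable M" for g
          by (rule borel_measurable_continuous_on[of "blinfun_apply g"]) (auto intro: continuous_intros)
      qed
      then have "(\<lambda>t. lim (\<lambda>i. blinfun_apply (s i t) (w t))) \<in> borel_measurable M"
        by (rule borel_measurable_lim_metric)
      moreover have "AE t in M. blinfun_apply (\<xi> t) (w t) = lim (\<lambda>i. blinfun_apply (s i t) (w t))"
        using s(2)
      proof eventually_elim
        case (elim t)
        have "(\<lambda>i. blinfun_apply (s i t) (w t)) \<longlonglongrightarrow> blinfun_apply (\<xi> t) (w t)"
          by (intro tendsto_intros elim)
        then show ?case by (simp add: limI)
      qed
      ultimately show ?thesis by (rule borel_measurable_AE_cong)
    qed
    \<comment> \<open>In (c) only the sum of the two integrands has a known sign, so the two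
      integrals must be joined, which requires integrability of each: \<open>\<theta>\<close>
      against \<open>w\<close> by conjugate exponents, and the bounded \<open>\<eta>\<close> against
      \<open>\<sigma>\<close>.\<close>
    have "integrable M (\<lambda>t. blinfun_apply (\<xi> t) (w t))"
    proof (rule Bochner_Integration.integrable_bound[OF Lp_conjugate_product_integrable[OF p assms(6) wL \<theta>L(1)] prod_m])
      show "AE t in M. norm (blinfun_apply (\<xi> t) (w t)) \<le> norm (\<theta> t * norm (w t))"
        using \<xi>_le
      proof eventually_elim
        case (elim t)
        have "norm (blinfun_apply (\<xi> t) (w t)) \<le> norm (\<xi> t) * norm (w t)" by (rule norm_blinfun)
        also have "\<dots> \<le> norm (\<theta> t) * norm (w t)" using elim by (rule mult_right_mono) simp
        finally show ?case by (simp add: abs_mult)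
      qed
    qed
    moreover have "integrable M (\<lambda>t. \<eta> t * \<sigma> t)"
    proof (rule Bochner_Integration.integrable_bound)
      show "integrable M (\<lambda>t. C * \<sigma> t)" using \<sigma>i by simp
      show "AE t in M. norm (\<eta> t * \<sigma> t) \<le> norm (C * \<sigma> t)"
        using \<eta>C
      proof eventually_elim
        case (elim t)
        then have "\<bar>\<eta> t\<bar> * \<bar>\<sigma> t\<bar> \<le> \<bar>C\<bar> * \<bar>\<sigma> t\<bar>" by (intro mult_right_mono) auto
        then show ?case by (simp add: abs_mult)
      qed
    qed measurable
    ultimately have "(\<integral>t. blinfun_apply (\<xi> t) (w t) \<partial>M) + (\<integral>t. \<eta> t * \<sigma> t \<partial>M)
        = (\<integral>t. blinfun_apply (\<xi> t) (w t) + \<eta> t * \<sigma> t \<partial>M)" by simp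
    also have "0 \<le> \<dots>" using nonneg by (rule integral_nonneg_AE)
    finally show ?thesis .
  qed
  show ?thesis
    using \<xi>L \<eta>L normalized b c unfolding E_eta a0_eta
    by (intro exI[of _ \<xi>] exI[of _ \<eta>] conjI) auto
qed

end
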